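(* Let $W\subset\mathbb{P}(V)$ be the Palatini quartic of a general prime Fano threefold of genus $8$, $\Gamma(W)=\mathrm{Sing}(W)$ its singular curve and $\mathcal{I}=\mathcal{I}_{\Gamma(W)}\subset\mathcal{O}_{\mathbb{P}(V)}$ its ideal sheaf. The vector space $$I_3:=H^0(\mathcal{I}(3))\subset H^0(\mathcal{O}_{\mathbb{P}(V)}(3))$$ has dimension $6$ and coincides with the jacobian space of $W$, $$JW:=\Big\langle\frac{\partial W}{\partial X_0},\dots,\frac{\partial W}{\partial X_5}\Big\rangle,$$ generated by the partial derivatives of (an equation of) $W$ with respect to any system of homogeneous coordinates $X_0,\dots,X_5$ in $\mathbb{P}(V)$.
   Context: We work over $\mathbb{C}$. $V$ is a $6$-dimensional vector space and $\mathbb{P}(V)\cong\mathbb{P}^5$ is the projective space of one-dimensional subspaces of $V$. For a general $5$-dimensional subspace $U\subset\wedge^2V^\vee=H^0(\mathbb{P}(V),\Omega^1_{\mathbb{P}(V)}(2))$ (corresponding to the general prime Fano threefold $G(2,V)\cap\mathbb{P}(U)^\perp$ of genus $8$, where $G(2,V)\subset\mathbb{P}(\wedge^2 V)$ is the grassmannian of lines of $\mathbb{P}(V)$ and $\mathbb{P}(U)^\perp\cong\mathbb{P}^9$ is the linear subspace on which $U$ vanishes) let $\phi:U\otimes\mathcal{O}_{\mathbb{P}(V)}\to\Omega^1_{\mathbb{P}(V)}(2)$ be the evaluation map and $D_k(\phi)$ the closed subscheme where $\mathrm{rk}(\phi)\le k$. The Palatini quartic is $W=D_4(\phi)$, a quartic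 hypersurface which is not a cone; its singular curve is $\Gamma(W)=D_3(\phi)$, a nonsingular curve of degree $25$ and genus $26$ with $\omega_{\Gamma(W)}\cong\mathcal{O}_{\Gamma(W)}(2)$. *)

theory Defs
  imports "HOL-Analysis.Analysis" "HOL-Library.Poly_Mapping" "HOL-Library.Numeral_Type"
begin

section \<open>Complex polynomials in finitely many variables\<close>

type_synonym 'i cpoly = "('i \<Rightarrow>\<^sub>0 nat) \<Rightarrow>\<^sub>0 complex"

definition Const :: "complex \<Rightarrow> 'i cpoly" where
  "Const c = Poly_Mapping.single 0 c"

definition Var :: "'i \<Rightarrow> 'i cpoly" where
  "Var i = Poly_Mapping.single (Poly_Mapping.single i 1) 1"

text \<open>The ring homomorphism out of the polynomial ring that is \<open>h\<close> on constants and sends the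
  \<open>i\<close>-th variable to \<open>x i\<close>; both evaluation at a point and substitution of polynomials are
  instances.\<close>

definition insertion :: "(complex \<Rightarrow> 'r::comm_ring_1) \<Rightarrow> ('i \<Rightarrow> 'r) \<Rightarrow> 'i cpoly \<Rightarrow> 'r" where
  "insertion h x p =
     (\<Sum>m\<in>Poly_Mapping.keys p. h (Poly_Mapping.lookup p m) *
        (\<Prod>i\<in>Poly_Mapping.keys m. x i ^ Poly_Mapping.lookup m i))"

abbreviation eval :: "('i \<Rightarrow> complex) \<Rightarrow> 'i cpoly \<Rightarrow> complex" where
  "eval \<equiv> insertion (\<lambda>c. c)"

abbreviation subst :: "('i \<Rightarrow> 'j cpoly) \<Rightarrow> 'i cpoly \<Rightarrow> 'j cpoly" where
  "subst \<equiv> insertion Const"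

definition homogeneous :: "nat \<Rightarrow> 'i::finite cpoly \<Rightarrow> bool" where
  "homogeneous d p \<longleftrightarrow> (\<forall>m\<in>Poly_Mapping.keys p. (\<Sum>i\<in>UNIV. Poly_Mapping.lookup m i) = d)"

text \<open>The formal partial derivative. The subtraction of exponents is truncated, which is harmless
  as the coefficient vanishes when the \<open>i\<close>-th exponent is zero.\<close>

definition pderivative :: "'i \<Rightarrow> 'i cpoly \<Rightarrow> 'i cpoly" where
  "pderivative i p =
     (\<Sum>m\<in>Poly_Mapping.keys p. Poly_Mapping.single (m - Poly_Mapping.single i 1)
        (of_nat (Poly_Mapping.lookup m i) * Poly_Mapping.lookup p m))"

text \<open>\<open>cp.span\<close> and \<open>cp.dim\<close> are linear span and dimension over the complex numbers;
  \<open>ideal.span\<close> is the ideal generated by a subset of a commutative ring.\<close>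

global_interpretation cp: vector_space "\<lambda>c (p :: 'i cpoly). Const c * p"
  by unfold_locales
    (simp_all add: Const_def algebra_simps single_add mult_single flip: mult.assoc)

global_interpretation ideal: module "(*) :: 'r::comm_ring_1 \<Rightarrow> 'r \<Rightarrow> 'r"
  by unfold_locales (simp_all add: algebra_simps)


section \<open>Closed subschemes of the projective space\<close>

text \<open>\<open>V\<close> is \<open>complex ^ 6\<close> with coordinate functions \<open>Var i\<close>. The ideal sheaf associated with a
  homogeneous ideal \<open>I\<close> is recorded by its restrictions to the six standard charts, i.e. by
  \<open>i \<mapsto>\<close> the set of polynomials lying in the localization of \<open>I\<close> at \<open>Var i\<close> (the chart is
  the locus where \<open>Var i\<close> does not vanish).\<close>

type_synonym ideal_sheaf = "6 \<Rightarrow> 6 cpoly set"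

definition chart_ideal :: "6 \<Rightarrow> 6 cpoly set \<Rightarrow> 6 cpoly set" where
  "chart_ideal i B = {g. \<exists>N. Var i ^ N * g \<in> ideal.span B}"

text \<open>Global sections of the twist by \<open>d\<close>: the forms of degree \<open>d\<close> that belong to the ideal sheaf
  on every chart.\<close>

definition H0 :: "ideal_sheaf \<Rightarrow> nat \<Rightarrow> 6 cpoly set" where
  "H0 I d = {f. homogeneous d f \<and> (\<forall>i. f \<in> I i)}"

definition hypersurface :: "6 cpoly \<Rightarrow> ideal_sheaf" where
  "hypersurface F = (\<lambda>i. chart_ideal i {F})"


section \<open>Degeneracy loci of the evaluation map\<close>

text \<open>An alternating form \<open>u\<close> on \<open>V\<close> is given by its matrix, whose entries are indexed by pairs
  so that \<open>complex ^ (6 \<times> 6)\<close> carries the library's linear algebra over the complex numbers.\<close>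

definition alternating_forms :: "(complex ^ (6 \<times> 6)) set" where
  "alternating_forms = {u. \<forall>i j. u $ (j, i) = - u $ (i, j)}"

text \<open>As a twisted 1-form, \<open>u\<close> is the sum of \<open>(\<Sum>i. u $ (i, j) * x\<^sub>i) dx\<^sub>j\<close> over \<open>j\<close>. These are
  the coefficients.\<close>

definition form_coeff :: "complex ^ (6 \<times> 6) \<Rightarrow> 6 \<Rightarrow> 6 cpoly" where
  "form_coeff u j = (\<Sum>i\<in>UNIV. Const (u $ (i, j)) * Var i)"

text \<open>On the chart \<open>x\<^sub>i \<noteq> 0\<close> put \<open>x\<^sub>j = x\<^sub>i y\<^sub>j\<close>. The 1-forms are free on the \<open>dy\<^sub>j\<close> with
  \<open>j \<noteq> i\<close>, and since \<open>u\<close> is alternating the terms in \<open>dx\<^sub>i\<close> cancel: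
  \<open>\<Sum>j. form_coeff u j dx\<^sub>j = x\<^sub>i (\<Sum>j \<noteq> i. form_coeff u j dy\<^sub>j)\<close>. So, up to the unit
  \<open>x\<^sub>i\<close>, the evaluation map \<open>\<phi>\<close> on \<open>U\<close> has on this chart the matrix entries \<open>form_coeff u j\<close>
  with \<open>u\<close> in a basis of \<open>U\<close> and \<open>j \<noteq> i\<close>. The minors are taken here on all tuples of members of
  \<open>U\<close>, which generates the same ideal and needs no basis.

  The closed subscheme where \<open>\<phi>\<close> has rank less than \<open>CARD('m)\<close> is the one defined by the minors
  of size \<open>CARD('m)\<close>.\<close>

definition chart_minors ::
  "'m::finite itself \<Rightarrow> (complex ^ (6 \<times> 6)) set \<Rightarrow> 6 \<Rightarrow> 6 cpoly set" where
  "chart_minors _ U i =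
     {det (\<chi> a b. form_coeff (u a) (j b)) | (u :: 'm \<Rightarrow> _) (j :: 'm \<Rightarrow> 6).
        range u \<subseteq> U \<and> i \<notin> range j}"

definition degeneracy_locus ::
  "'m::finite itself \<Rightarrow> (complex ^ (6 \<times> 6)) set \<Rightarrow> ideal_sheaf" where
  "degeneracy_locus m U = (\<lambda>i. chart_ideal i (chart_minors m U i))"

text \<open>\<open>W = D\<^sub>4(\<phi>)\<close> and \<open>\<Gamma>(W) = D\<^sub>3(\<phi>)\<close>, given by their ideal sheaves.\<close>

definition Palatini :: "(complex ^ (6 \<times> 6)) set \<Rightarrow> ideal_sheaf" where
  "Palatini U = degeneracy_locus TYPE(5) U"

definition singular_curve :: "(complex ^ (6 \<times> 6)) set \<Rightarrow> ideal_sheaf" where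
  "singular_curve U = degeneracy_locus TYPE(4) U"

definition quartic_equation :: "6 cpoly \<Rightarrow> ideal_sheaf \<Rightarrow> bool" where
  "quartic_equation F W \<longleftrightarrow> F \<noteq> 0 \<and> homogeneous 4 F \<and> W = hypersurface F"


section \<open>The jacobian space\<close>

text \<open>An invertible matrix \<open>A\<close> gives the homogeneous coordinates \<open>X\<^sub>i = \<Sum>j. A $ i $ j * x\<^sub>j\<close>. To
  differentiate with respect to \<open>X\<^sub>i\<close>, write \<open>F\<close> as a polynomial in the \<open>X\<close>'s, differentiate that
  polynomial, and return to the original coordinates.\<close>

definition linear_coords :: "complex ^ 6 ^ 6 \<Rightarrow> 6 \<Rightarrow> 6 cpoly" where
  "linear_coords A i = (\<Sum>j\<in>UNIV. Const (A $ i $ j) * Var j)"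

definition partial_wrt :: "complex ^ 6 ^ 6 \<Rightarrow> 6 \<Rightarrow> 6 cpoly \<Rightarrow> 6 cpoly" where
  "partial_wrt A i F =
     subst (linear_coords A) (pderivative i (subst (linear_coords (matrix_inv A)) F))"

definition jacobian_space :: "complex ^ 6 ^ 6 \<Rightarrow> 6 cpoly \<Rightarrow> 6 cpoly set" where
  "jacobian_space A F = cp.span (range (\<lambda>i. partial_wrt A i F))"


section \<open>General five-dimensional spaces of alternating forms\<close>

definition Gr5 :: "(complex ^ (6 \<times> 6)) set set" where
  "Gr5 = {U. vec.subspace U \<and> U \<subseteq> alternating_forms \<and> vec.dim U = 5}"

text \<open>The Zariski topology on the grassmannian is the quotient topology from the space of
  5-frames: a set of subspaces is open iff the frames spanning its members are, among all
  frames, the complement of the common zeros of some set of polynomials in the coordinates of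
  the frame.\<close>

definition zariski_open_Gr5 :: "(complex ^ (6 \<times> 6)) set set \<Rightarrow> bool" where
  "zariski_open_Gr5 S \<longleftrightarrow> S \<subseteq> Gr5 \<and>
     (\<exists>P :: (5 \<times> 6 \<times> 6) cpoly set. \<forall>w :: 5 \<Rightarrow> complex ^ (6 \<times> 6). vec.span (range w) \<in> Gr5 \<longrightarrow>
        (vec.span (range w) \<in> S \<longleftrightarrow> (\<exists>p\<in>P. eval (\<lambda>(k, ij). w k $ ij) p \<noteq> 0)))"

definition for_general :: "((complex ^ (6 \<times> 6)) set \<Rightarrow> bool) \<Rightarrow> bool" where
  "for_general Q \<longleftrightarrow> (\<exists>S. zariski_open_Gr5 S \<and> S \<noteq> {} \<and> (\<forall>U\<in>S. Q U))"

end

theory Submission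
  imports Defs "HOL-Computational_Algebra.Fundamental_Theorem_Algebra"
begin

text \<open>
  Let \<open>u\<^sub>1, \<dots>, u\<^sub>5\<close> be a basis of \<open>U\<close> and \<open>M(x)\<close> the matrix whose rows are the linear forms
  \<open>u\<^sub>l(x, -)\<close>. As the \<open>u\<^sub>l\<close> are alternating, \<open>M(x) x = 0\<close>. Hence the maximal minor of \<open>M(x)\<close> that
  omits column \<open>i\<close> is \<open>\<plusminus> x\<^sub>i F\<close> with one and the same quartic \<open>F\<close> (\<open>minors_divisible\<close>), and \<open>F\<close> is
  the equation of \<open>W\<close>. A partial derivative of \<open>x\<^sub>i F\<close> is the derivative of a determinant of size
  five, so it lies in the ideal of the minors of size four; therefore the six partial derivatives
  of \<open>F\<close> are cubic sections of the ideal sheaf of the singular curve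
  (\<open>pderivative_in_singular_curve\<close>). They are linearly independent if \<open>W\<close> is not a cone. What
  remains is the bound six for the dimension of the space of cubic sections.

  A cubic section vanishes at every point \<open>x\<close> that is killed by a pencil of forms in \<open>U\<close>, because
  \<open>M(x)\<close> has rank at most three there (\<open>singular_curve_section_vanishes\<close>). So it suffices that a
  cubic which vanishes at all these points is determined by six of its coefficients
  (\<open>determines_cubics\<close>). For the frame of the forms \<open>\<alpha>\<^sub>l \<and> \<beta>\<^sub>l\<close> with \<open>\<alpha>\<^sub>l\<close> in the first and \<open>\<beta>\<^sub>l\<close>
  in the last three coordinates, this locus contains fifteen lines at whose general points it is
  smooth, and linear algebra shows that vanishing on these lines is enough
  (\<open>cubic_vanishing_on_smooth_points\<close>).

  Two arguments lead from this special frame to the general one. The first is local: by the open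
  mapping property of maps with surjective derivative, each smooth point moves along with every
  small perturbation of the frame (\<open>pencil_deforms\<close>), and compactness of the unit sphere in the
  space of cubics turns this into \<open>determines_cubics\<close> for all frames on a short segment in any
  given direction. The second is algebraic: \<open>determines_cubics\<close> is a first-order property of the
  coordinates of the frame, so by elimination of quantifiers it defines a constructible set
  (\<open>constructible_project\<close>); a constructible set that contains a short segment in every direction
  from some point contains a non-empty Zariski open set (\<open>constructible_generic\<close>). That \<open>W\<close> is not
  a cone in general follows from the special case in the same way, by compactness and elimination
  of quantifiers.

  For a frame with both properties, the space of cubic sections is compared with the span of the
  partial derivatives through the six coefficients (\<open>cubic_sections_spanned\<close>). The equation of \<open>W\<close>
  is unique up to a factor and a change of coordinates does not alter the span of the partial
  derivatives, so the jacobian space may be computed from \<open>F\<close> in the standard coordinates.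
\<close>

section \<open>Constructible sets\<close>

text \<open>Polynomial functions instead of polynomials: membership is read off the shape of a term, and
  substitution is composition of functions.\<close>

inductive_set polyfun :: "(('v \<Rightarrow> complex) \<Rightarrow> complex) set" where
  polyfun_const: "(\<lambda>s. c) \<in> polyfun"
| polyfun_coord: "(\<lambda>s. s v) \<in> polyfun"
| polyfun_add: "p \<in> polyfun \<Longrightarrow> q \<in> polyfun \<Longrightarrow> (\<lambda>s. p s + q s) \<in> polyfun"
| polyfun_mult: "p \<in> polyfun \<Longrightarrow> q \<in> polyfun \<Longrightarrow> (\<lambda>s. p s * q s) \<in> polyfun"

lemma polyfun_uminus: "p \<in> polyfun \<Longrightarrow> (\<lambda>s. - p s) \<in> polyfun"
  using polyfun_mult[OF polyfun_const[of "-1"]] by simp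

lemma polyfun_diff: "p \<in> polyfun \<Longrightarrow> q \<in> polyfun \<Longrightarrow> (\<lambda>s. p s - q s) \<in> polyfun"
  using polyfun_add[OF _ polyfun_uminus] by simp

lemma polyfun_sum: "(\<And>i. i \<in> I \<Longrightarrow> p i \<in> polyfun) \<Longrightarrow> (\<lambda>s. \<Sum>i\<in>I. p i s) \<in> polyfun"
  by (induction I rule: infinite_finite_induct) (auto intro: polyfun.intros)

lemma polyfun_prod: "(\<And>i. i \<in> I \<Longrightarrow> p i \<in> polyfun) \<Longrightarrow> (\<lambda>s. \<Prod>i\<in>I. p i s) \<in> polyfun"
  by (induction I rule: infinite_finite_induct) (auto intro: polyfun.intros)

lemmas polyfun_intros = polyfun.intros polyfun_uminus polyfun_diff polyfun_sum polyfun_prod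

lemma polyfun_comp:
  assumes "p \<in> polyfun" "\<And>v. (\<lambda>s. f s v) \<in> polyfun"
  shows "(\<lambda>s. p (f s)) \<in> polyfun"
  using assms(1) by induction (auto intro: polyfun.intros assms(2))

inductive_set constructible :: "('v \<Rightarrow> complex) set set" where
  constructible_zeros: "p \<in> polyfun \<Longrightarrow> {s. p s = 0} \<in> constructible"
| constructible_Compl: "X \<in> constructible \<Longrightarrow> - X \<in> constructible"
| constructible_Int: "X \<in> constructible \<Longrightarrow> Y \<in> constructible \<Longrightarrow> X \<inter> Y \<in> constructible"

lemma constructible_Un: "X \<in> constructible \<Longrightarrow> Y \<in> constructible \<Longrightarrow> X \<union> Y \<in> constructible"
  using constructible_Compl[OF constructible_Int[OF constructible_Compl constructible_Compl]] by auto

lemma constructible_UNIV: "UNIV \<in> constructible"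
  using constructible_zeros[OF polyfun_const[of 0]] by simp

lemma constructible_empty: "{} \<in> constructible"
  using constructible_Compl[OF constructible_UNIV] by simp

lemma constructible_UN:
  "finite I \<Longrightarrow> (\<And>i. i \<in> I \<Longrightarrow> X i \<in> constructible) \<Longrightarrow> (\<Union>i\<in>I. X i) \<in> constructible"
  by (induction I rule: finite_induct) (auto intro: constructible_Un constructible_empty)

lemma constructible_INT:
  "finite I \<Longrightarrow> (\<And>i. i \<in> I \<Longrightarrow> X i \<in> constructible) \<Longrightarrow> (\<Inter>i\<in>I. X i) \<in> constructible"
  by (induction I rule: finite_induct) (auto intro: constructible_Int constructible_UNIV)

lemma constructible_vimage:
  assumes "X \<in> constructible" "\<And>v. (\<lambda>s. f s v) \<in> polyfun"
  shows "{s. f s \<in> X} \<in> constructible"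
  using assms(1)
proof induction
  case (constructible_zeros p)
  then show ?case
    using constructible.constructible_zeros[OF polyfun_comp[OF _ assms(2)]] by simp
next
  case (constructible_Compl X)
  then show ?case using constructible.constructible_Compl by (fastforce simp: Collect_neg_eq)
next
  case (constructible_Int X Y)
  then show ?case using constructible.constructible_Int by (fastforce simp: Collect_conj_eq)
qed

section \<open>Elimination of quantifiers over the complex numbers\<close>

text \<open>A polynomial in one distinguished variable whose coefficients are polynomial functions of a
  parameter. Its degree jumps with the parameter, whereas the bound \<open>n\<close> does not; the places where
  the degree drops are found by comparing the coefficient of index \<open>n - 1\<close> with zero.\<close>

definition polyfam :: "nat \<Rightarrow> (('v \<Rightarrow> complex) \<Rightarrow> complex poly) \<Rightarrow> bool" where
  "polyfam n P \<longleftrightarrow> (\<forall>k. (\<lambda>s. coeff (P s) k) \<in> polyfun) \<and> (\<forall>s. \<forall>k\<ge>n. coeff (P s) k = 0)"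

lemma polyfam_add: "polyfam n P \<Longrightarrow> polyfam m Q \<Longrightarrow> polyfam (max n m) (\<lambda>s. P s + Q s)"
  by (auto simp: polyfam_def intro: polyfun_add)

lemma polyfam_mult:
  assumes "polyfam n P" "polyfam m Q"
  shows "polyfam (n + m) (\<lambda>s. P s * Q s)"
  unfolding polyfam_def
proof (intro conjI allI impI)
  fix k
  show "(\<lambda>s. coeff (P s * Q s) k) \<in> polyfun"
    using assms by (auto simp: coeff_mult polyfam_def intro!: polyfun_intros)
next
  fix s k assume "n + m \<le> k"
  have zero: "coeff (P s) i * coeff (Q s) (k - i) = 0" if "i \<le> k" for i
  proof (cases "n \<le> i")
    case False
    then have "m \<le> k - i" using \<open>n + m \<le> k\<close> by simp
    then show ?thesis using assms by (simp add: polyfam_def)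
  qed (use assms in \<open>simp add: polyfam_def\<close>)
  show "coeff (P s * Q s) k = 0" unfolding coeff_mult by (rule sum.neutral) (use zero in auto)
qed

lemma polyfam_power: "polyfam n P \<Longrightarrow> \<exists>m. polyfam m (\<lambda>s. P s ^ d)"
proof (induction d)
  case 0
  have "polyfam 1 (\<lambda>s. 1 :: complex poly)"
    by (auto simp: polyfam_def intro!: polyfun_intros)
  then show ?case by auto
next
  case (Suc d)
  then show ?case using polyfam_mult by fastforce
qed

lemma polyfam_truncate:
  assumes "polyfam (Suc n) P"
  shows "polyfam n (\<lambda>s. P s - monom (coeff (P s) n) n)"
  unfolding polyfam_def
proof (intro conjI allI impI)
  fix k
  show "(\<lambda>s. coeff (P s - monom (coeff (P s) n) n) k) \<in> polyfun"
    using assms by (cases "n = k") (auto simp: polyfam_def intro: polyfun_intros)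
next
  fix s k assume "n \<le> k"
  then show "coeff (P s - monom (coeff (P s) n) n) k = 0"
    using assms by (cases "n = k") (auto simp: polyfam_def)
qed

lemma polyfam_pseudo_remainder:
  assumes P: "polyfam (Suc n) P" and R: "polyfam (Suc m) R" and "n \<le> m"
  shows "polyfam m (\<lambda>s. smult (coeff (P s) n) (R s) - monom (coeff (R s) m) (m - n) * P s)"
  unfolding polyfam_def
proof (intro conjI allI impI)
  fix k
  show "(\<lambda>s. coeff (smult (coeff (P s) n) (R s) - monom (coeff (R s) m) (m - n) * P s) k) \<in> polyfun"
    using P R by (cases "k < m - n") (auto simp: coeff_monom_mult polyfam_def intro!: polyfun_intros)
next
  fix s k assume "m \<le> k"
  show "coeff (smult (coeff (P s) n) (R s) - monom (coeff (R s) m) (m - n) * P s) k = 0"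
  proof (cases "k = m")
    case True
    then show ?thesis using \<open>n \<le> m\<close> by (simp add: coeff_monom_mult)
  next
    case False
    then have "Suc m \<le> k" "Suc n \<le> k - (m - n)" using \<open>m \<le> k\<close> \<open>n \<le> m\<close> by auto
    then show ?thesis using P R by (simp add: coeff_monom_mult polyfam_def)
  qed
qed

lemma polyfam_slice:
  "p \<in> polyfun \<Longrightarrow> \<exists>n P. polyfam n P \<and> (\<forall>s t. p (s(v := t)) = poly (P s) t)"
proof (induction rule: polyfun.induct)
  case (polyfun_const c)
  have "polyfam 1 (\<lambda>s. [:c:])"
    by (auto simp: polyfam_def coeff_pCons split: nat.split intro: polyfun_intros)
  then show ?case by (intro exI conjI) auto
next
  case (polyfun_coord u)
  show ?case
  proof (cases "u = v")
    case True
    have "polyfam 2 (\<lambda>s. [:0, 1:])"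
      by (auto simp: polyfam_def coeff_pCons split: nat.split intro: polyfun_intros)
    then show ?thesis using True by (intro exI conjI) auto
  next
    case False
    have "(\<lambda>s. coeff [:s u:] k) \<in> polyfun" for k
      by (cases k) (auto simp: coeff_pCons intro: polyfun_intros)
    then have "polyfam 1 (\<lambda>s. [:s u:])"
      by (auto simp: polyfam_def coeff_pCons split: nat.split)
    then show ?thesis using False by (intro exI conjI) auto
  qed
next
  case (polyfun_add p q)
  then obtain n P m Q where "polyfam n P" "polyfam m Q"
    "\<And>s t. p (s(v := t)) = poly (P s) t" "\<And>s t. q (s(v := t)) = poly (Q s) t" by metis
  then show ?case using polyfam_add[of n P m Q]
    by (intro exI[of _ "max n m"] exI[of _ "\<lambda>s. P s + Q s"]) (auto simp del: fun_upd_apply)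
next
  case (polyfun_mult p q)
  then obtain n P m Q where "polyfam n P" "polyfam m Q"
    "\<And>s t. p (s(v := t)) = poly (P s) t" "\<And>s t. q (s(v := t)) = poly (Q s) t" by metis
  then show ?case using polyfam_mult[of n P m Q]
    by (intro exI[of _ "n + m"] exI[of _ "\<lambda>s. P s * Q s"]) (auto simp del: fun_upd_apply)
qed

lemma polyfam_eq_0: "polyfam n P \<Longrightarrow> P s = 0 \<longleftrightarrow> (\<forall>k<n. coeff (P s) k = 0)"
  by (auto simp: polyfam_def poly_eq_iff) (meson not_le_imp_less)

lemma constructible_polyfam_eq_0:
  assumes "polyfam n P"
  shows "{s. P s = 0} \<in> constructible"
proof -
  have "{s. P s = 0} = (\<Inter>k\<in>{..<n}. {s. coeff (P s) k = 0})"
    using polyfam_eq_0[OF assms] by auto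
  also have "\<dots> \<in> constructible"
    using assms by (intro constructible_INT constructible_zeros) (auto simp: polyfam_def)
  finally show ?thesis .
qed

text \<open>Where the leading coefficient of \<open>P s\<close> does not vanish, pseudo-division decides divisibility: it
  lowers the degree bound of \<open>R\<close> without affecting whether \<open>P s\<close> divides \<open>R s\<close>, until the bound is
  below the degree of \<open>P s\<close> and divisibility means \<open>R s = 0\<close>.\<close>

lemma constructible_dvd:
  assumes P: "polyfam (Suc n) P"
  shows "polyfam m R \<Longrightarrow> {s. coeff (P s) n \<noteq> 0 \<and> P s dvd R s} \<in> constructible"
proof (induction m arbitrary: R)
  case 0
  then have "R s = 0" for s
    by (simp add: polyfam_eq_0)
  then have "{s. coeff (P s) n \<noteq> 0 \<and> P s dvd R s} = - {s. coeff (P s) n = 0}"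
    by auto
  then show ?case using P constructible_Compl[OF constructible_zeros] by (auto simp: polyfam_def)
next
  case (Suc m)
  have ne: "- {s. coeff (P s) n = 0} \<in> constructible"
    using P constructible_Compl[OF constructible_zeros] by (auto simp: polyfam_def)
  show ?case
  proof (cases "n \<le> m")
    case True
    let ?R = "\<lambda>s. smult (coeff (P s) n) (R s) - monom (coeff (R s) m) (m - n) * P s"
    have "P s dvd ?R s \<longleftrightarrow> P s dvd R s" if "coeff (P s) n \<noteq> 0" for s
      using that by (metis dvd_diff_left_iff dvd_smult_iff dvd_triv_right)
    then have "{s. coeff (P s) n \<noteq> 0 \<and> P s dvd R s} = {s. coeff (P s) n \<noteq> 0 \<and> P s dvd ?R s}"
      by auto
    then show ?thesis using Suc.IH[OF polyfam_pseudo_remainder[OF P Suc.prems True]] by simp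
  next
    case False
    have "P s dvd R s \<longleftrightarrow> R s = 0" if "coeff (P s) n \<noteq> 0" for s
    proof
      assume "P s dvd R s"
      show "R s = 0"
      proof (rule ccontr)
        assume "R s \<noteq> 0"
        with \<open>P s dvd R s\<close> have "degree (P s) \<le> degree (R s)" by (rule dvd_imp_degree_le)
        moreover have "n \<le> degree (P s)" using that by (rule le_degree)
        moreover have "degree (R s) \<le> m"
          using Suc.prems by (intro degree_le) (auto simp: polyfam_def)
        ultimately show False using False by simp
      qed
    qed simp
    then have "{s. coeff (P s) n \<noteq> 0 \<and> P s dvd R s} = - {s. coeff (P s) n = 0} \<inter> {s. R s = 0}"
      by auto
    then show ?thesis using constructible_Int[OF ne constructible_polyfam_eq_0[OF Suc.prems]] by simp
  qed
qed

lemma constructible_cases: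
  assumes "p \<in> polyfun" "X \<in> constructible" "Y \<in> constructible"
    "\<And>s. p s = 0 \<Longrightarrow> s \<in> Z \<longleftrightarrow> s \<in> X" "\<And>s. p s \<noteq> 0 \<Longrightarrow> s \<in> Z \<longleftrightarrow> s \<in> Y"
  shows "Z \<in> constructible"
proof -
  have "Z = ({s. p s = 0} \<inter> X) \<union> (- {s. p s = 0} \<inter> Y)" using assms(4,5) by auto
  then show ?thesis using assms(1-3)
    by (auto intro!: constructible_Un constructible_Int constructible_Compl constructible_zeros)
qed

text \<open>Euclid's algorithm, run for all parameters at once. Each step takes two of the polynomials and
  distinguishes whether the leading coefficient of the shorter one vanishes: if so that polynomial
  is truncated, and otherwise it is used to shorten the other one; the sum of the degree bounds
  decreases in both cases. When a single polynomial \<open>P\<close> of true degree \<open>n\<close> is left, all its roots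
  are roots of \<open>Q\<close> iff \<open>P\<close> divides \<open>Q ^ n\<close>, by the Nullstellensatz in one variable.\<close>

lemma common_root_constructible:
  assumes "\<forall>(n, P)\<in>set ps. polyfam n P" "polyfam k Q"
  shows "{s. \<exists>t. (\<forall>(n, P)\<in>set ps. poly (P s) t = 0) \<and> poly (Q s) t \<noteq> 0} \<in> constructible"
  using assms(1)
proof (induction "sum_list (map fst ps) + length ps" arbitrary: ps rule: less_induct)
  case less
  let ?C = "\<lambda>ps. {s. \<exists>t. (\<forall>(n, P)\<in>set ps. poly (P s) t = 0) \<and> poly (Q s) t \<noteq> 0}"
  consider (nil) "ps = []" | (zero) P rest where "ps = (0, P) # rest"
    | (one) n P where "ps = [(Suc n, P)]"
    | (two) n P m R rest where "ps = (Suc n, P) # (m, R) # rest"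
  proof (cases ps)
    case (Cons x rest)
    obtain n P where x: "x = (n, P)" by fastforce
    show ?thesis
    proof (cases n)
      case 0
      then show ?thesis using zero Cons x by simp
    next
      case (Suc n')
      show ?thesis
      proof (cases rest)
        case Nil
        then show ?thesis using one Cons x Suc by simp
      next
        case (Cons y rest')
        then show ?thesis using two[of n' P "fst y" "snd y" rest'] \<open>ps = x # rest\<close> x Suc by simp
      qed
    qed
  qed simp
  then show ?case
  proof cases
    case nil
    have "?C ps = - {s. Q s = 0}"
      using nil poly_all_0_iff_0 by auto
    then show ?thesis using constructible_Compl[OF constructible_polyfam_eq_0[OF assms(2)]] by simp
  next
    case zero
    have "?C ps = ?C rest" using zero less.prems polyfam_eq_0[of 0 P] by auto
    moreover have "?C rest \<in> constructible" by (rule less.hyps) (use zero less.prems in auto)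
    ultimately show ?thesis by simp
  next
    case one
    let ?P = "\<lambda>s. P s - monom (coeff (P s) n) n"
    have P: "polyfam (Suc n) P" using one less.prems by simp
    have X: "?C [(n, ?P)] \<in> constructible"
      by (rule less.hyps) (use one polyfam_truncate[OF P] in auto)
    obtain m where m: "polyfam m (\<lambda>s. Q s ^ n)" using polyfam_power[OF assms(2)] by blast
    let ?Y = "- {s. coeff (P s) n \<noteq> 0 \<and> P s dvd Q s ^ n}"
    have Y: "?Y \<in> constructible" using constructible_Compl[OF constructible_dvd[OF P m]] .
    show ?thesis
    proof (rule constructible_cases[OF _ X Y])
      show "(\<lambda>s. coeff (P s) n) \<in> polyfun" using P by (simp add: polyfam_def)
      fix s assume nz: "coeff (P s) n \<noteq> 0"
      have "degree (P s) = n" using nz P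
        by (intro antisym degree_le le_degree) (auto simp: polyfam_def)
      moreover have "P s \<noteq> 0" using nz by auto
      ultimately show "s \<in> ?C ps \<longleftrightarrow> s \<in> ?Y"
        using nullstellensatz_univariate[of "P s" "Q s"] nz one by auto
    qed (use one in auto)
  next
    case two
    have wlog: "?C ((Suc n, P) # (Suc m, R) # rest) \<in> constructible"
      if nm: "n \<le> m" and meas: "Suc n + Suc m + sum_list (map fst rest) + (2 + length rest)
            = sum_list (map fst ps) + length ps"
        and P: "polyfam (Suc n) P" and R: "polyfam (Suc m) R"
        and rest: "\<forall>(n, P)\<in>set rest. polyfam n P" for n P m R
    proof -
      let ?P = "\<lambda>s. P s - monom (coeff (P s) n) n"
      let ?R = "\<lambda>s. smult (coeff (P s) n) (R s) - monom (coeff (R s) m) (m - n) * P s"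
      have X: "?C ((n, ?P) # (Suc m, R) # rest) \<in> constructible"
        by (rule less.hyps) (use meas polyfam_truncate[OF P] R rest in auto)
      have Y: "?C ((Suc n, P) # (m, ?R) # rest) \<in> constructible"
        by (rule less.hyps) (use meas polyfam_pseudo_remainder[OF P R nm] P rest in auto)
      show ?thesis
      proof (rule constructible_cases[OF _ X Y])
        show "(\<lambda>s. coeff (P s) n) \<in> polyfun" using P by (simp add: polyfam_def)
      next
        fix s assume "coeff (P s) n \<noteq> 0"
        then have "poly (P s) t = 0 \<and> poly (R s) t = 0 \<longleftrightarrow> poly (P s) t = 0 \<and> poly (?R s) t = 0" for t
          by auto
        then show "s \<in> ?C ((Suc n, P) # (Suc m, R) # rest) \<longleftrightarrow> s \<in> ?C ((Suc n, P) # (m, ?R) # rest)"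
          by auto
      qed auto
    qed
    have P: "polyfam (Suc n) P" and R: "polyfam m R" and rest: "\<forall>(n, P)\<in>set rest. polyfam n P"
      using two less.prems by auto
    show ?thesis
    proof (cases m)
      case 0
      have "?C ps = ?C ((Suc n, P) # rest)" using 0 two R polyfam_eq_0[of 0 R] by auto
      moreover have "?C ((Suc n, P) # rest) \<in> constructible"
        by (rule less.hyps) (use two less.prems in auto)
      ultimately show ?thesis by simp
    next
      case (Suc m')
      show ?thesis
      proof (cases "n \<le> m'")
        case True
        show ?thesis using wlog[of n m' P R] True P R rest two Suc by simp
      next
        case False
        have "?C ps = ?C ((Suc m', R) # (Suc n, P) # rest)" using two Suc by auto
        then show ?thesis using wlog[of m' n R P] False P R rest two Suc by simp
      qed
    qed
  qed
qed

text \<open>Disjunctive normal form. The inequations of a conjunction are merged into a single one by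
  multiplying them.\<close>

definition locally_closed_basic :: "('v \<Rightarrow> complex) set set" where
  "locally_closed_basic =
     {{s. (\<forall>p\<in>set ps. p s = 0) \<and> q s \<noteq> 0} | ps q. set ps \<subseteq> polyfun \<and> q \<in> polyfun}"

definition basic_unions :: "('v \<Rightarrow> complex) set set" where
  "basic_unions = {\<Union>F | F. finite F \<and> F \<subseteq> locally_closed_basic}"

lemma basic_unions_Un:
  assumes "X \<in> basic_unions" "Y \<in> basic_unions"
  shows "X \<union> Y \<in> basic_unions"
proof -
  obtain F G where "X = \<Union>F" "Y = \<Union>G" "finite F" "finite G"
    "F \<subseteq> locally_closed_basic" "G \<subseteq> locally_closed_basic"
    using assms unfolding basic_unions_def by auto
  then show ?thesis unfolding basic_unions_def by (intro CollectI exI[of _ "F \<union> G"]) auto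
qed

lemma basic_unions_UN:
  "finite I \<Longrightarrow> (\<And>i. i \<in> I \<Longrightarrow> X i \<in> basic_unions) \<Longrightarrow> (\<Union>i\<in>I. X i) \<in> basic_unions"
proof (induction I rule: finite_induct)
  case empty
  then show ?case by (auto simp: basic_unions_def)
qed (auto intro: basic_unions_Un)

lemma basic_Int:
  assumes "X \<in> locally_closed_basic" "Y \<in> locally_closed_basic"
  shows "X \<inter> Y \<in> locally_closed_basic"
proof -
  obtain ps q ps' q' where "X = {s. (\<forall>p\<in>set ps. p s = 0) \<and> q s \<noteq> 0}"
    "Y = {s. (\<forall>p\<in>set ps'. p s = 0) \<and> q' s \<noteq> 0}"
    "set ps \<subseteq> polyfun" "q \<in> polyfun" "set ps' \<subseteq> polyfun" "q' \<in> polyfun"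
    using assms unfolding locally_closed_basic_def by auto
  then show ?thesis unfolding locally_closed_basic_def
    by (intro CollectI exI[of _ "ps @ ps'"] exI[of _ "\<lambda>s. q s * q' s"]) (auto intro: polyfun_mult)
qed

lemma basic_unions_Int:
  assumes "X \<in> basic_unions" "Y \<in> basic_unions"
  shows "X \<inter> Y \<in> basic_unions"
proof -
  obtain F G where *: "X = \<Union>F" "Y = \<Union>G" "finite F" "finite G"
    "F \<subseteq> locally_closed_basic" "G \<subseteq> locally_closed_basic"
    using assms unfolding basic_unions_def by auto
  have "X \<inter> Y = \<Union>((\<lambda>(A, B). A \<inter> B) ` (F \<times> G))" using * by auto
  moreover have "(\<lambda>(A, B). A \<inter> B) ` (F \<times> G) \<subseteq> locally_closed_basic"
    using * basic_Int by auto
  ultimately show ?thesis unfolding basic_unions_def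
    using * by (intro CollectI exI[of _ "(\<lambda>(A, B). A \<inter> B) ` (F \<times> G)"]) auto
qed

lemma basic_in_unions: "X \<in> locally_closed_basic \<Longrightarrow> X \<in> basic_unions"
  unfolding basic_unions_def by (intro CollectI exI[of _ "{X}"]) auto

lemma zeros_in_unions: "p \<in> polyfun \<Longrightarrow> {s. p s = 0} \<in> basic_unions"
  by (rule basic_in_unions, unfold locally_closed_basic_def, intro CollectI exI[of _ "[p]"] exI[of _ "\<lambda>_. 1"])
    (auto intro: polyfun_const)

lemma nonzeros_in_unions: "p \<in> polyfun \<Longrightarrow> {s. p s \<noteq> 0} \<in> basic_unions"
  by (rule basic_in_unions, unfold locally_closed_basic_def, intro CollectI exI[of _ "[]"] exI[of _ p]) auto

lemma basic_unions_Compl: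
  assumes "X \<in> basic_unions"
  shows "- X \<in> basic_unions"
proof -
  obtain F where F: "X = \<Union>F" "finite F" "F \<subseteq> locally_closed_basic"
    using assms unfolding basic_unions_def by auto
  have B: "- B \<in> basic_unions" if "B \<in> F" for B
  proof -
    obtain ps q where *: "B = {s. (\<forall>p\<in>set ps. p s = 0) \<and> q s \<noteq> 0}" "set ps \<subseteq> polyfun" "q \<in> polyfun"
    proof -
      have "B \<in> locally_closed_basic" using \<open>B \<in> F\<close> F by blast
      then show thesis using that unfolding locally_closed_basic_def by blast
    qed
    have "- B = (\<Union>p\<in>set ps. {s. p s \<noteq> 0}) \<union> {s. q s = 0}" using * by auto
    then show ?thesis using *
      by (auto intro!: basic_unions_Un basic_unions_UN nonzeros_in_unions zeros_in_unions)
  qed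
  have "(\<Inter>B\<in>F. - B) \<in> basic_unions" using F(2) B
  proof (induction F rule: finite_induct)
    case empty
    show ?case using zeros_in_unions[OF polyfun_const[of 0]] by simp
  qed (auto intro: basic_unions_Int)
  then show ?thesis using F(1) by (simp only: uminus_Sup)
qed

lemma constructible_normal_form: "X \<in> constructible \<Longrightarrow> X \<in> basic_unions"
  by (induction rule: constructible.induct)
    (auto intro: zeros_in_unions basic_unions_Compl basic_unions_Int)

text \<open>The existential quantifier commutes with unions, so it only has to be eliminated from the members
  of the normal form, which is the problem of a common root.\<close>

theorem constructible_project1:
  assumes "X \<in> constructible"
  shows "{s. \<exists>t. s(v := t) \<in> X} \<in> constructible"
proof -
  obtain F where F: "X = \<Union>F" "finite F" "F \<subseteq> locally_closed_basic"
    using constructible_normal_form[OF assms] unfolding basic_unions_def by auto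
  have "{s. \<exists>t. s(v := t) \<in> B} \<in> constructible" if "B \<in> F" for B
  proof -
    obtain ps q where *: "B = {s. (\<forall>p\<in>set ps. p s = 0) \<and> q s \<noteq> 0}" "set ps \<subseteq> polyfun" "q \<in> polyfun"
    proof -
      have "B \<in> locally_closed_basic" using \<open>B \<in> F\<close> F by blast
      then show thesis using that unfolding locally_closed_basic_def by blast
    qed
    obtain n P where P: "\<And>p. p \<in> set ps \<Longrightarrow> polyfam (n p) (P p)"
      "\<And>p s t. p \<in> set ps \<Longrightarrow> p (s(v := t)) = poly (P p s) t"
    proof -
      have "\<forall>p\<in>set ps. \<exists>nP. polyfam (fst nP) (snd nP) \<and> (\<forall>s t. p (s(v := t)) = poly (snd nP s) t)"
        using polyfam_slice[of _ v] *(2) by fastforce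
      then obtain nP where "\<forall>p\<in>set ps. polyfam (fst (nP p)) (snd (nP p)) \<and>
          (\<forall>s t. p (s(v := t)) = poly (snd (nP p) s) t)" by (rule bchoice[THEN exE])
      then show thesis by (intro that[of "\<lambda>p. fst (nP p)" "\<lambda>p. snd (nP p)"]) auto
    qed
    obtain k Q where Q: "polyfam k Q" "\<And>s t. q (s(v := t)) = poly (Q s) t"
      using polyfam_slice[OF *(3)] by metis
    have "{s. \<exists>t. s(v := t) \<in> B} =
      {s. \<exists>t. (\<forall>(n, P)\<in>set (map (\<lambda>p. (n p, P p)) ps). poly (P s) t = 0) \<and> poly (Q s) t \<noteq> 0}"
      using * P Q by (auto simp del: fun_upd_apply)
    then show ?thesis
      using common_root_constructible[of "map (\<lambda>p. (n p, P p)) ps" k Q] P Q by auto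
  qed
  moreover have "{s. \<exists>t. s(v := t) \<in> X} = (\<Union>B\<in>F. {s. \<exists>t. s(v := t) \<in> B})" using F by blast
  ultimately show ?thesis using constructible_UN[OF F(2), of "\<lambda>B. {s. \<exists>t. s(v := t) \<in> B}"] by simp
qed

theorem constructible_project:
  fixes X :: "('a + 'k::finite \<Rightarrow> complex) set"
  assumes "X \<in> constructible"
  shows "{s. \<exists>z. case_sum s z \<in> X} \<in> constructible"
proof -
  \<comment> \<open>The quantified variables are eliminated one at a time; \<open>f K s z\<close> takes the coordinates in \<open>K\<close>
    from \<open>z\<close>.\<close>
  define f :: "'k set \<Rightarrow> ('a + 'k \<Rightarrow> complex) \<Rightarrow> ('k \<Rightarrow> complex) \<Rightarrow> 'a + 'k \<Rightarrow> complex" where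
    "f K s z v = (case v of Inl a \<Rightarrow> s v | Inr k \<Rightarrow> if k \<in> K then z k else s v)" for K s z v
  have *: "{s. \<exists>z. f K s z \<in> X} \<in> constructible" if "finite K" for K
    using that
  proof (induction K rule: finite_induct)
    case empty
    have "f {} s z = s" for s z
      by (rule ext) (simp add: f_def split: sum.split)
    then show ?case using assms by (simp only: ex_simps simp_thms Collect_mem_eq)
  next
    case (insert k K)
    have 1: "f (insert k K) s z = f K (s(Inr k := z k)) z" for s z
      by (rule ext) (simp add: f_def split: sum.split)
    have 2: "f K (s(Inr k := t)) z = f (insert k K) s (z(k := t))" for s z t
      using insert.hyps by (intro ext) (auto simp: f_def split: sum.split)
    have "(\<exists>z. f (insert k K) s z \<in> X) \<longleftrightarrow> (\<exists>t. s(Inr k := t) \<in> {s. \<exists>z. f K s z \<in> X})" for s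
    proof
      assume "\<exists>z. f (insert k K) s z \<in> X"
      then obtain z where "f (insert k K) s z \<in> X" ..
      then have "f K (s(Inr k := z k)) z \<in> X" by (simp only: 1)
      then show "\<exists>t. s(Inr k := t) \<in> {s. \<exists>z. f K s z \<in> X}" by blast
    next
      assume "\<exists>t. s(Inr k := t) \<in> {s. \<exists>z. f K s z \<in> X}"
      then obtain t z where "f K (s(Inr k := t)) z \<in> X" by blast
      then have "f (insert k K) s (z(k := t)) \<in> X" by (simp only: 2)
      then show "\<exists>z. f (insert k K) s z \<in> X" by blast
    qed
    then show ?case using constructible_project1[OF insert.IH, of "Inr k"] by (simp only:)
  qed
  have eq: "case_sum s z = f UNIV (case_sum s (\<lambda>_. 0)) z" for s :: "'a \<Rightarrow> complex" and z :: "'k \<Rightarrow> complex"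
    by (rule ext) (simp add: f_def split: sum.split)
  have "{s. \<exists>z. case_sum s z \<in> X} = {s. case_sum s (\<lambda>_. 0) \<in> {s. \<exists>z. f UNIV s z \<in> X}}"
    unfolding mem_Collect_eq by (subst eq) (rule refl)
  also have "\<dots> \<in> constructible"
  proof (rule constructible_vimage[OF *])
    show "(\<lambda>s :: 'a \<Rightarrow> complex. case_sum s (\<lambda>_. 0) v) \<in> polyfun" for v :: "'a + 'k"
      by (cases v) (simp_all add: polyfun.intros)
  qed simp
  finally show ?thesis .
qed

section \<open>Properties that hold generically\<close>

lemma polyfun_on_line:
  "p \<in> polyfun \<Longrightarrow> \<exists>Q. \<forall>t. p (\<lambda>v. a v + t * b v) = poly Q t"
proof (induction rule: polyfun.induct)
  case (polyfun_const c)
  show ?case by (intro exI[of _ "[:c:]"]) simp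
next
  case (polyfun_coord v)
  show ?case by (intro exI[of _ "[:a v, b v:]"]) simp
next
  case (polyfun_add p q)
  then obtain P Q where "\<forall>t. p (\<lambda>v. a v + t * b v) = poly P t" "\<forall>t. q (\<lambda>v. a v + t * b v) = poly Q t"
    by blast
  then show ?case by (intro exI[of _ "P + Q"]) simp
next
  case (polyfun_mult p q)
  then obtain P Q where "\<forall>t. p (\<lambda>v. a v + t * b v) = poly P t" "\<forall>t. q (\<lambda>v. a v + t * b v) = poly Q t"
    by blast
  then show ?case by (intro exI[of _ "P * Q"]) simp
qed

text \<open>On the line through \<open>a\<close> and \<open>b\<close> both functions restrict to non-zero polynomials in one variable.\<close>

lemma polyfun_mult_nonzero:
  assumes "p \<in> polyfun" "q \<in> polyfun" "p a \<noteq> 0" "q b \<noteq> 0"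
  shows "\<exists>s. p s * q s \<noteq> 0"
proof -
  obtain P where P: "\<And>t. p (\<lambda>v. a v + t * (b v - a v)) = poly P t"
    using polyfun_on_line[OF assms(1), of a "\<lambda>v. b v - a v"] by blast
  obtain Q where Q: "\<And>t. q (\<lambda>v. a v + t * (b v - a v)) = poly Q t"
    using polyfun_on_line[OF assms(2), of a "\<lambda>v. b v - a v"] by blast
  note PQ = P Q
  have "P \<noteq> 0" "Q \<noteq> 0" using PQ(1)[of 0] PQ(2)[of 1] assms(3,4) by auto
  then obtain t where "poly (P * Q) t \<noteq> 0"
    using poly_all_0_iff_0[of "P * Q"] by auto
  then have "p (\<lambda>v. a v + t * (b v - a v)) * q (\<lambda>v. a v + t * (b v - a v)) \<noteq> 0"
    using PQ by simp
  then show ?thesis by (rule exI[of _ "\<lambda>v. a v + t * (b v - a v)"])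
qed

text \<open>The sets that contain or avoid a non-empty principal open set are closed under complements and,
  because non-empty principal open sets meet, under intersections.\<close>

lemma constructible_dichotomy:
  "X \<in> constructible \<Longrightarrow> \<exists>h\<in>polyfun. (\<exists>s. h s \<noteq> 0) \<and>
     ((\<forall>s. h s \<noteq> 0 \<longrightarrow> s \<in> X) \<or> (\<forall>s. h s \<noteq> 0 \<longrightarrow> s \<notin> X))"
proof (induction rule: constructible.induct)
  case (constructible_zeros p)
  show ?case
  proof (cases "\<exists>s. p s \<noteq> 0")
    case True
    then show ?thesis using constructible_zeros by (intro bexI[of _ p]) auto
  next
    case False
    then show ?thesis by (intro bexI[of _ "\<lambda>_. 1"]) (auto intro: polyfun_const)
  qed
next
  case (constructible_Compl X)
  then show ?case by auto
next
  case (constructible_Int X Y)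
  then obtain h g where hg: "h \<in> polyfun" "g \<in> polyfun" "\<exists>s. h s \<noteq> 0" "\<exists>s. g s \<noteq> 0"
     "(\<forall>s. h s \<noteq> 0 \<longrightarrow> s \<in> X) \<or> (\<forall>s. h s \<noteq> 0 \<longrightarrow> s \<notin> X)"
     "(\<forall>s. g s \<noteq> 0 \<longrightarrow> s \<in> Y) \<or> (\<forall>s. g s \<noteq> 0 \<longrightarrow> s \<notin> Y)" by (elim bexE conjE) rule
  have "(\<lambda>s. h s * g s) \<in> polyfun" using hg by (intro polyfun_mult)
  moreover have "\<exists>s. h s * g s \<noteq> 0" using hg polyfun_mult_nonzero[of h g] by fast
  moreover have "(\<forall>s. h s * g s \<noteq> 0 \<longrightarrow> s \<in> X \<inter> Y) \<or> (\<forall>s. h s * g s \<noteq> 0 \<longrightarrow> s \<notin> X \<inter> Y)"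
    using hg(5,6) by fastforce
  ultimately show ?case by (rule_tac bexI[of _ "\<lambda>s. h s * g s"]) auto
qed

text \<open>If \<open>X\<close> avoided a principal open set, join \<open>a\<close> with a point of that set: on this line the
  polynomial \<open>h\<close> is not identically zero, so it has finitely many zeros, but it vanishes at all
  the points near \<open>a\<close> that lie in \<open>X\<close>.\<close>

theorem constructible_generic:
  assumes X: "X \<in> constructible"
    and near: "\<And>b. \<exists>\<epsilon>>0. \<forall>t::real. 0 < t \<and> t < \<epsilon> \<longrightarrow> (\<lambda>v. a v + of_real t * b v) \<in> X"
  shows "\<exists>h\<in>polyfun. (\<exists>s. h s \<noteq> 0) \<and> (\<forall>s. h s \<noteq> 0 \<longrightarrow> s \<in> X)"
proof -
  obtain h where h: "h \<in> polyfun" "\<exists>s. h s \<noteq> 0"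
    "(\<forall>s. h s \<noteq> 0 \<longrightarrow> s \<in> X) \<or> (\<forall>s. h s \<noteq> 0 \<longrightarrow> s \<notin> X)"
    using constructible_dichotomy[OF X] by (elim bexE conjE) rule
  have False if out: "\<forall>s. h s \<noteq> 0 \<longrightarrow> s \<notin> X"
  proof -
    obtain c where c: "h c \<noteq> 0" using h(2) ..
    define b where "b v = c v - a v" for v
    obtain Q where Q: "\<forall>t. h (\<lambda>v. a v + t * b v) = poly Q t"
      using polyfun_on_line[OF h(1), of a b] ..
    have "(\<lambda>v. a v + 1 * b v) = c" by (simp add: b_def)
    then have "poly Q 1 \<noteq> 0" using c Q by (metis (no_types))
    then have "Q \<noteq> 0" by auto
    obtain e where e: "e > 0" "\<forall>t::real. 0 < t \<and> t < e \<longrightarrow> (\<lambda>v. a v + of_real t * b v) \<in> X"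
      using near[of b] by (elim exE conjE) rule
    have "complex_of_real ` {0<..<e} \<subseteq> {t. poly Q t = 0}"
    proof (intro subsetI, elim imageE, hypsubst)
      fix t :: real assume "t \<in> {0<..<e}"
      then have "(\<lambda>v. a v + of_real t * b v) \<in> X" using e(2) by simp
      then have "h (\<lambda>v. a v + of_real t * b v) = 0" using out by blast
      then show "complex_of_real t \<in> {t. poly Q t = 0}" using Q by simp
    qed
    then have "finite (complex_of_real ` {0<..<e})"
      using poly_roots_finite[OF \<open>Q \<noteq> 0\<close>] by (rule finite_subset)
    then have "finite {0<..<e}" by (rule finite_imageD) (simp add: inj_on_def)
    then show False using e(1) infinite_Ioo by blast
  qed
  then show ?thesis using h by blast
qed

section \<open>Induction over polynomials\<close>

lemma poly_mapping_sum_single: "(\<Sum>m\<in>Poly_Mapping.keys p. Poly_Mapping.single m (Poly_Mapping.lookup p m)) = p"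
proof (rule poly_mapping_eqI)
  fix k
  have "(\<Sum>m\<in>Poly_Mapping.keys p. Poly_Mapping.lookup p m when m = k) =
      (\<Sum>m\<in>Poly_Mapping.keys p. if m = k then Poly_Mapping.lookup p m else 0)"
    by (intro sum.cong) (auto simp: when_def)
  also have "\<dots> = Poly_Mapping.lookup p k" by (simp add: in_keys_iff)
  finally show "Poly_Mapping.lookup (\<Sum>m\<in>Poly_Mapping.keys p. Poly_Mapping.single m (Poly_Mapping.lookup p m)) k =
      Poly_Mapping.lookup p k"
    by (simp add: lookup_sum lookup_single)
qed

lemma single_add_induct [case_names single add]:
  fixes p :: "'k \<Rightarrow>\<^sub>0 'c::comm_monoid_add"
  assumes "\<And>m c. P (Poly_Mapping.single m c)" "\<And>p q. P p \<Longrightarrow> P q \<Longrightarrow> P (p + q)"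
  shows "P p"
proof -
  have "P (\<Sum>m\<in>K. Poly_Mapping.single m (c m))" for K :: "'k set" and c :: "'k \<Rightarrow> 'c"
  proof (induction K rule: infinite_finite_induct)
    case (infinite A)
    then show ?case using assms(1)[of undefined 0] by simp
  next
    case empty
    then show ?case using assms(1)[of undefined 0] by simp
  qed (auto intro: assms)
  then show ?thesis using poly_mapping_sum_single[of p] by metis
qed

lemma Const_0 [simp]: "Const 0 = 0" and Const_1 [simp]: "Const 1 = 1"
  and Const_add: "Const (a + b) = Const a + Const b"
  and Const_mult: "Const (a * b) = Const a * Const b"
  and Const_uminus: "Const (- a) = - Const a"
  by (simp_all add: Const_def single_add mult_single single_uminus)

lemma Const_sum: "Const (\<Sum>i\<in>I. f i) = (\<Sum>i\<in>I. Const (f i))"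
  by (induction I rule: infinite_finite_induct) (simp_all add: Const_add)

lemma Var_power: "Var i ^ k = Poly_Mapping.single (Poly_Mapping.single i k) 1"
  by (induction k) (simp_all add: Var_def mult_single flip: single_add)

lemma single_eq_monomial:
  "Poly_Mapping.single m c = Const c * (\<Prod>i\<in>UNIV. Var (i::'i::finite) ^ Poly_Mapping.lookup m i)"
proof -
  have "(\<Prod>i\<in>I. Var i ^ Poly_Mapping.lookup m i) =
      Poly_Mapping.single (\<Sum>i\<in>I. Poly_Mapping.single i (Poly_Mapping.lookup m i)) 1" for I
    by (induction I rule: infinite_finite_induct) (simp_all add: Var_power mult_single)
  moreover have "(\<Sum>i\<in>UNIV. Poly_Mapping.single i (Poly_Mapping.lookup m i)) = m"
    by (rule poly_mapping_eqI) (simp add: lookup_sum lookup_single when_def)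
  ultimately show ?thesis by (simp add: Const_def mult_single)
qed

lemma cpoly_induct [case_names Const Var add mult]:
  fixes p :: "'i::finite cpoly"
  assumes C: "\<And>c. P (Const c)" and V: "\<And>i. P (Var i)"
    and A: "\<And>p q. P p \<Longrightarrow> P q \<Longrightarrow> P (p + q)" and M: "\<And>p q. P p \<Longrightarrow> P q \<Longrightarrow> P (p * q)"
  shows "P p"
proof (induction p rule: single_add_induct)
  case (single m c)
  have pow: "P (Var i ^ k)" for i k
    by (induction k) (use C[of 1] in \<open>auto intro: V M\<close>)
  have "P (\<Prod>i\<in>I. Var i ^ Poly_Mapping.lookup m i)" for I :: "'i set"
    by (induction I rule: infinite_finite_induct) (use C[of 1] in \<open>auto intro: pow M\<close>)
  then show ?case by (simp add: single_eq_monomial M C)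
qed (rule A)

section \<open>Substitution and evaluation\<close>

definition coefficient_hom :: "(complex \<Rightarrow> 'r::comm_ring_1) \<Rightarrow> bool" where
  "coefficient_hom h \<longleftrightarrow> h 0 = 0 \<and> h 1 = 1 \<and> (\<forall>a b. h (a + b) = h a + h b) \<and> (\<forall>a b. h (a * b) = h a * h b)"

lemma insertion_single:
  assumes "coefficient_hom h"
  shows "insertion h x (Poly_Mapping.single m c) = h c * (\<Prod>i\<in>UNIV. x (i::'i::finite) ^ Poly_Mapping.lookup m i)"
proof -
  have "(\<Prod>i\<in>UNIV. x i ^ Poly_Mapping.lookup m i) = (\<Prod>i\<in>Poly_Mapping.keys m. x i ^ Poly_Mapping.lookup m i)"
    by (rule prod.mono_neutral_right) (auto simp: in_keys_iff)
  then show ?thesis using assms by (simp add: insertion_def coefficient_hom_def)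
qed

lemma insertion_add:
  assumes "coefficient_hom h"
  shows "insertion h x (p + q) = insertion h x p + insertion h x q"
proof -
  define K where "K = Poly_Mapping.keys p \<union> Poly_Mapping.keys q"
  have *: "insertion h x r = (\<Sum>m\<in>K. h (Poly_Mapping.lookup r m) * (\<Prod>i\<in>Poly_Mapping.keys m. x i ^ Poly_Mapping.lookup m i))"
    if "Poly_Mapping.keys r \<subseteq> K" for r
    unfolding insertion_def using that assms
    by (intro sum.mono_neutral_left) (auto simp: K_def in_keys_iff coefficient_hom_def)
  have add: "h (a + b) = h a + h b" for a b using assms by (simp add: coefficient_hom_def)
  have "insertion h x (p + q) = (\<Sum>m\<in>K. h (Poly_Mapping.lookup (p + q) m) * (\<Prod>i\<in>Poly_Mapping.keys m. x i ^ Poly_Mapping.lookup m i))"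
    by (rule *) (use keys_add[of p q] in \<open>simp add: K_def\<close>)
  also have "\<dots> = insertion h x p + insertion h x q"
    by (simp only: *[of p] *[of q] K_def Un_upper1 Un_upper2 lookup_add add distrib_right sum.distrib)
  finally show ?thesis .
qed

lemma insertion_mult:
  fixes p q :: "'i::finite cpoly"
  assumes h: "coefficient_hom h"
  shows "insertion h x (p * q) = insertion h x p * insertion h x q"
proof (induction p rule: single_add_induct)
  case (single m c)
  show ?case
  proof (induction q rule: single_add_induct)
    case (single n d)
    have hm: "h (c * d) = h c * h d" using h by (simp add: coefficient_hom_def)
    show ?case
      by (simp only: mult_single insertion_single[OF h] lookup_add power_add prod.distrib hm mult_ac)
  next
    case (add q r)
    then show ?case by (simp only: distrib_left insertion_add[OF h])
  qed
next
  case (add p r)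
  then show ?case by (simp only: distrib_right insertion_add[OF h])
qed

lemma insertion_Const: "coefficient_hom h \<Longrightarrow> insertion h x (Const c :: 'i::finite cpoly) = h c"
  by (simp add: Const_def insertion_single)

lemma insertion_Var: "coefficient_hom h \<Longrightarrow> insertion h x (Var i :: 'i::finite cpoly) = x i"
proof -
  assume "coefficient_hom h"
  moreover have "(\<Prod>j\<in>UNIV. x j ^ Poly_Mapping.lookup (Poly_Mapping.single i 1) j) = x i"
  proof -
    have "(\<Prod>j\<in>UNIV. x j ^ Poly_Mapping.lookup (Poly_Mapping.single i 1) j) = (\<Prod>j\<in>UNIV. if i = j then x j else 1)"
      by (intro prod.cong) (auto simp: lookup_single when_def)
    then show ?thesis by simp
  qed
  ultimately show ?thesis by (simp add: Var_def insertion_single coefficient_hom_def)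
qed

lemma hom_id: "coefficient_hom (\<lambda>c. c)" and hom_Const: "coefficient_hom Const"
  by (simp_all add: coefficient_hom_def Const_add Const_mult)

lemma eval_simps [simp]:
  fixes p q :: "'i::finite cpoly"
  shows "eval x (p + q) = eval x p + eval x q" "eval x (p * q) = eval x p * eval x q"
    "eval x (Const c :: 'i cpoly) = c" "eval x (Var i :: 'i cpoly) = x i"
  by (simp_all add: insertion_add insertion_mult insertion_Const insertion_Var hom_id)

lemma eval_01 [simp]: "eval x (0 :: 'i::finite cpoly) = 0" "eval x (1 :: 'i::finite cpoly) = 1"
  using eval_simps(3)[of x 0] eval_simps(3)[of x 1] by simp_all

lemma eval_uminus [simp]: "eval x (- p :: 'i::finite cpoly) = - eval x p"
  using eval_simps(1)[of x p "- p"] by (simp add: eq_neg_iff_add_eq_0 add.commute)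

lemma eval_diff [simp]: "eval x (p - q :: 'i::finite cpoly) = eval x p - eval x q"
  using eval_simps(1)[of x p "- q"] by simp

lemma eval_sum: "eval x (\<Sum>i\<in>I. f i :: 'i::finite cpoly) = (\<Sum>i\<in>I. eval x (f i))"
  by (induction I rule: infinite_finite_induct) simp_all

lemma eval_prod: "eval x (\<Prod>i\<in>I. f i :: 'i::finite cpoly) = (\<Prod>i\<in>I. eval x (f i))"
  by (induction I rule: infinite_finite_induct) simp_all

lemma eval_power: "eval x (p ^ n :: 'i::finite cpoly) = eval x p ^ n"
  by (induction n) simp_all

lemma eval_of_int: "eval x (of_int n :: 'i::finite cpoly) = of_int n"
proof -
  have "of_nat k = (Const (of_nat k) :: 'i cpoly)" for k
    by (induction k) (simp_all add: Const_add)
  then have k: "eval x (of_nat k :: 'i cpoly) = of_nat k" for k by simp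
  show ?thesis by (cases n rule: int_diff_cases) (simp add: k)
qed

lemma eval_det: "eval x (det (\<chi> i j. M i j) :: 'i::finite cpoly) = det (\<chi> i j. eval x (M i j))"
  by (simp add: det_def eval_sum eval_prod eval_of_int)

lemma subst_simps [simp]:
  fixes p q :: "'i::finite cpoly"
  shows "subst x (p + q) = subst x p + subst x q" "subst x (p * q) = subst x p * subst x q"
    "subst x (Const c :: 'i cpoly) = Const c" "subst x (Var i :: 'i cpoly) = x i"
  by (simp_all add: insertion_add insertion_mult insertion_Const insertion_Var hom_Const)

lemma subst_sum: "subst x (\<Sum>i\<in>I. f i :: 'i::finite cpoly) = (\<Sum>i\<in>I. subst x (f i))"
  by (induction I rule: infinite_finite_induct) (use subst_simps(3)[of x 0] in simp_all)

lemma polyfun_eval: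
  assumes "p \<in> polyfun"
  shows "\<exists>P :: 'i::finite cpoly. \<forall>s. eval s P = p s"
  using assms
proof induction
  case (polyfun_const c)
  show ?case by (intro exI[of _ "Const c"]) simp
next
  case (polyfun_coord v)
  show ?case by (intro exI[of _ "Var v"]) simp
next
  case (polyfun_add p q)
  then obtain P Q :: "'i cpoly" where "\<forall>s. eval s P = p s" "\<forall>s. eval s Q = q s" by blast
  then show ?case by (intro exI[of _ "P + Q"]) simp
next
  case (polyfun_mult p q)
  then obtain P Q :: "'i cpoly" where "\<forall>s. eval s P = p s" "\<forall>s. eval s Q = q s" by blast
  then show ?case by (intro exI[of _ "P * Q"]) simp
qed

section \<open>Partial derivatives\<close>

lemma pderivative_single:
  "pderivative i (Poly_Mapping.single m c) =
    Poly_Mapping.single (m - Poly_Mapping.single i 1) (of_nat (Poly_Mapping.lookup m i) * c)"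
  by (simp add: pderivative_def)

lemma pderivative_add: "pderivative i (p + q) = pderivative i p + pderivative i q"
proof -
  define K where "K = Poly_Mapping.keys p \<union> Poly_Mapping.keys q"
  have *: "pderivative i r = (\<Sum>m\<in>K. Poly_Mapping.single (m - Poly_Mapping.single i 1)
      (of_nat (Poly_Mapping.lookup m i) * Poly_Mapping.lookup r m))"
    if "Poly_Mapping.keys r \<subseteq> K" for r
    unfolding pderivative_def using that
    by (intro sum.mono_neutral_left) (auto simp: K_def in_keys_iff)
  have "pderivative i (p + q) = (\<Sum>m\<in>K. Poly_Mapping.single (m - Poly_Mapping.single i 1)
      (of_nat (Poly_Mapping.lookup m i) * Poly_Mapping.lookup (p + q) m))"
    by (rule *) (use keys_add[of p q] in \<open>simp add: K_def\<close>)
  also have "\<dots> = pderivative i p + pderivative i q"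
    by (simp only: *[of p] *[of q] K_def Un_upper1 Un_upper2 lookup_add distrib_left sum.distrib single_add)
  finally show ?thesis .
qed

lemma minus_single_add:
  fixes m n :: "'i \<Rightarrow>\<^sub>0 nat"
  assumes "Poly_Mapping.lookup m i \<noteq> 0"
  shows "m - Poly_Mapping.single i 1 + n = m + n - Poly_Mapping.single i 1"
  using assms by (intro poly_mapping_eqI) (auto simp: lookup_add lookup_minus lookup_single when_def)

lemma pderivative_mult: "pderivative i (p * q) = pderivative i p * q + p * pderivative i q"
proof (induction p rule: single_add_induct)
  case (single m c)
  show ?case
  proof (induction q rule: single_add_induct)
    case (single n d)
    have 1: "Poly_Mapping.single (m - Poly_Mapping.single i 1 + n) (of_nat (Poly_Mapping.lookup m i) * c * d) =
        Poly_Mapping.single (m + n - Poly_Mapping.single i 1) (of_nat (Poly_Mapping.lookup m i) * c * d)"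
      by (cases "Poly_Mapping.lookup m i = 0") (simp_all add: minus_single_add del: One_nat_def)
    have 2: "Poly_Mapping.single (m + (n - Poly_Mapping.single i 1)) (c * (of_nat (Poly_Mapping.lookup n i) * d)) =
        Poly_Mapping.single (m + n - Poly_Mapping.single i 1) (c * (of_nat (Poly_Mapping.lookup n i) * d))"
      using minus_single_add[of n i m] by (cases "Poly_Mapping.lookup n i = 0") (simp_all add: add.commute del: One_nat_def)
    show ?case
      by (simp only: mult_single pderivative_single 1 2, subst single_add[symmetric])
        (simp only: lookup_add of_nat_add distrib_right mult.assoc mult.left_commute[of c])
  next
    case (add q r)
    then show ?case by (simp add: distrib_left pderivative_add)
  qed
next
  case (add p r)
  then show ?case by (simp add: distrib_right pderivative_add)
qed

lemma pderivative_Const [simp]: "pderivative i (Const c) = 0"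
  by (simp add: Const_def pderivative_single)

lemma pderivative_01 [simp]: "pderivative i 0 = 0" "pderivative i 1 = 0"
  using pderivative_Const[of i 0] pderivative_Const[of i 1] by simp_all

lemma pderivative_Var [simp]: "pderivative i (Var j) = (if i = j then 1 else 0)"
  by (simp add: Var_def pderivative_single lookup_single when_def)

lemma pderivative_uminus: "pderivative i (- p) = - pderivative i p"
  using pderivative_add[of i p "- p"] by (simp add: eq_neg_iff_add_eq_0 add.commute)

lemma pderivative_sum: "pderivative i (\<Sum>j\<in>J. f j) = (\<Sum>j\<in>J. pderivative i (f j))"
  by (induction J rule: infinite_finite_induct) (simp_all add: pderivative_add)

lemma pderivative_subst:
  fixes p :: "'i::finite cpoly" and x :: "'i \<Rightarrow> 'j::finite cpoly"
  shows "pderivative i (subst x p) = (\<Sum>k\<in>UNIV. subst x (pderivative k p) * pderivative i (x k))"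
proof (induction p rule: cpoly_induct)
  case (Const c)
  show ?case using subst_simps(3)[of x 0] by simp
next
  case (Var k)
  have "subst x (if l = k then 1 else 0) * pderivative i (x l) = (if l = k then pderivative i (x k) else 0)" for l
    using subst_simps(3)[of x 0] subst_simps(3)[of x 1] by simp
  then show ?case by simp
next
  case (add p q)
  then show ?case by (simp add: pderivative_add distrib_right sum.distrib)
next
  case (mult p q)
  show ?case
    by (simp only: pderivative_mult subst_simps mult distrib_right sum.distrib sum_distrib_left sum_distrib_right)
      (simp only: mult_ac)
qed

lemma eval_along_line_derivative:
  fixes p :: "'i::finite cpoly"
  shows "((\<lambda>s. eval (\<lambda>i. x i + s * b i) p) has_field_derivative
     (\<Sum>i\<in>UNIV. b i * eval (\<lambda>i. x i + s * b i) (pderivative i p))) (at s)"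
proof (induction p rule: cpoly_induct)
  case (Const c)
  show ?case by simp
next
  case (Var k)
  have "b i * eval (\<lambda>i. x i + s * b i) (if i = k then 1 else 0) = (if i = k then b k else 0)" for i
    by simp
  then show ?case by (auto intro!: derivative_eq_intros)
next
  case (add p q)
  then show ?case
    by (auto intro!: derivative_eq_intros simp: pderivative_add distrib_left sum.distrib)
next
  case (mult p q)
  show ?case
    unfolding eval_simps
    by (rule DERIV_cong[OF DERIV_mult[OF mult]])
      (simp only: pderivative_mult eval_simps distrib_left sum.distrib sum_distrib_left sum_distrib_right mult_ac)
qed

text \<open>The derivative of \<open>p\<close> in the direction \<open>b\<close> vanishes along the whole line.\<close>

lemma eval_translate_invariant:
  fixes p :: "'i::finite cpoly"
  assumes "(\<Sum>i\<in>UNIV. Const (b i) * pderivative i p) = 0"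
  shows "eval (\<lambda>i. x i + s * b i) p = eval x p"
proof -
  have "(\<Sum>i\<in>UNIV. b i * eval y (pderivative i p)) = 0" for y
    using arg_cong[OF assms, of "eval y"] by (simp add: eval_sum)
  then have "((\<lambda>s. eval (\<lambda>i. x i + s * b i) p) has_field_derivative 0) (at s)" for s
    using eval_along_line_derivative[of x b p s] by simp
  then obtain c where "\<And>s. eval (\<lambda>i. x i + s * b i) p = c"
    using has_field_derivative_zero_constant[OF convex_UNIV, of "\<lambda>s. eval (\<lambda>i. x i + s * b i) p"]
    by auto
  from this[of s] this[of 0] show ?thesis by simp
qed

section \<open>Homogeneous polynomials\<close>

lemma homogeneous_0 [simp]: "homogeneous d 0"
  by (simp add: homogeneous_def)

lemma homogeneous_add: "homogeneous d p \<Longrightarrow> homogeneous d q \<Longrightarrow> homogeneous d (p + q)"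
  using keys_add[of p q] by (auto simp: homogeneous_def)

lemma homogeneous_uminus: "homogeneous d p \<Longrightarrow> homogeneous d (- p)"
  by (simp add: homogeneous_def in_keys_iff)

lemma homogeneous_sum: "(\<And>i. i \<in> I \<Longrightarrow> homogeneous d (f i)) \<Longrightarrow> homogeneous d (\<Sum>i\<in>I. f i)"
  by (induction I rule: infinite_finite_induct) (auto intro: homogeneous_add)

lemma homogeneous_mult:
  assumes "homogeneous d p" "homogeneous e q"
  shows "homogeneous (d + e) (p * q)"
  unfolding homogeneous_def
proof
  fix m assume "m \<in> Poly_Mapping.keys (p * q)"
  then obtain a b where "m = a + b" "a \<in> Poly_Mapping.keys p" "b \<in> Poly_Mapping.keys q"
    using keys_mult[of p q] by blast
  then show "(\<Sum>i\<in>UNIV. Poly_Mapping.lookup m i) = d + e"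
    using assms by (simp add: homogeneous_def lookup_add sum.distrib)
qed

lemma homogeneous_single: "(\<Sum>i\<in>UNIV. Poly_Mapping.lookup m i) = d \<Longrightarrow> homogeneous d (Poly_Mapping.single m c)"
  by (simp add: homogeneous_def)

lemma homogeneous_Const: "homogeneous 0 (Const c)"
  by (simp add: Const_def homogeneous_single)

lemma homogeneous_Var: "homogeneous 1 (Var i)"
  unfolding Var_def by (rule homogeneous_single) (simp add: lookup_single when_def)

lemma homogeneous_Const_mult: "homogeneous d p \<Longrightarrow> homogeneous d (Const c * p)"
  using homogeneous_mult[OF homogeneous_Const[of c]] by simp

lemma homogeneous_prod:
  "finite I \<Longrightarrow> (\<And>i. i \<in> I \<Longrightarrow> homogeneous 1 (f i)) \<Longrightarrow> homogeneous (card I) (\<Prod>i\<in>I. f i)"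
proof (induction I rule: finite_induct)
  case empty
  show ?case using homogeneous_Const[of 1] by simp
next
  case (insert i I)
  then show ?case using homogeneous_mult[of 1 "f i" "card I"] by simp
qed

lemma homogeneous_det:
  fixes M :: "'n::finite \<Rightarrow> 'n \<Rightarrow> 'b::finite cpoly"
  assumes "\<And>i j. homogeneous 1 (M i j)"
  shows "homogeneous CARD('n) (det (\<chi> i j. M i j))"
proof -
  have "homogeneous CARD('n) (of_int (sign p) * (\<Prod>i\<in>UNIV. M i (p i)))" for p
  proof -
    have "(of_int (sign p) :: 'b cpoly) = Const (of_int (sign p))"
      by (simp add: sign_def Const_uminus)
    then show ?thesis
      by (simp only:) (intro homogeneous_Const_mult homogeneous_prod finite assms)
  qed
  then show ?thesis unfolding det_def by (intro homogeneous_sum) simp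
qed

lemma homogeneous_pderivative:
  assumes "homogeneous d p"
  shows "homogeneous (d - 1) (pderivative i p)"
  unfolding pderivative_def
proof (rule homogeneous_sum)
  fix m assume m: "m \<in> Poly_Mapping.keys p"
  show "homogeneous (d - 1) (Poly_Mapping.single (m - Poly_Mapping.single i 1)
      (of_nat (Poly_Mapping.lookup m i) * Poly_Mapping.lookup p m))"
  proof (cases "Poly_Mapping.lookup m i = 0")
    case False
    have "m = (m - Poly_Mapping.single i 1) + Poly_Mapping.single i 1"
      using False by (intro poly_mapping_eqI) (auto simp: lookup_add lookup_minus lookup_single when_def)
    then have "(\<Sum>j\<in>UNIV. Poly_Mapping.lookup m j) = (\<Sum>j\<in>UNIV. Poly_Mapping.lookup (m - Poly_Mapping.single i 1) j
        + Poly_Mapping.lookup (Poly_Mapping.single i 1) j)"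
      by (metis lookup_add)
    also have "\<dots> = (\<Sum>j\<in>UNIV. Poly_Mapping.lookup (m - Poly_Mapping.single i 1) j) + 1"
      by (simp add: sum.distrib lookup_single when_def)
    finally show ?thesis using assms m by (intro homogeneous_single) (simp add: homogeneous_def)
  qed simp
qed

lemma euler_identity:
  fixes p :: "'i::finite cpoly"
  assumes "homogeneous d p"
  shows "(\<Sum>i\<in>UNIV. Var i * pderivative i p) = of_nat d * p"
proof -
  have single: "(\<Sum>i\<in>UNIV. Var i * pderivative i (Poly_Mapping.single m c)) =
      of_nat (\<Sum>i\<in>UNIV. Poly_Mapping.lookup m i) * Poly_Mapping.single m c" for m :: "'i \<Rightarrow>\<^sub>0 nat" and c
  proof -
    have "Var i * pderivative i (Poly_Mapping.single m c) = of_nat (Poly_Mapping.lookup m i) * Poly_Mapping.single m c" for i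
    proof (cases "Poly_Mapping.lookup m i = 0")
      case False
      have "Poly_Mapping.single i 1 + (m - Poly_Mapping.single i 1) = m"
        using False by (intro poly_mapping_eqI) (auto simp: lookup_add lookup_minus lookup_single when_def)
      then show ?thesis
        by (simp add: Var_def pderivative_single mult_single flip: single_of_nat)
    qed (simp add: pderivative_single)
    then show ?thesis by (simp add: sum_distrib_right)
  qed
  have p: "p = (\<Sum>m\<in>Poly_Mapping.keys p. Poly_Mapping.single m (Poly_Mapping.lookup p m))"
    by (simp add: poly_mapping_sum_single)
  have "(\<Sum>i\<in>UNIV. Var i * pderivative i p) =
      (\<Sum>m\<in>Poly_Mapping.keys p. \<Sum>i\<in>UNIV. Var i * pderivative i (Poly_Mapping.single m (Poly_Mapping.lookup p m)))"
    by (subst p, simp only: pderivative_sum sum_distrib_left) (rule sum.swap)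
  also have "\<dots> = (\<Sum>m\<in>Poly_Mapping.keys p. of_nat d * Poly_Mapping.single m (Poly_Mapping.lookup p m))"
    using assms by (intro sum.cong refl) (simp only: single, simp add: homogeneous_def)
  finally show ?thesis by (simp only: poly_mapping_sum_single flip: sum_distrib_left)
qed

section \<open>Expansion of determinants along a row\<close>

text \<open>The determinant of the block of \<open>B\<close> with rows and columns in \<open>S\<close>. It allows repeated expansion
  within one index type.\<close>

definition partial_det :: "'n set \<Rightarrow> ('n \<Rightarrow> 'n \<Rightarrow> 'r::comm_ring_1) \<Rightarrow> 'r" where
  "partial_det S B = (\<Sum>q | q permutes S. of_int (sign q) * (\<Prod>i\<in>S. B i (q i)))"

lemma det_eq_partial_det: "det A = partial_det UNIV (\<lambda>i j. A $ i $ j)"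
  by (simp add: det_def partial_det_def)

lemma partial_det_empty [simp]: "partial_det {} B = 1"
  by (simp add: partial_det_def)

text \<open>Expansion along row \<open>a\<close>. The transposition of \<open>a\<close> and \<open>b\<close> puts column \<open>a\<close> into the place of the
  deleted column \<open>b\<close>, which turns every sign except the first into a minus.\<close>

lemma partial_det_insert:
  assumes S: "finite S" "a \<notin> S"
  shows "partial_det (insert a S) B =
    B a a * partial_det S B - (\<Sum>b\<in>S. B a b * partial_det S (\<lambda>i j. B i (Transposition.transpose a b j)))"
proof -
  have term_eq: "of_int (sign (Transposition.transpose a b \<circ> q)) * (\<Prod>i\<in>insert a S. B i ((Transposition.transpose a b \<circ> q) i)) =
      (if a = b then 1 else -1) * B a b * (of_int (sign q) * (\<Prod>i\<in>S. B i (Transposition.transpose a b (q i))))"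
    if q: "q permutes S" for b q
  proof -
    have "q a = a" using q S by (simp add: permutes_def)
    moreover have "sign (Transposition.transpose a b \<circ> q) = (if a = b then 1 else -1) * sign q"
    proof -
      have "permutation q" using q S(1) by (auto simp: permutation_permutes)
      then show ?thesis by (simp add: sign_compose permutation_swap_id sign_swap_id)
    qed
    ultimately show ?thesis using S by simp
  qed
  have "partial_det (insert a S) B =
      (\<Sum>b\<in>insert a S. \<Sum>q | q permutes S.
        (if a = b then 1 else -1) * B a b * (of_int (sign q) * (\<Prod>i\<in>S. B i (Transposition.transpose a b (q i)))))"
    unfolding partial_det_def sum_over_permutations_insert[OF S]
    by (intro sum.cong refl) (use term_eq in simp)
  also have "\<dots> = (\<Sum>b\<in>insert a S. (if a = b then 1 else -1) * B a b * partial_det S (\<lambda>i j. B i (Transposition.transpose a b j)))"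
    by (simp only: partial_det_def sum_distrib_left)
  also have "\<dots> = B a a * partial_det S (\<lambda>i j. B i (Transposition.transpose a a j)) +
      (\<Sum>b\<in>S. (if a = b then 1 else -1) * B a b * partial_det S (\<lambda>i j. B i (Transposition.transpose a b j)))"
    using S by simp
  also have "(\<Sum>b\<in>S. (if a = b then 1 else -1) * B a b * partial_det S (\<lambda>i j. B i (Transposition.transpose a b j))) =
      (\<Sum>b\<in>S. - (B a b * partial_det S (\<lambda>i j. B i (Transposition.transpose a b j))))"
    using S by (intro sum.cong) auto
  finally show ?thesis by (simp add: sum_negf)
qed

lemma partial_det_image:
  fixes f :: "'m::finite \<Rightarrow> 'n"
  assumes f: "inj f"
  shows "partial_det (range f) B = det (\<chi> r c. B (f r) (f c))"
proof -
  let ?h = "\<lambda>\<pi> x. if x \<in> range f then f (\<pi> (inv f x)) else x"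
  have bij: "bij_betw ?h {\<pi>. \<pi> permutes (UNIV :: 'm set)} {q. q permutes range f}"
    using bij_betw_permutations[of f UNIV "range f"] f by (simp add: bij_betw_def)
  have "partial_det (range f) B =
      (\<Sum>\<pi> | \<pi> permutes (UNIV :: 'm set). of_int (sign (?h \<pi>)) * (\<Prod>i\<in>range f. B i (?h \<pi> i)))"
    unfolding partial_det_def by (rule sum.reindex_bij_betw[OF bij, symmetric])
  also have "\<dots> = (\<Sum>\<pi> | \<pi> permutes (UNIV :: 'm set). of_int (sign \<pi>) * (\<Prod>r\<in>UNIV. B (f r) (f (\<pi> r))))"
  proof (intro sum.cong refl)
    fix \<pi> :: "'m \<Rightarrow> 'm" assume "\<pi> \<in> {\<pi>. \<pi> permutes UNIV}"
    moreover have "?h \<pi> = map_permutation UNIV f \<pi>"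
      by (auto simp: map_permutation_def restrict_id_def fun_eq_iff)
    ultimately have "sign (?h \<pi>) = sign \<pi>" using sign_map_permutation[of f UNIV \<pi>] f by simp
    then show "of_int (sign (?h \<pi>)) * (\<Prod>i\<in>range f. B i (?h \<pi> i)) =
        of_int (sign \<pi>) * (\<Prod>r\<in>UNIV. B (f r) (f (\<pi> r)))"
      using f by (simp add: prod.reindex)
  qed
  finally show ?thesis by (simp add: det_def)
qed

text \<open>Laplace expansion along row \<open>a\<close>, with the cofactors written as determinants over a smaller index
  type, the form in which the minors of a degeneracy locus are given.\<close>

lemma det_in_ideal_of_cofactors:
  fixes A :: "'r::comm_ring_1^'n^'n" and f :: "'m::finite \<Rightarrow> 'n"
  assumes f: "inj f" "range f = UNIV - {a}"
    and minors: "\<And>b. det (\<chi> r c. A $ f r $ Transposition.transpose a b (f c)) \<in> ideal.span I"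
  shows "det A \<in> ideal.span I"
proof -
  have U: "UNIV = insert a (range f)" using f(2) by auto
  have *: "B * partial_det (range f) (\<lambda>i j. A $ i $ Transposition.transpose a b j) \<in> ideal.span I" for B b
    using minors[of b] by (simp add: partial_det_image[OF f(1)] ideal.span_scale)
  have "partial_det (range f) (\<lambda>i j. A $ i $ j) = partial_det (range f) (\<lambda>i j. A $ i $ Transposition.transpose a a j)"
    by simp
  then have D: "det A = A $ a $ a * partial_det (range f) (\<lambda>i j. A $ i $ Transposition.transpose a a j) -
      (\<Sum>b\<in>range f. A $ a $ b * partial_det (range f) (\<lambda>i j. A $ i $ Transposition.transpose a b j))"
    unfolding det_eq_partial_det using f(2)
    by (subst U, subst partial_det_insert) auto
  show ?thesis unfolding D by (intro ideal.span_diff ideal.span_sum *)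
qed

section \<open>Maximal minors of alternating forms\<close>

definition minor :: "('m::finite \<Rightarrow> complex ^ (6 \<times> 6)) \<Rightarrow> ('m \<Rightarrow> 6) \<Rightarrow> 6 cpoly" where
  "minor u j = det (\<chi> a b. form_coeff (u a) (j b))"

lemma chart_minors_eq: "chart_minors TYPE('m::finite) U i = {minor u j | (u :: 'm \<Rightarrow> _) j. range u \<subseteq> U \<and> i \<notin> range j}"
  by (simp add: chart_minors_def minor_def)

text \<open>Contraction with the Euler vector field gives \<open>u(x, x)\<close>.\<close>

lemma alternating_contraction:
  assumes "u \<in> alternating_forms"
  shows "(\<Sum>j\<in>UNIV. Var j * form_coeff u j) = 0"
proof -
  have c: "Const (u $ (j, i)) = - Const (u $ (i, j))" for i j
  proof -
    have "u $ (j, i) = - u $ (i, j)" using assms unfolding alternating_forms_def by blast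
    then show ?thesis by (simp only: Const_uminus)
  qed
  define S where "S = (\<Sum>j\<in>UNIV. \<Sum>i\<in>UNIV. Const (u $ (i, j)) * Var i * (Var j :: 6 cpoly))"
  have "S = (\<Sum>i\<in>UNIV. \<Sum>j\<in>UNIV. Const (u $ (i, j)) * Var i * Var j)"
    unfolding S_def by (rule sum.swap)
  also have "\<dots> = (\<Sum>i\<in>UNIV. \<Sum>j\<in>UNIV. - (Const (u $ (j, i)) * Var j * Var i))"
  proof (rule sum.cong[OF refl], rule sum.cong[OF refl])
    fix i j
    show "Const (u $ (i, j)) * Var i * Var j = - (Const (u $ (j, i)) * Var j * Var i)"
      by (subst c) (simp only: mult_minus_left mult.assoc mult.commute[of "Var i"])
  qed
  also have "\<dots> = - S" by (simp only: sum_negf S_def)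
  finally have "S = - S" .
  then have "2 * S = 0" by (metis add_eq_0_iff mult_2)
  then have "S = 0" by simp
  moreover have "(\<Sum>j\<in>UNIV. Var j * form_coeff u j) = S"
    unfolding S_def form_coeff_def sum_distrib_left
    by (rule sum.cong[OF refl], rule sum.cong[OF refl], rule mult.commute)
  ultimately show ?thesis by simp
qed

lemma homogeneous_form_coeff: "homogeneous 1 (form_coeff u j)"
  unfolding form_coeff_def by (intro homogeneous_sum homogeneous_Const_mult homogeneous_Var)

lemma homogeneous_minor: "homogeneous CARD('m) (minor (u :: 'm::finite \<Rightarrow> _) j)"
  unfolding minor_def by (intro homogeneous_det homogeneous_form_coeff)

lemma minor_transpose: "minor u j = det (\<chi> b. \<chi> a. form_coeff (u a) (j b))"
proof -
  have "transpose (\<chi> a b. form_coeff (u a) (j b)) = (\<chi> b. \<chi> a. form_coeff (u a) (j b))"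
    by (simp add: transpose_def)
  then show ?thesis unfolding minor_def by (metis det_transpose)
qed

text \<open>By \<open>alternating_contraction\<close>, \<open>x\<^sub>i\<close> times column \<open>i\<close> is minus the sum of the \<open>x\<^sub>c\<close> times the other
  columns \<open>c\<close>. Substituted for column \<open>b\<close> of the minor, all of these but one repeat a column.\<close>

lemma minor_exchange:
  fixes w :: "'m::finite \<Rightarrow> complex ^ (6 \<times> 6)"
  assumes w: "\<And>a. w a \<in> alternating_forms" and j: "inj j" "range j = UNIV - {i}"
  shows "Var i * minor w (j(b := i)) = - (Var (j b) * minor w j)"
proof -
  let ?col = "\<lambda>c. (\<chi> a. form_coeff (w a) c) :: 6 cpoly ^ 'm"
  have col: "Var i *s ?col i = (\<Sum>b\<in>UNIV. - Var (j b) *s ?col (j b))"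
  proof (intro vec_eq_iff[THEN iffD2] allI)
    fix a
    have "UNIV = insert i (range j)" using j(2) by auto
    then have "0 = (\<Sum>c\<in>insert i (range j). Var c * form_coeff (w a) c)"
      using alternating_contraction[OF w, of a] by simp
    also have "\<dots> = Var i * form_coeff (w a) i + (\<Sum>b\<in>UNIV. Var (j b) * form_coeff (w a) (j b))"
    proof -
      have "i \<notin> range j" using j(2) by simp
      then show ?thesis by (simp only: sum.insert finite sum.reindex[OF j(1)] o_def not_False_eq_True)
    qed
    finally show "(Var i *s ?col i) $ a = (\<Sum>b\<in>UNIV. - Var (j b) *s ?col (j b)) $ a"
      by (simp add: sum_component sum_negf eq_neg_iff_add_eq_0)
  qed
  have "Var i * minor w (j(b := i)) = Var i * det (\<chi> r. if r = b then ?col i else ?col (j r))"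
    unfolding minor_transpose by (intro arg_cong[of _ _ "\<lambda>M. Var i * det M"]) (simp add: vec_eq_iff)
  also have "\<dots> = det (\<chi> r. if r = b then Var i *s ?col i else ?col (j r))"
    by (rule det_row_mul[of b "Var i" "\<lambda>_. ?col i", symmetric])
  also have "\<dots> = (\<Sum>b'\<in>UNIV. det (\<chi> r. if r = b then - Var (j b') *s ?col (j b') else ?col (j r)))"
    unfolding col by (rule det_linear_row_sum) simp
  also have "\<dots> = (\<Sum>b'\<in>UNIV. - Var (j b') * det (\<chi> r. if r = b then ?col (j b') else ?col (j r)))"
    by (intro sum.cong refl det_row_mul)
  also have "\<dots> = (\<Sum>b'\<in>UNIV. if b' = b then - Var (j b) * minor w j else 0)"
  proof (intro sum.cong refl)
    fix b'
    have "det (\<chi> r. if r = b then ?col (j b') else ?col (j r)) = 0" if "b' \<noteq> b"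
      by (rule det_identical_rows[OF that]) (use that in \<open>simp add: row_def\<close>)
    moreover have "det (\<chi> r. if r = b then ?col (j b) else ?col (j r)) = minor w j"
      unfolding minor_transpose by (intro arg_cong[of _ _ det]) (simp add: vec_eq_iff)
    ultimately show "- Var (j b') * det (\<chi> r. if r = b then ?col (j b') else ?col (j r)) =
        (if b' = b then - Var (j b) * minor w j else 0)" by auto
  qed
  finally show ?thesis by simp
qed

lemma minor_permute: "p permutes UNIV \<Longrightarrow> minor w (j \<circ> p) = of_int (sign p) * minor w j"
  using det_permute_columns[of p "\<chi> a b. form_coeff (w a) (j b)"] by (simp add: minor_def)

lemma minor_not_inj: "\<not> inj j \<Longrightarrow> minor w j = 0"
  unfolding minor_def inj_def by (auto intro!: det_identical_columns simp: column_def)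

lemma minor_same_range:
  assumes "inj j" "inj j'" "range j = range j'"
  shows "minor w j = minor w j' \<or> minor w j = - minor w j'"
proof -
  have "bij (inv j' \<circ> j)"
  proof (rule bijI)
    show "inj (inv j' \<circ> j)" using assms
      by (intro comp_inj_on) (auto intro: inj_on_inv_into)
    then show "surj (inv j' \<circ> j)" by (rule finite_UNIV_inj_surj[OF finite])
  qed
  then have "(inv j' \<circ> j) permutes UNIV" by (intro bij_imp_permutes) auto
  moreover have "j' \<circ> (inv j' \<circ> j) = j"
  proof
    fix x
    have "j x \<in> range j'" using assms(3) by blast
    then show "(j' \<circ> (inv j' \<circ> j)) x = j x" by (simp add: f_inv_into_f)
  qed
  ultimately have "minor w j = of_int (sign (inv j' \<circ> j)) * minor w j'"
    using minor_permute[of "inv j' \<circ> j" w j'] by simp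
  then show ?thesis by (cases "inv j' \<circ> j" rule: sign_cases) auto
qed

lemma range_missing:
  fixes j :: "5 \<Rightarrow> 6"
  assumes "inj j" "i \<notin> range j"
  shows "range j = UNIV - {i}"
proof (rule card_subset_eq)
  show "card (range j) = card (UNIV - {i} :: 6 set)" using assms by (simp add: card_image)
qed (use assms in auto)

text \<open>The exchange relations say that the signed minors \<open>N k\<close>, in which column \<open>k\<close> is omitted, satisfy
  \<open>x\<^sub>i N k = x\<^sub>k N i\<close>. This forces \<open>N i = x\<^sub>i F\<close>. Unique factorization is avoided by writing \<open>F\<close>
  down as a multiple of the divergence \<open>G = \<Sum>k. \<partial>(N k) / \<partial>x\<^sub>k\<close>: differentiating the relation with
  respect to \<open>x\<^sub>k\<close> and summing over \<open>k\<close> gives \<open>N i + x\<^sub>i G = 6 N i + 5 N i\<close>, where \<open>6\<close> is the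
  number of variables and \<open>5\<close> the degree in Euler's identity.\<close>

lemma minors_divisible:
  fixes w :: "5 \<Rightarrow> complex ^ (6 \<times> 6)" and j0 :: "5 \<Rightarrow> 6"
  assumes w: "\<And>a. w a \<in> alternating_forms" and j0: "inj j0" "0 \<notin> range j0"
  shows "\<exists>F. homogeneous 4 F \<and> minor w j0 = Var 0 * F \<and>
    (\<forall>i j. i \<notin> range j \<longrightarrow> inj j \<longrightarrow> minor w j = Var i * F \<or> minor w j = - (Var i * F))"
proof -
  define J where "J k = (if k = 0 then j0 else j0(inv j0 k := 0))" for k
  define N where "N k = (if k = 0 then minor w j0 else - minor w (J k))" for k
  have r0: "range j0 = UNIV - {0}" using range_missing[OF j0] .
  have Jinj: "inj (J k)" and Jk: "k \<notin> range (J k)" for k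
  proof -
    have *: "j0 (inv j0 k) = k" if "k \<noteq> 0"
      using that r0 by (intro f_inv_into_f) auto
    show "inj (J k)" using j0 by (auto simp: J_def inj_def)
    show "k \<notin> range (J k)"
    proof (cases "k = 0")
      case False
      then show ?thesis using *[OF False] j0 by (auto simp: J_def inj_def)
    qed (use j0 in \<open>simp add: J_def\<close>)
  qed
  have N0: "Var 0 * N k = Var k * N 0" for k
  proof (cases "k = 0")
    case False
    then have "j0 (inv j0 k) = k" using r0 by (intro f_inv_into_f) auto
    then show ?thesis
      using minor_exchange[OF w j0(1) r0, where b = "inv j0 k"] False by (simp add: N_def J_def)
  qed simp
  have Var0: "(Var 0 :: 6 cpoly) \<noteq> 0"
  proof
    assume "(Var 0 :: 6 cpoly) = 0"
    from arg_cong[OF this, of "eval (\<lambda>_. 1)"] show False by simp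
  qed
  have comm: "Var i * N k = Var k * N i" for i k
  proof -
    have "Var 0 * (Var i * N k) = Var i * (Var 0 * N k)" by (rule mult.left_commute)
    also have "\<dots> = Var k * (Var i * N 0)" unfolding N0 by (rule mult.left_commute)
    also have "\<dots> = Var 0 * (Var k * N i)" unfolding N0[of i, symmetric] by (rule mult.left_commute)
    finally show ?thesis using Var0 by (metis mult_left_cancel)
  qed
  have homN: "homogeneous 5 (N k)" for k
    using homogeneous_minor[of w j0] homogeneous_uminus[OF homogeneous_minor[of w "J k"]] by (simp add: N_def)
  define G where "G = (\<Sum>k\<in>UNIV. pderivative k (N k))"
  have G: "Var i * G = 10 * N i" for i
  proof -
    have "pderivative k (Var i * N k) = (if k = i then N i else 0) + Var i * pderivative k (N k)" for k
      by (simp add: pderivative_mult)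
    then have "(\<Sum>k\<in>UNIV. pderivative k (Var i * N k)) = N i + Var i * G"
      by (simp add: sum.distrib G_def sum_distrib_left)
    moreover have "(\<Sum>k\<in>UNIV. pderivative k (Var i * N k)) = (\<Sum>k\<in>UNIV. N i + Var k * pderivative k (N i))"
      by (intro sum.cong refl) (simp add: comm[of i] pderivative_mult)
    moreover have "\<dots> = 11 * N i"
      using euler_identity[OF homN, of i] by (simp add: sum.distrib)
    ultimately show ?thesis by (simp add: algebra_simps)
  qed
  define F where "F = Const (1 / 10) * G"
  have ten: "Const (1 / 10) * (10 * p) = p" for p :: "6 cpoly"
  proof -
    have "(10 :: 6 cpoly) = Const 10" by (simp add: Const_def)
    then have "Const (1 / 10) * (10 * p) = Const (1 / 10 * 10) * p" by (simp only: Const_mult mult.assoc)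
    then show ?thesis by simp
  qed
  have F: "Var i * F = N i" for i
    by (simp only: F_def mult.left_commute[of "Var i" "Const (1 / 10)"] G ten)
  show ?thesis
  proof (intro exI[of _ F] conjI allI impI)
    show "homogeneous 4 F" unfolding F_def G_def
      using homogeneous_pderivative[OF homN] by (intro homogeneous_Const_mult homogeneous_sum) simp
    show "minor w j0 = Var 0 * F" using F[of 0] by (simp add: N_def)
    fix i and j :: "5 \<Rightarrow> 6" assume j: "i \<notin> range j" "inj j"
    have "range j = range (J i)" using range_missing[OF j(2,1)] range_missing[OF Jinj Jk] by simp
    then have "minor w j = minor w (J i) \<or> minor w j = - minor w (J i)"
      using minor_same_range[OF j(2) Jinj] by blast
    moreover have "minor w (J i) = N i \<or> minor w (J i) = - N i"
      by (auto simp: N_def J_def)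
    ultimately show "minor w j = Var i * F \<or> minor w j = - (Var i * F)"
      unfolding F by auto
  qed
qed

lemma minor_combination:
  fixes u w :: "'m::finite \<Rightarrow> complex ^ (6 \<times> 6)"
  assumes u: "\<And>a. u a = (\<Sum>k\<in>UNIV. g a k *s w k)"
  shows "minor u j = Const (det (\<chi> a k. g a k)) * minor w j"
proof -
  have coeff: "form_coeff (u a) i = (\<Sum>k\<in>UNIV. Const (g a k) * form_coeff (w k) i)" for a i
  proof -
    have "form_coeff (u a) i = (\<Sum>l\<in>UNIV. \<Sum>k\<in>UNIV. Const (g a k) * (Const (w k $ (l, i)) * Var l))"
    proof -
      have "u a $ (l, i) = (\<Sum>k\<in>UNIV. g a k * w k $ (l, i))" for l
        unfolding u by (simp add: sum_component)
      then show ?thesis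
        unfolding form_coeff_def by (simp only: Const_sum Const_mult sum_distrib_right mult.assoc)
    qed
    also have "\<dots> = (\<Sum>k\<in>UNIV. Const (g a k) * form_coeff (w k) i)"
      unfolding form_coeff_def sum_distrib_left by (rule sum.swap)
    finally show ?thesis .
  qed
  have "(\<chi> a b. form_coeff (u a) (j b)) = (\<chi> a k. Const (g a k)) ** (\<chi> k b. form_coeff (w k) (j b))"
    by (simp add: matrix_matrix_mult_def coeff)
  then have "minor u j = det (\<chi> a k. Const (g a k)) * minor w j"
    by (simp only: minor_def det_mul)
  moreover have "(det (\<chi> a k. Const (g a k)) :: 6 cpoly) = Const (det (\<chi> a k. g a k))"
  proof -
    have p: "Const (\<Prod>i\<in>I. f i) = (\<Prod>i\<in>I. Const (f i))" for f :: "'m \<Rightarrow> complex" and I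
      by (induction I rule: infinite_finite_induct) (simp_all add: Const_mult)
    have s: "Const (of_int (sign q)) = of_int (sign q)" for q :: "'m \<Rightarrow> 'm"
      by (simp add: sign_def Const_uminus)
    show ?thesis by (simp add: det_def Const_sum Const_mult p s)
  qed
  ultimately show ?thesis by simp
qed

section \<open>Deformation of a transversal pencil\<close>

lemma has_derivative_vec:
  fixes f :: "'a::real_normed_vector \<Rightarrow> 'n::finite \<Rightarrow> 'b::euclidean_space"
  assumes "\<And>j. ((\<lambda>z. f z j) has_derivative (\<lambda>h. f' h j)) F"
  shows "((\<lambda>z. \<chi> j. f z j) has_derivative (\<lambda>h. \<chi> j. f' h j)) F"
proof -
  have bl: "bounded_linear (axis k :: 'b \<Rightarrow> 'b^'n)" for k
  proof -
    have "linear (axis k :: 'b \<Rightarrow> 'b^'n)"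
      by (rule linearI) (simp_all add: axis_def vec_eq_iff)
    then show ?thesis by (simp add: linear_conv_bounded_linear)
  qed
  have eq: "(\<chi> j. g j) = (\<Sum>j\<in>UNIV. axis j (g j))" for g :: "'n \<Rightarrow> 'b"
    by (simp add: vec_eq_iff sum_component axis_def if_distrib cong: if_cong)
  show ?thesis unfolding eq
    by (intro has_derivative_sum bounded_linear.has_derivative[OF bl] assms)
qed

lemma pencil_map_derivative:
  fixes A B :: "'m::finite \<Rightarrow> 'n::finite \<Rightarrow> 'n \<Rightarrow> complex"
    and T :: "'z::real_normed_vector \<Rightarrow> real" and X :: "'z \<Rightarrow> complex^'n" and C :: "'z \<Rightarrow> complex^'m"
    and S :: "'z \<Rightarrow> complex"
  assumes bl: "bounded_linear T" "bounded_linear X" "bounded_linear C" "bounded_linear S"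
    and z0: "T z0 = 0"
  shows "((\<lambda>z. \<chi> j. (\<Sum>l\<in>UNIV. \<Sum>i\<in>UNIV. C z $ l * (A l j i + of_real (T z) * B l j i) * X z $ i) + S z * \<delta> j)
    has_derivative
      (\<lambda>h. \<chi> j. (\<Sum>l\<in>UNIV. \<Sum>i\<in>UNIV. C h $ l * A l j i * X z0 $ i +
        C z0 $ l * of_real (T h) * B l j i * X z0 $ i + C z0 $ l * A l j i * X h $ i) + S h * \<delta> j)) (at z0)"
proof (rule has_derivative_vec)
  fix j
  have C: "((\<lambda>z. C z $ l) has_derivative (\<lambda>h. C h $ l)) (at z0)" for l
    by (intro bounded_linear_imp_has_derivative bounded_linear_compose[OF bounded_linear_vec_nth bl(3)])
  have X: "((\<lambda>z. X z $ i) has_derivative (\<lambda>h. X h $ i)) (at z0)" for i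
    by (intro bounded_linear_imp_has_derivative bounded_linear_compose[OF bounded_linear_vec_nth bl(2)])
  have S: "(S has_derivative S) (at z0)" by (rule bounded_linear_imp_has_derivative[OF bl(4)])
  have T: "((\<lambda>z. complex_of_real (T z)) has_derivative (\<lambda>h. of_real (T h))) (at z0)"
    by (intro bounded_linear_imp_has_derivative bounded_linear_compose[OF bounded_linear_of_real bl(1)])
  have term_der: "((\<lambda>z. C z $ l * (A l j i + of_real (T z) * B l j i) * X z $ i) has_derivative
      (\<lambda>h. C h $ l * A l j i * X z0 $ i + C z0 $ l * of_real (T h) * B l j i * X z0 $ i + C z0 $ l * A l j i * X h $ i))
      (at z0)" for l i
  proof -
    have TB: "((\<lambda>z. A l j i + of_real (T z) * B l j i) has_derivative (\<lambda>h. of_real (T h) * B l j i)) (at z0)"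
      using has_derivative_add[OF has_derivative_const has_derivative_mult_left[OF T], of "A l j i" "B l j i"] by simp
    have "((\<lambda>z. C z $ l * (A l j i + of_real (T z) * B l j i) * X z $ i) has_derivative
        (\<lambda>h. (C z0 $ l * (A l j i + of_real (T z0) * B l j i)) * X h $ i +
          (C z0 $ l * (of_real (T h) * B l j i) + C h $ l * (A l j i + of_real (T z0) * B l j i)) * X z0 $ i)) (at z0)"
      by (rule has_derivative_mult[OF has_derivative_mult[OF C TB] X])
    moreover have "(C z0 $ l * (A l j i + of_real (T z0) * B l j i)) * X h $ i +
          (C z0 $ l * (of_real (T h) * B l j i) + C h $ l * (A l j i + of_real (T z0) * B l j i)) * X z0 $ i =
        C h $ l * A l j i * X z0 $ i + C z0 $ l * of_real (T h) * B l j i * X z0 $ i + C z0 $ l * A l j i * X h $ i" for h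
      unfolding z0 of_real_0 mult_zero_left add_0_right by (simp add: distrib_right)
    ultimately show ?thesis by (simp only:)
  qed
  show "((\<lambda>z. (\<Sum>l\<in>UNIV. \<Sum>i\<in>UNIV. C z $ l * (A l j i + of_real (T z) * B l j i) * X z $ i) + S z * \<delta> j)
    has_derivative
      (\<lambda>h. (\<Sum>l\<in>UNIV. \<Sum>i\<in>UNIV. C h $ l * A l j i * X z0 $ i +
        C z0 $ l * of_real (T h) * B l j i * X z0 $ i + C z0 $ l * A l j i * X h $ i) + S h * \<delta> j)) (at z0)"
    by (intro has_derivative_add has_derivative_sum term_der has_derivative_mult_left[OF S])
qed

lemma complex_functional_zero:
  assumes "\<And>\<gamma>::complex. Re (\<gamma> * a) = 0"
  shows "a = 0"
  using assms[of 1] assms[of "-\<i>"] by (simp add: complex_eq_iff)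

lemma inner_vec_complex: "inner (Y :: complex^'n) s = Re (\<Sum>j\<in>UNIV. cnj (Y $ j) * s $ j)"
  by (simp add: inner_vec_def inner_complex_def)

text \<open>The vectors \<open>c\<close> and \<open>d\<close> span a pencil of forms vanishing at \<open>p\<close>. The condition says that
  \<open>c \<cdot> A x = 0\<close>, \<open>d \<cdot> A x = 0\<close>, as equations in the unknowns \<open>x\<close>, \<open>c\<close>, \<open>d\<close>, have independent
  differentials at this solution: a covector \<open>(y, z)\<close> that annihilates the image of the
  differential is zero. For skew-symmetric \<open>A\<close> the pairing of \<open>c \<cdot> A x\<close> with \<open>x\<close> is zero, so the
  component \<open>i0\<close>, with \<open>p $ i0 \<noteq> 0\<close>, of either equation is a consequence of the others; this is
  why only covectors with \<open>y $ i0 = z $ i0 = 0\<close> count.\<close>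

definition transversal_pencil ::
  "('m::finite \<Rightarrow> 'n::finite \<Rightarrow> 'n \<Rightarrow> complex) \<Rightarrow> complex^'n \<Rightarrow> 'n \<Rightarrow> complex^'m \<Rightarrow> complex^'m \<Rightarrow> bool" where
  "transversal_pencil A p i0 c d \<longleftrightarrow> (\<forall>y z :: complex^'n. y $ i0 = 0 \<and> z $ i0 = 0 \<and>
      (\<forall>l. (\<Sum>j\<in>UNIV. \<Sum>i\<in>UNIV. y $ j * A l j i * p $ i) = 0) \<and>
      (\<forall>l. (\<Sum>j\<in>UNIV. \<Sum>i\<in>UNIV. z $ j * A l j i * p $ i) = 0) \<and>
      (\<forall>i. (\<Sum>j\<in>UNIV. \<Sum>l\<in>UNIV. y $ j * c $ l * A l j i + z $ j * d $ l * A l j i) = 0) \<longrightarrow> y = 0 \<and> z = 0)"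

text \<open>The unknowns \<open>\<sigma>\<close> and \<open>\<tau>\<close> fill the redundant direction \<open>i0\<close>. The map is linear over the reals and
  its image is stable under multiplication with complex numbers, so that orthogonality in the real
  inner product yields complex equations for \<open>(y, z)\<close>.\<close>

lemma pencil_linearization_surj:
  fixes A :: "'m::finite \<Rightarrow> 'n::finite \<Rightarrow> 'n \<Rightarrow> complex" and p :: "complex^'n" and c d :: "complex^'m"
  assumes inj: "transversal_pencil A p i0 c d"
  shows "\<exists>x' c' \<sigma> d' \<tau>.
    (\<chi> j. (\<Sum>l\<in>UNIV. \<Sum>i\<in>UNIV. c' $ l * A l j i * p $ i + c $ l * A l j i * x' $ i) + \<sigma> * (if j = i0 then 1 else 0)) = f \<and>
    (\<chi> j. (\<Sum>l\<in>UNIV. \<Sum>i\<in>UNIV. d' $ l * A l j i * p $ i + d $ l * A l j i * x' $ i) + \<tau> * (if j = i0 then 1 else 0)) = g"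
proof -
  define G :: "complex^'m \<Rightarrow> complex^'n \<Rightarrow> complex^'m \<Rightarrow> complex \<Rightarrow> complex^'n" where
    "G c x' c' \<sigma> = (\<chi> j. (\<Sum>l\<in>UNIV. \<Sum>i\<in>UNIV. c' $ l * A l j i * p $ i + c $ l * A l j i * x' $ i) +
       \<sigma> * (if j = i0 then 1 else 0))" for c x' c' \<sigma>
  define L where "L = (\<lambda>(x', c', \<sigma>, d', \<tau>). (G c x' c' \<sigma>, G d x' d' \<tau>))"
  have G_add: "G c (x1 + x2) (c1 + c2) (s1 + s2) = G c x1 c1 s1 + G c x2 c2 s2" for c x1 x2 c1 c2 s1 s2
    unfolding G_def vec_eq_iff vec_lambda_beta vector_add_component
    by (simp only: distrib_left distrib_right sum.distrib add.assoc add.left_commute add.commute simp_thms)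
  have G_scale: "G c (r *\<^sub>R x1) (r *\<^sub>R c1) (r *\<^sub>R s1) = r *\<^sub>R G c x1 c1 s1" for r c x1 c1 s1
    unfolding G_def vec_eq_iff vec_lambda_beta vector_scaleR_component
    by (simp only: scaleR_sum_right scaleR_add_right mult_scaleR_left mult_scaleR_right simp_thms)
  have lin: "linear L"
    by (rule linearI) (auto simp: L_def G_add G_scale)
  have "range L = UNIV"
  proof (rule ccontr)
    assume ne: "range L \<noteq> UNIV"
    have sp: "span (range L) = range L"
      by (simp add: span_eq_iff linear_subspace_image[OF lin])
    have "dim (range L) \<noteq> DIM((complex^'n) \<times> (complex^'n))"
      unfolding dim_eq_full sp by fact
    then have "dim (range L) < DIM((complex^'n) \<times> (complex^'n))"
      using dim_subset_UNIV[of "range L"] by linarith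
    then obtain YZ where YZ: "YZ \<noteq> 0" "\<And>s. s \<in> span (range L) \<Longrightarrow> orthogonal YZ s"
      using orthogonal_to_subspace_exists by blast
    define y where "y = (\<chi> j. cnj (fst YZ $ j))"
    define z where "z = (\<chi> j. cnj (snd YZ $ j))"
    have orth: "Re ((\<Sum>j\<in>UNIV. y $ j * G c x' c' \<sigma> $ j) + (\<Sum>j\<in>UNIV. z $ j * G d x' d' \<tau> $ j)) = 0" for x' c' \<sigma> d' \<tau>
    proof -
      have "inner YZ (L (x', c', \<sigma>, d', \<tau>)) = 0"
        using YZ(2)[OF span_base[OF rangeI]] by (simp add: orthogonal_def)
      then show ?thesis
        by (cases YZ) (simp add: L_def inner_prod_def inner_vec_complex y_def z_def)
    qed
    have G0: "G c 0 0 0 = 0" for c by (simp add: G_def vec_eq_iff)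
    have yi: "y $ i0 = 0"
    proof (rule complex_functional_zero)
      fix \<gamma>
      have "(\<Sum>j\<in>UNIV. y $ j * G c 0 0 \<gamma> $ j) = \<gamma> * y $ i0"
        by (simp add: G_def if_distrib cong: if_cong)
      then show "Re (\<gamma> * y $ i0) = 0" using orth[of 0 0 \<gamma> 0 0] by (simp add: G0)
    qed
    have zi: "z $ i0 = 0"
    proof (rule complex_functional_zero)
      fix \<gamma>
      have "(\<Sum>j\<in>UNIV. z $ j * G d 0 0 \<gamma> $ j) = \<gamma> * z $ i0"
        by (simp add: G_def if_distrib cong: if_cong)
      then show "Re (\<gamma> * z $ i0) = 0" using orth[of 0 0 0 0 \<gamma>] by (simp add: G0)
    qed
    have Gaxis: "G c 0 (axis l \<gamma>) 0 $ j = (\<Sum>i\<in>UNIV. \<gamma> * A l j i * p $ i)" for c l \<gamma> j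
    proof -
      have "(\<Sum>i\<in>UNIV. axis l \<gamma> $ k * A k j i * p $ i) = (if k = l then (\<Sum>i\<in>UNIV. \<gamma> * A l j i * p $ i) else 0)" for k
        by (simp add: axis_def)
      then show ?thesis by (simp add: G_def)
    qed
    have yl: "(\<Sum>j\<in>UNIV. \<Sum>i\<in>UNIV. y $ j * A l j i * p $ i) = 0" for l
    proof (rule complex_functional_zero)
      fix \<gamma>
      have "(\<Sum>j\<in>UNIV. y $ j * G c 0 (axis l \<gamma>) 0 $ j) = \<gamma> * (\<Sum>j\<in>UNIV. \<Sum>i\<in>UNIV. y $ j * A l j i * p $ i)"
        by (simp only: Gaxis sum_distrib_left) (simp only: mult_ac)
      then show "Re (\<gamma> * (\<Sum>j\<in>UNIV. \<Sum>i\<in>UNIV. y $ j * A l j i * p $ i)) = 0"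
        using orth[of 0 "axis l \<gamma>" 0 0 0] by (simp add: G0)
    qed
    have zl: "(\<Sum>j\<in>UNIV. \<Sum>i\<in>UNIV. z $ j * A l j i * p $ i) = 0" for l
    proof (rule complex_functional_zero)
      fix \<gamma>
      have "(\<Sum>j\<in>UNIV. z $ j * G d 0 (axis l \<gamma>) 0 $ j) = \<gamma> * (\<Sum>j\<in>UNIV. \<Sum>i\<in>UNIV. z $ j * A l j i * p $ i)"
        by (simp only: Gaxis sum_distrib_left) (simp only: mult_ac)
      then show "Re (\<gamma> * (\<Sum>j\<in>UNIV. \<Sum>i\<in>UNIV. z $ j * A l j i * p $ i)) = 0"
        using orth[of 0 0 0 "axis l \<gamma>" 0] by (simp add: G0)
    qed
    have Gx: "G c (axis i \<gamma>) 0 0 $ j = (\<Sum>l\<in>UNIV. \<gamma> * c $ l * A l j i)" for c i \<gamma> j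
    proof -
      have "(\<Sum>k\<in>UNIV. c $ l * A l j k * axis i \<gamma> $ k) = (\<Sum>k\<in>UNIV. if k = i then \<gamma> * c $ l * A l j i else 0)" for l
        by (intro sum.cong refl) (simp add: axis_def)
      then show ?thesis by (simp add: G_def)
    qed
    have yz: "(\<Sum>j\<in>UNIV. \<Sum>l\<in>UNIV. y $ j * c $ l * A l j i + z $ j * d $ l * A l j i) = 0" for i
    proof (rule complex_functional_zero)
      fix \<gamma>
      have "\<gamma> * (\<Sum>j\<in>UNIV. \<Sum>l\<in>UNIV. y $ j * c $ l * A l j i + z $ j * d $ l * A l j i) =
          (\<Sum>j\<in>UNIV. y $ j * G c (axis i \<gamma>) 0 0 $ j) + (\<Sum>j\<in>UNIV. z $ j * G d (axis i \<gamma>) 0 0 $ j)"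
        by (simp only: Gx sum_distrib_left sum.distrib distrib_left) (simp only: mult_ac)
      then show "Re (\<gamma> * (\<Sum>j\<in>UNIV. \<Sum>l\<in>UNIV. y $ j * c $ l * A l j i + z $ j * d $ l * A l j i)) = 0"
        using orth[of "axis i \<gamma>" 0 0 0 0] by simp
    qed
    have "y = 0 \<and> z = 0" using inj yi zi yl zl yz unfolding transversal_pencil_def by blast
    then have "fst YZ = 0 \<and> snd YZ = 0"
      by (simp add: y_def z_def vec_eq_iff)
    then show False using YZ(1) by (simp add: prod_eq_iff)
  qed
  then have "(f, g) \<in> range L" by simp
  then show ?thesis unfolding L_def G_def by auto
qed

text \<open>The open mapping property at a point with surjective derivative. The unknowns include slack
  variables \<open>\<sigma>\<close> and \<open>\<tau>\<close>, which are added to component \<open>i0\<close> of the equations to make the derivative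
  surjective. At a solution they vanish: pairing the equation with \<open>x\<close> kills the skew-symmetric
  part and leaves \<open>\<sigma> x $ i0 = 0\<close>.\<close>

theorem pencil_deforms:
  fixes A B :: "'m::finite \<Rightarrow> 'n::finite \<Rightarrow> 'n \<Rightarrow> complex" and p :: "complex^'n" and c d :: "complex^'m"
  assumes skewA: "\<And>l i j. A l j i = - A l i j" and skewB: "\<And>l i j. B l j i = - B l i j"
    and p: "p $ i0 \<noteq> 0"
    and c: "\<And>j. (\<Sum>l\<in>UNIV. \<Sum>i\<in>UNIV. c $ l * A l j i * p $ i) = 0"
    and d: "\<And>j. (\<Sum>l\<in>UNIV. \<Sum>i\<in>UNIV. d $ l * A l j i * p $ i) = 0"
    and inj: "transversal_pencil A p i0 c d"
    and \<epsilon>: "\<epsilon> > 0"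
  shows "\<exists>\<delta>>0. \<forall>t. 0 < t \<and> t < \<delta> \<longrightarrow> (\<exists>x c' d'. dist x p < \<epsilon> \<and> dist c' c < \<epsilon> \<and> dist d' d < \<epsilon> \<and>
    (\<forall>j. (\<Sum>l\<in>UNIV. \<Sum>i\<in>UNIV. c' $ l * (A l j i + of_real t * B l j i) * x $ i) = 0) \<and>
    (\<forall>j. (\<Sum>l\<in>UNIV. \<Sum>i\<in>UNIV. d' $ l * (A l j i + of_real t * B l j i) * x $ i) = 0))"
proof -
  define e where "e = (\<lambda>j. if j = i0 then 1 else 0 :: complex)"
  define T where "T = (fst :: real \<times> (complex^'n) \<times> (complex^'m) \<times> complex \<times> (complex^'m) \<times> complex \<Rightarrow> real)"
  define X where "X = (\<lambda>z :: real \<times> (complex^'n) \<times> (complex^'m) \<times> complex \<times> (complex^'m) \<times> complex. fst (snd z))"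
  define C where "C = (\<lambda>z :: real \<times> (complex^'n) \<times> (complex^'m) \<times> complex \<times> (complex^'m) \<times> complex. fst (snd (snd z)))"
  define S where "S = (\<lambda>z :: real \<times> (complex^'n) \<times> (complex^'m) \<times> complex \<times> (complex^'m) \<times> complex. fst (snd (snd (snd z))))"
  define D where "D = (\<lambda>z :: real \<times> (complex^'n) \<times> (complex^'m) \<times> complex \<times> (complex^'m) \<times> complex. fst (snd (snd (snd (snd z)))))"
  define R where "R = (\<lambda>z :: real \<times> (complex^'n) \<times> (complex^'m) \<times> complex \<times> (complex^'m) \<times> complex. snd (snd (snd (snd (snd z)))))"
  have bl: "bounded_linear T" "bounded_linear X" "bounded_linear C" "bounded_linear S" "bounded_linear D" "bounded_linear R"
    unfolding T_def X_def C_def S_def D_def R_def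
    by (intro bounded_linear_fst bounded_linear_snd bounded_linear_fst_comp bounded_linear_snd_comp)+
  define z0 where "z0 = (0 :: real, p, c, 0 :: complex, d, 0 :: complex)"
  have z0: "T z0 = 0" "X z0 = p" "C z0 = c" "S z0 = 0" "D z0 = d" "R z0 = 0"
    by (simp_all add: z0_def T_def X_def C_def S_def D_def R_def)
  define \<Phi>1 where "\<Phi>1 C S z = (\<chi> j. (\<Sum>l\<in>UNIV. \<Sum>i\<in>UNIV. C z $ l * (A l j i + of_real (T z) * B l j i) * X z $ i) + S z * e j)"
    for C :: "_ \<Rightarrow> complex^'m" and S and z
  define \<Phi>' where "\<Phi>' C S h = (\<chi> j. (\<Sum>l\<in>UNIV. \<Sum>i\<in>UNIV. C h $ l * A l j i * X z0 $ i +
        C z0 $ l * of_real (T h) * B l j i * X z0 $ i + C z0 $ l * A l j i * X h $ i) + S h * e j)"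
    for C :: "_ \<Rightarrow> complex^'m" and S and h
  \<comment> \<open>The parameter \<open>t\<close> is both an unknown and a component of the map, so that it can be prescribed.\<close>
  define \<Phi> where "\<Phi> z = (T z, \<Phi>1 C S z, \<Phi>1 D R z)" for z
  define L where "L h = (T h, \<Phi>' C S h, \<Phi>' D R h)" for h
  have der: "(\<Phi> has_derivative L) (at z0)"
    unfolding \<Phi>_def L_def \<Phi>1_def \<Phi>'_def
    by (intro has_derivative_Pair pencil_map_derivative bl z0(1) bounded_linear_imp_has_derivative)
  have "surj L"
    unfolding surj_def
  proof
    fix tgt :: "real \<times> (complex^'n) \<times> (complex^'n)"
    obtain t f g where tgt: "tgt = (t, f, g)" by (cases tgt) auto
    define b where "b c' = (\<chi> j. \<Sum>l\<in>UNIV. \<Sum>i\<in>UNIV. c' $ l * of_real t * B l j i * p $ i)" for c' :: "complex^'m"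
    obtain x' c' \<sigma> d' \<tau> where sol:
      "(\<chi> j. (\<Sum>l\<in>UNIV. \<Sum>i\<in>UNIV. c' $ l * A l j i * p $ i + c $ l * A l j i * x' $ i) + \<sigma> * (if j = i0 then 1 else 0)) = f - b c"
      "(\<chi> j. (\<Sum>l\<in>UNIV. \<Sum>i\<in>UNIV. d' $ l * A l j i * p $ i + d $ l * A l j i * x' $ i) + \<tau> * (if j = i0 then 1 else 0)) = g - b d"
      using pencil_linearization_surj[OF inj, where f = "f - b c" and g = "g - b d"] by (elim exE conjE) rule
    define h where "h = (t, x', c', \<sigma>, d', \<tau>)"
    have h: "T h = t" "X h = x'" "C h = c'" "S h = \<sigma>" "D h = d'" "R h = \<tau>"
      by (simp_all add: h_def T_def X_def C_def S_def D_def R_def)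
    have "\<Phi>' C S h = (f - b c) + b c" "\<Phi>' D R h = (g - b d) + b d"
      unfolding sol[symmetric] by (simp_all add: \<Phi>'_def h z0 b_def vec_eq_iff e_def sum.distrib)
    then show "\<exists>h. tgt = L h" by (intro exI[of _ h]) (simp add: L_def tgt h)
  qed
  moreover have linL: "linear L" using der has_derivative_linear by blast
  ultimately have "\<exists>g. range g \<subseteq> span UNIV \<and> linear g \<and> (\<forall>x\<in>span UNIV. L (g x) = x)"
    by (intro linear_surj_right_inverse) auto
  then obtain g where "linear g" "\<forall>x. L (g x) = x" by auto
  then have g: "linear g" "L \<circ> g = id" by auto
  define r where "r = min \<epsilon> (norm (p $ i0))"
  have r: "r > 0" using \<epsilon> p by (simp add: r_def)
  have cont: "continuous_on UNIV \<Phi>"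
    unfolding \<Phi>_def \<Phi>1_def
    by (intro continuous_on_Pair continuous_on_vec_lambda continuous_on_add continuous_on_sum continuous_on_mult
        continuous_on_const continuous_on_of_real continuous_on_component
        linear_continuous_on bl)
  have "\<Phi> z0 \<in> interior (\<Phi> ` ball z0 r)"
    by (rule sussmann_open_mapping[OF open_UNIV cont UNIV_I der _ g(2)])
      (use g(1) r in \<open>auto simp: linear_conv_bounded_linear interior_open\<close>)
  then obtain \<delta> where \<delta>: "\<delta> > 0" "ball (\<Phi> z0) \<delta> \<subseteq> \<Phi> ` ball z0 r"
    by (auto simp: mem_interior)
  have \<Phi>0: "\<Phi> z0 = (0, 0, 0)"
    using c d by (simp add: \<Phi>_def \<Phi>1_def z0 vec_eq_iff)
  show ?thesis
  proof (intro exI[of _ \<delta>] conjI allI impI \<delta>(1))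
    fix t :: real assume t: "0 < t \<and> t < \<delta>"
    have "(t, 0, 0) \<in> ball (\<Phi> z0) \<delta>"
      using t by (simp add: \<Phi>0 dist_Pair_Pair)
    with \<delta>(2) have "(t, 0, 0) \<in> \<Phi> ` ball z0 r" by (rule subsetD)
    then obtain z where z: "(t, 0, 0) = \<Phi> z" "z \<in> ball z0 r" by (rule imageE)
    have Tz: "T z = t" using z(1) by (simp add: \<Phi>_def)
    have dist: "dist (X z) p < r" "dist (C z) c < r" "dist (D z) d < r"
    proof -
      have zz: "dist z z0 < r" using z(2) by (simp add: dist_commute)
      have "dist (X z) (X z0) \<le> dist z z0" "dist (C z) (C z0) \<le> dist z z0" "dist (D z) (D z0) \<le> dist z z0"
        unfolding X_def C_def D_def
        by (rule dist_fst_le[THEN order_trans] dist_snd_le[THEN order_trans] dist_snd_le order_refl)+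
      then show "dist (X z) p < r" "dist (C z) c < r" "dist (D z) d < r" using zz by (simp_all add: z0)
    qed
    have Xi: "X z $ i0 \<noteq> 0"
    proof
      assume "X z $ i0 = 0"
      then have "norm (p $ i0) \<le> dist (X z) p"
        using Finite_Cartesian_Product.norm_nth_le[of "X z - p" i0] by (simp add: dist_norm)
      then show False using dist(1) by (simp add: r_def)
    qed
    have key: "(\<Sum>l\<in>UNIV. \<Sum>i\<in>UNIV. K $ l * (A l j i + of_real t * B l j i) * X z $ i) = 0"
      if K: "\<And>j. (\<Sum>l\<in>UNIV. \<Sum>i\<in>UNIV. K $ l * (A l j i + of_real t * B l j i) * X z $ i) + s * e j = 0"
      for K :: "complex^'m" and s j
    proof -
      define Q where "Q = (\<Sum>j\<in>UNIV. X z $ j * (\<Sum>l\<in>UNIV. \<Sum>i\<in>UNIV. K $ l * (A l j i + of_real t * B l j i) * X z $ i))"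
      define M where "M j i = (\<Sum>l\<in>UNIV. K $ l * (A l j i + of_real t * B l j i))" for j i
      have M: "M j i = - M i j" for i j
      proof -
        have "M j i = (\<Sum>l\<in>UNIV. - (K $ l * (A l i j + of_real t * B l i j)))"
          unfolding M_def
        proof (rule sum.cong[OF refl])
          fix l
          have "K $ l * (A l j i + of_real t * B l j i) = K $ l * (- A l i j + of_real t * - B l i j)"
            by (simp only: skewA[of l j i] skewB[of l j i])
          also have "\<dots> = - (K $ l * (A l i j + of_real t * B l i j))"
            by algebra
          finally show "K $ l * (A l j i + of_real t * B l j i) = - (K $ l * (A l i j + of_real t * B l i j))" .
        qed
        then show ?thesis by (simp only: sum_negf M_def)
      qed
      have Q: "Q = (\<Sum>j\<in>UNIV. \<Sum>i\<in>UNIV. X z $ j * M j i * X z $ i)"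
      proof -
        have "(\<Sum>l\<in>UNIV. \<Sum>i\<in>UNIV. K $ l * (A l j i + of_real t * B l j i) * X z $ i) = (\<Sum>i\<in>UNIV. M j i * X z $ i)" for j
          unfolding M_def sum_distrib_right by (rule sum.swap)
        then show ?thesis by (simp only: Q_def sum_distrib_left mult.assoc)
      qed
      also have "\<dots> = (\<Sum>i\<in>UNIV. \<Sum>j\<in>UNIV. X z $ j * M j i * X z $ i)" by (rule sum.swap)
      also have "\<dots> = (\<Sum>i\<in>UNIV. \<Sum>j\<in>UNIV. - (X z $ i * M i j * X z $ j))"
        by (rule sum.cong[OF refl], rule sum.cong[OF refl], subst M) (simp only: mult_minus_left mult_minus_right mult_ac)
      also have "\<dots> = - Q" by (simp only: sum_negf Q)
      finally have "Q = 0" by simp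
      moreover have "Q = (\<Sum>j\<in>UNIV. X z $ j * (- (s * e j)))"
      proof -
        have "(\<Sum>l\<in>UNIV. \<Sum>i\<in>UNIV. K $ l * (A l j i + of_real t * B l j i) * X z $ i) = - (s * e j)" for j
          using K[of j] by (simp only: eq_neg_iff_add_eq_0)
        then show ?thesis by (simp only: Q_def)
      qed
      moreover have "\<dots> = - (s * X z $ i0)"
        by (simp add: e_def if_distrib sum_negf cong: if_cong)
      ultimately have "s = 0" using Xi by simp
      then show ?thesis using K[of j] by simp
    qed
    have 1: "(\<Sum>l\<in>UNIV. \<Sum>i\<in>UNIV. C z $ l * (A l j i + of_real t * B l j i) * X z $ i) + S z * e j = 0"
      and 2: "(\<Sum>l\<in>UNIV. \<Sum>i\<in>UNIV. D z $ l * (A l j i + of_real t * B l j i) * X z $ i) + R z * e j = 0" for j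
      using z(1) by (simp_all add: \<Phi>_def \<Phi>1_def vec_eq_iff Tz)
    show "\<exists>x c' d'. dist x p < \<epsilon> \<and> dist c' c < \<epsilon> \<and> dist d' d < \<epsilon> \<and>
      (\<forall>j. (\<Sum>l\<in>UNIV. \<Sum>i\<in>UNIV. c' $ l * (A l j i + of_real t * B l j i) * x $ i) = 0) \<and>
      (\<forall>j. (\<Sum>l\<in>UNIV. \<Sum>i\<in>UNIV. d' $ l * (A l j i + of_real t * B l j i) * x $ i) = 0)"
      using dist key[OF 1] key[OF 2] by (intro exI[of _ "X z"] exI[of _ "C z"] exI[of _ "D z"]) (simp add: r_def)
  qed
qed

text \<open>As a rewrite rule this is associativity of the ring, oriented against \<open>mult_ac\<close>.\<close>

declare ideal.scale_scale [simp del]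

section \<open>Coordinates in dimensions five and six\<close>

lemma UNIV_6: "(UNIV :: 6 set) = {0, 1, 2, 3, 4, 5}"
proof (rule card_subset_eq[symmetric])
  show "card {0, 1, 2, 3, 4, 5 :: 6} = card (UNIV :: 6 set)" by simp
qed auto

lemma UNIV_5: "(UNIV :: 5 set) = {0, 1, 2, 3, 4}"
proof (rule card_subset_eq[symmetric])
  show "card {0, 1, 2, 3, 4 :: 5} = card (UNIV :: 5 set)" by simp
qed auto

lemma sum6: "(\<Sum>i\<in>(UNIV::6 set). f i) = f 0 + f 1 + f 2 + f 3 + f 4 + (f 5 :: 'a::comm_monoid_add)"
  unfolding UNIV_6 by (simp add: add_ac)

lemma sum5: "(\<Sum>i\<in>(UNIV::5 set). f i) = f 0 + f 1 + f 2 + f 3 + (f 4 :: 'a::comm_monoid_add)"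
  unfolding UNIV_5 by (simp add: add_ac)

lemma all6: "(\<forall>i::6. P i) \<longleftrightarrow> P 0 \<and> P 1 \<and> P 2 \<and> P 3 \<and> P 4 \<and> P 5"
  by (metis UNIV_6 UNIV_I insertE singletonD)

lemma all5: "(\<forall>i::5. P i) \<longleftrightarrow> P 0 \<and> P 1 \<and> P 2 \<and> P 3 \<and> P 4"
  by (metis UNIV_5 UNIV_I insertE singletonD)

definition v6 :: "'a \<Rightarrow> 'a \<Rightarrow> 'a \<Rightarrow> 'a \<Rightarrow> 'a \<Rightarrow> 'a \<Rightarrow> 6 \<Rightarrow> 'a" where
  "v6 a b c d e f i = (if i = 0 then a else if i = 1 then b else if i = 2 then c else if i = 3 then d else if i = 4 then e else f)"

definition v5 :: "'a \<Rightarrow> 'a \<Rightarrow> 'a \<Rightarrow> 'a \<Rightarrow> 'a \<Rightarrow> 5 \<Rightarrow> 'a" where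
  "v5 a b c d e i = (if i = 0 then a else if i = 1 then b else if i = 2 then c else if i = 3 then d else e)"

lemma v6_simps [simp]: "v6 a b c d e f 0 = a" "v6 a b c d e f 1 = b" "v6 a b c d e f 2 = c"
    "v6 a b c d e f 3 = d" "v6 a b c d e f 4 = e" "v6 a b c d e f 5 = f"
  by (simp_all add: v6_def)

lemma v5_simps [simp]: "v5 a b c d e 0 = a" "v5 a b c d e 1 = b" "v5 a b c d e 2 = c"
    "v5 a b c d e 3 = d" "v5 a b c d e 4 = e"
  by (simp_all add: v5_def)

section \<open>Five decomposable forms\<close>

text \<open>Five decomposable forms \<open>\<alpha>\<^sub>l \<and> \<beta>\<^sub>l\<close> with \<open>\<alpha>\<^sub>l\<close> in the first three and \<open>\<beta>\<^sub>l\<close> in the last three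
  coordinates. Four members of each family are normalised to the coordinate functions and their
  sum. The fifth ones are chosen so that any three members of a family are independent and the two
  families are not projectively equivalent.\<close>

definition first_factor :: "5 \<Rightarrow> 6 \<Rightarrow> complex" where
  "first_factor = v5 (v6 1 0 0 0 0 0) (v6 0 1 0 0 0 0) (v6 0 0 1 0 0 0) (v6 1 1 1 0 0 0) (v6 1 (-1) 2 0 0 0)"

definition second_factor :: "5 \<Rightarrow> 6 \<Rightarrow> complex" where
  "second_factor = v5 (v6 0 0 0 1 0 0) (v6 0 0 0 0 1 0) (v6 0 0 0 0 0 1) (v6 0 0 0 1 1 1) (v6 0 0 0 1 2 (-1))"

definition base_form :: "5 \<Rightarrow> 6 \<Rightarrow> 6 \<Rightarrow> complex" where
  "base_form l j i = first_factor l i * second_factor l j - second_factor l i * first_factor l j"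

definition first_value :: "(6 \<Rightarrow> complex) \<Rightarrow> 5 \<Rightarrow> complex" where
  "first_value x = v5 (x 0) (x 1) (x 2) (x 0 + x 1 + x 2) (x 0 - x 1 + 2 * x 2)"

definition second_value :: "(6 \<Rightarrow> complex) \<Rightarrow> 5 \<Rightarrow> complex" where
  "second_value x = v5 (x 3) (x 4) (x 5) (x 3 + x 4 + x 5) (x 3 + 2 * x 4 - x 5)"

lemma factor_values: "(\<Sum>i\<in>UNIV. first_factor l i * x i) = first_value x l"
    "(\<Sum>i\<in>UNIV. second_factor l i * x i) = second_value x l"
proof -
  have "\<forall>l. (\<Sum>i\<in>UNIV. first_factor l i * x i) = first_value x l \<and> (\<Sum>i\<in>UNIV. second_factor l i * x i) = second_value x l"
    unfolding all5 sum6 by (simp add: first_factor_def second_factor_def first_value_def second_value_def)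
  then show "(\<Sum>i\<in>UNIV. first_factor l i * x i) = first_value x l"
    "(\<Sum>i\<in>UNIV. second_factor l i * x i) = second_value x l" by auto
qed

lemma base_form_apply:
  "(\<Sum>i\<in>UNIV. base_form l j i * x i) = first_value x l * second_factor l j - second_value x l * first_factor l j"
proof -
  have "(\<Sum>i\<in>UNIV. base_form l j i * x i) =
      (\<Sum>i\<in>UNIV. first_factor l i * x i * second_factor l j - second_factor l i * x i * first_factor l j)"
    by (rule sum.cong[OF refl]) (simp add: base_form_def algebra_simps)
  then show ?thesis by (simp only: sum_subtractf factor_values flip: sum_distrib_right)
qed

lemma base_form_skew: "base_form l j i = - base_form l i j"
  by (simp add: base_form_def mult.commute)

text \<open>\<open>transversal_pencil\<close> for the decomposable forms, together with the condition that \<open>c\<close> and \<open>d\<close> span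
  a pencil of forms vanishing at \<open>x\<close>. Each vector equation is split into its two groups of
  coordinates, in which only the \<open>first_factor\<close>s respectively the \<open>second_factor\<close>s occur.\<close>

definition transversal_at :: "(6 \<Rightarrow> complex) \<Rightarrow> 6 \<Rightarrow> (5 \<Rightarrow> complex) \<Rightarrow> (5 \<Rightarrow> complex) \<Rightarrow> bool" where
  "transversal_at x i0 c d \<longleftrightarrow> x i0 \<noteq> 0 \<and> (\<exists>l m. c l * d m \<noteq> c m * d l) \<and>
    (\<forall>j. (\<Sum>l\<in>UNIV. c l * (first_value x l * second_factor l j)) = 0) \<and>
    (\<forall>j. (\<Sum>l\<in>UNIV. c l * (second_value x l * first_factor l j)) = 0) \<and>
    (\<forall>j. (\<Sum>l\<in>UNIV. d l * (first_value x l * second_factor l j)) = 0) \<and>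
    (\<forall>j. (\<Sum>l\<in>UNIV. d l * (second_value x l * first_factor l j)) = 0) \<and>
    (\<forall>y z. y i0 = 0 \<longrightarrow> z i0 = 0 \<longrightarrow>
      (\<forall>l. first_value x l * second_value y l = second_value x l * first_value y l) \<longrightarrow>
      (\<forall>l. first_value x l * second_value z l = second_value x l * first_value z l) \<longrightarrow>
      (\<forall>i. (\<Sum>l\<in>UNIV. (c l * second_value y l + d l * second_value z l) * first_factor l i) = 0) \<longrightarrow>
      (\<forall>i. (\<Sum>l\<in>UNIV. (c l * first_value y l + d l * first_value z l) * second_factor l i) = 0) \<longrightarrow>
      (\<forall>i. y i = 0 \<and> z i = 0))"

lemmas transversal_atD =
  transversal_at_def[THEN iffD1, THEN conjunct1]
    transversal_at_def[THEN iffD1, THEN conjunct2, THEN conjunct1]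
    transversal_at_def[THEN iffD1, THEN conjunct2, THEN conjunct2, THEN conjunct1]
    transversal_at_def[THEN iffD1, THEN conjunct2, THEN conjunct2, THEN conjunct2, THEN conjunct1]
    transversal_at_def[THEN iffD1, THEN conjunct2, THEN conjunct2, THEN conjunct2, THEN conjunct2, THEN conjunct1]
    transversal_at_def[THEN iffD1, THEN conjunct2, THEN conjunct2, THEN conjunct2, THEN conjunct2, THEN conjunct2, THEN conjunct1]
    transversal_at_def[THEN iffD1, THEN conjunct2, THEN conjunct2, THEN conjunct2, THEN conjunct2, THEN conjunct2, THEN conjunct2]

definition smooth_point :: "(6 \<Rightarrow> complex) \<Rightarrow> bool" where
  "smooth_point x \<longleftrightarrow> (\<exists>i0 c d. transversal_at x i0 c d)"

lemma first_factor_0: "i \<in> {3, 4, 5} \<Longrightarrow> first_factor l i = 0"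
  and second_factor_0: "i \<in> {0, 1, 2} \<Longrightarrow> second_factor l i = 0"
proof -
  have "\<forall>l. first_factor l 3 = 0 \<and> first_factor l 4 = 0 \<and> first_factor l 5 = 0 \<and>
    second_factor l 0 = 0 \<and> second_factor l 1 = 0 \<and> second_factor l 2 = 0"
    unfolding all5 by (simp add: first_factor_def second_factor_def)
  then show "i \<in> {3, 4, 5} \<Longrightarrow> first_factor l i = 0" "i \<in> {0, 1, 2} \<Longrightarrow> second_factor l i = 0" by auto
qed

lemma factor_split:
  assumes "(\<Sum>l\<in>UNIV. f l * first_factor l i) = (\<Sum>l\<in>UNIV. g l * second_factor l i)"
  shows "(\<Sum>l\<in>UNIV. f l * first_factor l i) = 0 \<and> (\<Sum>l\<in>UNIV. g l * second_factor l i) = 0"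
proof (cases "i \<in> {3, 4, 5}")
  case True
  then have "(\<Sum>l\<in>UNIV. f l * first_factor l i) = 0" by (simp add: first_factor_0)
  then show ?thesis using assms by simp
next
  case False
  then have "i \<in> {0, 1, 2}" using UNIV_6 by (metis UNIV_I insert_iff)
  then have "(\<Sum>l\<in>UNIV. g l * second_factor l i) = 0" by (simp add: second_factor_0)
  then show ?thesis using assms by simp
qed

lemma smooth_point_pencil:
  assumes "smooth_point x"
  obtains i0 c d where "x i0 \<noteq> 0" "\<exists>l m. c $ l * d $ m \<noteq> c $ m * d $ l"
    "\<And>j. (\<Sum>l\<in>UNIV. \<Sum>i\<in>UNIV. c $ l * base_form l j i * (\<chi> i. x i) $ i) = 0"
    "\<And>j. (\<Sum>l\<in>UNIV. \<Sum>i\<in>UNIV. d $ l * base_form l j i * (\<chi> i. x i) $ i) = 0"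
    "transversal_pencil base_form (\<chi> i. x i) i0 c d"
proof -
  obtain i0 c d where T: "transversal_at x i0 c d"
    using assms unfolding smooth_point_def by blast
  note * = transversal_atD[OF T]
  have kernel: "(\<Sum>l\<in>UNIV. \<Sum>i\<in>UNIV. (\<chi> l. k l) $ l * base_form l j i * (\<chi> i. x i) $ i) = 0"
    if "\<forall>j. (\<Sum>l\<in>UNIV. k l * (first_value x l * second_factor l j)) = 0"
      "\<forall>j. (\<Sum>l\<in>UNIV. k l * (second_value x l * first_factor l j)) = 0" for k j
  proof -
    have "(\<Sum>l\<in>UNIV. \<Sum>i\<in>UNIV. (\<chi> l. k l) $ l * base_form l j i * (\<chi> i. x i) $ i) =
        (\<Sum>l\<in>UNIV. k l * (\<Sum>i\<in>UNIV. base_form l j i * x i))"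
      by (simp only: vec_lambda_beta sum_distrib_left mult.assoc)
    also have "\<dots> = 0"
      using that by (simp only: base_form_apply right_diff_distrib sum_subtractf) simp
    finally show ?thesis .
  qed
  have trans: "transversal_pencil base_form (\<chi> i. x i) i0 (\<chi> l. c l) (\<chi> l. d l)"
    unfolding transversal_pencil_def
  proof (intro allI impI, elim conjE)
    fix y z :: "complex^6"
    assume y0: "y $ i0 = 0" and z0: "z $ i0 = 0"
      and yl: "\<forall>l. (\<Sum>j\<in>UNIV. \<Sum>i\<in>UNIV. y $ j * base_form l j i * (\<chi> i. x i) $ i) = 0"
      and zl: "\<forall>l. (\<Sum>j\<in>UNIV. \<Sum>i\<in>UNIV. z $ j * base_form l j i * (\<chi> i. x i) $ i) = 0"
      and yz: "\<forall>i. (\<Sum>j\<in>UNIV. \<Sum>l\<in>UNIV. y $ j * (\<chi> l. c l) $ l * base_form l j i + z $ j * (\<chi> l. d l) $ l * base_form l j i) = 0"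
    have pair: "first_value x l * second_value (($) u) l = second_value x l * first_value (($) u) l"
      if "(\<Sum>j\<in>UNIV. \<Sum>i\<in>UNIV. u $ j * base_form l j i * (\<chi> i. x i) $ i) = 0" for u :: "complex^6" and l
    proof -
      have "0 = (\<Sum>j\<in>UNIV. u $ j * (\<Sum>i\<in>UNIV. base_form l j i * x i))"
        using that by (simp only: vec_lambda_beta sum_distrib_left mult.assoc)
      also have "\<dots> = (\<Sum>j\<in>UNIV. first_value x l * (second_factor l j * u $ j) - second_value x l * (first_factor l j * u $ j))"
        by (rule sum.cong[OF refl], simp only: base_form_apply) algebra
      also have "\<dots> = first_value x l * second_value (($) u) l - second_value x l * first_value (($) u) l"
        by (simp only: sum_subtractf factor_values flip: sum_distrib_left)
      finally show ?thesis by simp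
    qed
    have third: "(\<Sum>l\<in>UNIV. (c l * second_value (($) y) l + d l * second_value (($) z) l) * first_factor l i) = 0 \<and>
        (\<Sum>l\<in>UNIV. (c l * first_value (($) y) l + d l * first_value (($) z) l) * second_factor l i) = 0" for i
    proof (rule factor_split)
      have s: "(\<Sum>j\<in>UNIV. u $ j * base_form l j i) = second_value (($) u) l * first_factor l i - first_value (($) u) l * second_factor l i"
        for u :: "complex^6" and l
      proof -
        have "(\<Sum>j\<in>UNIV. u $ j * base_form l j i) =
            (\<Sum>j\<in>UNIV. second_factor l j * u $ j * first_factor l i - first_factor l j * u $ j * second_factor l i)"
          by (rule sum.cong[OF refl]) (simp add: base_form_def algebra_simps)
        then show ?thesis by (simp only: sum_subtractf factor_values flip: sum_distrib_right)
      qed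
      have "0 = (\<Sum>l\<in>UNIV. c l * (\<Sum>j\<in>UNIV. y $ j * base_form l j i) + d l * (\<Sum>j\<in>UNIV. z $ j * base_form l j i))"
      proof -
        have "0 = (\<Sum>j\<in>UNIV. \<Sum>l\<in>UNIV. y $ j * c l * base_form l j i + z $ j * d l * base_form l j i)"
          using yz by simp
        also have "\<dots> = (\<Sum>l\<in>UNIV. \<Sum>j\<in>UNIV. y $ j * c l * base_form l j i + z $ j * d l * base_form l j i)"
          by (rule sum.swap)
        also have "\<dots> = (\<Sum>l\<in>UNIV. c l * (\<Sum>j\<in>UNIV. y $ j * base_form l j i) + d l * (\<Sum>j\<in>UNIV. z $ j * base_form l j i))"
          by (simp only: sum.distrib sum_distrib_left) (simp only: mult_ac)
        finally show ?thesis .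
      qed
      also have "\<dots> = (\<Sum>l\<in>UNIV. (c l * second_value (($) y) l + d l * second_value (($) z) l) * first_factor l i -
          (c l * first_value (($) y) l + d l * first_value (($) z) l) * second_factor l i)"
        unfolding s by (rule sum.cong[OF refl]) (simp add: algebra_simps)
      finally show "(\<Sum>l\<in>UNIV. (c l * second_value (($) y) l + d l * second_value (($) z) l) * first_factor l i) =
        (\<Sum>l\<in>UNIV. (c l * first_value (($) y) l + d l * first_value (($) z) l) * second_factor l i)"
        by (simp add: sum_subtractf)
    qed
    have "\<forall>i. y $ i = 0 \<and> z $ i = 0"
      using *(7) y0 z0 pair yl zl third by blast
    then show "y = 0 \<and> z = 0" by (simp add: vec_eq_iff)
  qed
  show thesis
  proof (rule that[of i0 "\<chi> l. c l" "\<chi> l. d l"])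
    show "x i0 \<noteq> 0" by (rule *(1))
    show "\<exists>l m. (\<chi> l. c l) $ l * (\<chi> l. d l) $ m \<noteq> (\<chi> l. c l) $ m * (\<chi> l. d l) $ l"
      using *(2) by (simp only: vec_lambda_beta)
  qed (rule kernel[OF *(3,4)] kernel[OF *(5,6)] trans)+
qed

section \<open>Smooth points on fifteen lines\<close>

definition scale_second :: "complex \<Rightarrow> (6 \<Rightarrow> complex) \<Rightarrow> 6 \<Rightarrow> complex" where
  "scale_second s x = v6 (x 0) (x 1) (x 2) (s * x 3) (s * x 4) (s * x 5)"

lemma first_value_scale_second: "first_value (scale_second s x) = first_value x"
  by (simp add: first_value_def scale_second_def)

lemma second_value_scale_second: "second_value (scale_second s x) l = s * second_value x l"
proof -
  have "\<forall>l. second_value (scale_second s x) l = s * second_value x l"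
    unfolding all5 by (simp add: second_value_def scale_second_def algebra_simps)
  then show ?thesis ..
qed

text \<open>Scaling the last three coordinates by \<open>s\<close> multiplies all five forms by \<open>s\<close>, so it preserves
  everything. Hence a smooth point comes with the line that joins its two components.\<close>

lemma smooth_point_scale_second:
  assumes "smooth_point x" "s \<noteq> 0"
  shows "smooth_point (scale_second s x)"
proof -
  obtain i0 c d where T: "transversal_at x i0 c d"
    using assms unfolding smooth_point_def by blast
  note * = transversal_atD[OF T]
  note inj = *(7)
  have scaled: "(\<Sum>l\<in>UNIV. k l * (s * g l * f l)) = s * (\<Sum>l\<in>UNIV. k l * (g l * f l))" for k g f :: "5 \<Rightarrow> complex"
    by (simp only: sum_distrib_left) (simp only: mult_ac)
  have x0: "\<forall>i. x i \<noteq> 0 \<longrightarrow> scale_second s x i \<noteq> 0"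
    unfolding all6 using assms(2) by (simp add: scale_second_def)
  have scale0: "\<forall>i. \<forall>y. y i = 0 \<longrightarrow> v6 (s * y 0) (s * y 1) (s * y 2) (y 3) (y 4) (y 5) i = 0"
    unfolding all6 by simp
  have "transversal_at (scale_second s x) i0 c d"
    unfolding transversal_at_def
  proof (intro conjI)
    show "scale_second s x i0 \<noteq> 0" using *(1) x0 by blast
    show "\<exists>l m. c l * d m \<noteq> c m * d l" by (rule *(2))
    show "\<forall>j. (\<Sum>l\<in>UNIV. c l * (first_value (scale_second s x) l * second_factor l j)) = 0"
      "\<forall>j. (\<Sum>l\<in>UNIV. d l * (first_value (scale_second s x) l * second_factor l j)) = 0"
      using *(3,5) unfolding first_value_scale_second by blast+
    show "\<forall>j. (\<Sum>l\<in>UNIV. c l * (second_value (scale_second s x) l * first_factor l j)) = 0"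
      "\<forall>j. (\<Sum>l\<in>UNIV. d l * (second_value (scale_second s x) l * first_factor l j)) = 0"
      using *(4,6) by (simp_all only: second_value_scale_second scaled mult_zero_right simp_thms)
  next
    show "\<forall>y z. y i0 = 0 \<longrightarrow> z i0 = 0 \<longrightarrow>
      (\<forall>l. first_value (scale_second s x) l * second_value y l = second_value (scale_second s x) l * first_value y l) \<longrightarrow>
      (\<forall>l. first_value (scale_second s x) l * second_value z l = second_value (scale_second s x) l * first_value z l) \<longrightarrow>
      (\<forall>i. (\<Sum>l\<in>UNIV. (c l * second_value y l + d l * second_value z l) * first_factor l i) = 0) \<longrightarrow>
      (\<forall>i. (\<Sum>l\<in>UNIV. (c l * first_value y l + d l * first_value z l) * second_factor l i) = 0) \<longrightarrow>
      (\<forall>i. y i = 0 \<and> z i = 0)"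
      unfolding first_value_scale_second second_value_scale_second
    proof (intro allI impI)
    fix y z :: "6 \<Rightarrow> complex" and i
    let ?y = "v6 (s * y 0) (s * y 1) (s * y 2) (y 3) (y 4) (y 5)"
    let ?z = "v6 (s * z 0) (s * z 1) (s * z 2) (z 3) (z 4) (z 5)"
    assume h: "y i0 = 0" "z i0 = 0"
      "\<forall>l. first_value x l * second_value y l = s * second_value x l * first_value y l"
      "\<forall>l. first_value x l * second_value z l = s * second_value x l * first_value z l"
      "\<forall>i. (\<Sum>l\<in>UNIV. (c l * second_value y l + d l * second_value z l) * first_factor l i) = 0"
      "\<forall>i. (\<Sum>l\<in>UNIV. (c l * first_value y l + d l * first_value z l) * second_factor l i) = 0"
    have f: "\<forall>l. first_value (v6 (s * u 0) (s * u 1) (s * u 2) (u 3) (u 4) (u 5)) l = s * first_value u l"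
      and g: "second_value (v6 (s * u 0) (s * u 1) (s * u 2) (u 3) (u 4) (u 5)) = second_value u" for u
      unfolding all5 by (simp_all add: first_value_def second_value_def algebra_simps)
    have "(c l * first_value ?y l + d l * first_value ?z l) * e = s * ((c l * first_value y l + d l * first_value z l) * e)" for l e
      by (simp add: f algebra_simps)
    then have 6: "\<forall>i. (\<Sum>l\<in>UNIV. (c l * first_value ?y l + d l * first_value ?z l) * second_factor l i) = 0"
      using h(6) by (simp only: flip: sum_distrib_left) simp
    have 1: "?y i0 = 0" "?z i0 = 0" using h(1,2) scale0 by blast+
    have 3: "\<forall>l. first_value x l * second_value ?y l = second_value x l * first_value ?y l"
      "\<forall>l. first_value x l * second_value ?z l = second_value x l * first_value ?z l"
      using h(3,4) by (simp_all add: f g mult_ac)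
    have 5: "\<forall>i. (\<Sum>l\<in>UNIV. (c l * second_value ?y l + d l * second_value ?z l) * first_factor l i) = 0"
      using h(5) by (simp add: g)
    have "\<forall>i. ?y i = 0 \<and> ?z i = 0"
      by (rule inj[THEN spec, THEN spec, THEN mp, THEN mp, THEN mp, THEN mp, THEN mp, THEN mp, OF 1 3 5 6])
    then have "\<forall>i. y i = 0 \<and> z i = 0"
      unfolding all6 using assms(2) by simp
    then show "y i = 0 \<and> z i = 0" ..
    qed
  qed
  then show ?thesis unfolding smooth_point_def by blast
qed

text \<open>All conditions written as scalar equations, which are decided by \<open>algebra\<close> for explicit numbers.
  The \<open>k\<close>'s are the coordinates of the unit vector \<open>i0\<close>.\<close>

lemma smooth_pointI:
  assumes k: "\<forall>i. v6 k0 k1 k2 k3 k4 k5 i = (if i = i0 then 1 else (0 :: complex))"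
    and x: "k0 * x0 + k1 * x1 + k2 * x2 + k3 * x3 + k4 * x4 + k5 * x5 \<noteq> 0"
    and indep: "v5 c0 c1 c2 c3 c4 l * v5 d0 d1 d2 d3 d4 m \<noteq> v5 c0 c1 c2 c3 c4 m * v5 d0 d1 d2 d3 d4 l"
    and kernel: "\<forall>(e0, e1, e2, e3, e4)\<in>{(c0, c1, c2, c3, c4), (d0, d1, d2, d3, d4)}.
       e0 * x0 + e3 * (x0 + x1 + x2) + e4 * (x0 - x1 + 2 * x2) = 0 \<and>
       e1 * x1 + e3 * (x0 + x1 + x2) + 2 * e4 * (x0 - x1 + 2 * x2) = 0 \<and>
       e2 * x2 + e3 * (x0 + x1 + x2) - e4 * (x0 - x1 + 2 * x2) = 0 \<and>
       e0 * x3 + e3 * (x3 + x4 + x5) + e4 * (x3 + 2 * x4 - x5) = 0 \<and>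
       e1 * x4 + e3 * (x3 + x4 + x5) - e4 * (x3 + 2 * x4 - x5) = 0 \<and>
       e2 * x5 + e3 * (x3 + x4 + x5) + 2 * e4 * (x3 + 2 * x4 - x5) = 0"
    and inj: "\<And>y0 y1 y2 y3 y4 y5 z0 z1 z2 z3 z4 z5. \<lbrakk>
       k0 * y0 + k1 * y1 + k2 * y2 + k3 * y3 + k4 * y4 + k5 * y5 = 0;
       k0 * z0 + k1 * z1 + k2 * z2 + k3 * z3 + k4 * z4 + k5 * z5 = 0;
       x0 * y3 = x3 * y0; x1 * y4 = x4 * y1; x2 * y5 = x5 * y2;
       (x0 + x1 + x2) * (y3 + y4 + y5) = (x3 + x4 + x5) * (y0 + y1 + y2);
       (x0 - x1 + 2 * x2) * (y3 + 2 * y4 - y5) = (x3 + 2 * x4 - x5) * (y0 - y1 + 2 * y2);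
       x0 * z3 = x3 * z0; x1 * z4 = x4 * z1; x2 * z5 = x5 * z2;
       (x0 + x1 + x2) * (z3 + z4 + z5) = (x3 + x4 + x5) * (z0 + z1 + z2);
       (x0 - x1 + 2 * x2) * (z3 + 2 * z4 - z5) = (x3 + 2 * x4 - x5) * (z0 - z1 + 2 * z2);
       c0 * y3 + d0 * z3 + (c3 * (y3 + y4 + y5) + d3 * (z3 + z4 + z5)) + (c4 * (y3 + 2 * y4 - y5) + d4 * (z3 + 2 * z4 - z5)) = 0;
       c1 * y4 + d1 * z4 + (c3 * (y3 + y4 + y5) + d3 * (z3 + z4 + z5)) + (- (c4 * (y3 + 2 * y4 - y5)) - d4 * (z3 + 2 * z4 - z5)) = 0;
       c2 * y5 + d2 * z5 + (c3 * (y3 + y4 + y5) + d3 * (z3 + z4 + z5)) + (c4 * (y3 + 2 * y4 - y5) + d4 * (z3 + 2 * z4 - z5)) * 2 = 0;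
       c0 * y0 + d0 * z0 + (c3 * (y0 + y1 + y2) + d3 * (z0 + z1 + z2)) + (c4 * (y0 - y1 + 2 * y2) + d4 * (z0 - z1 + 2 * z2)) = 0;
       c1 * y1 + d1 * z1 + (c3 * (y0 + y1 + y2) + d3 * (z0 + z1 + z2)) + (c4 * (y0 - y1 + 2 * y2) + d4 * (z0 - z1 + 2 * z2)) * 2 = 0;
       c2 * y2 + d2 * z2 + (c3 * (y0 + y1 + y2) + d3 * (z0 + z1 + z2)) + (- (c4 * (y0 - y1 + 2 * y2)) - d4 * (z0 - z1 + 2 * z2)) = 0\<rbrakk>
      \<Longrightarrow> y0 = 0 \<and> y1 = 0 \<and> y2 = 0 \<and> y3 = 0 \<and> y4 = 0 \<and> y5 = 0 \<and>
          z0 = 0 \<and> z1 = 0 \<and> z2 = 0 \<and> z3 = 0 \<and> z4 = 0 \<and> (z5 :: complex) = 0"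
  shows "smooth_point (v6 x0 x1 x2 x3 x4 x5)"
proof -
  have pick: "k0 * u 0 + k1 * u 1 + k2 * u 2 + k3 * u 3 + k4 * u 4 + k5 * u 5 = u i0" for u
  proof -
    have "k0 * u 0 + k1 * u 1 + k2 * u 2 + k3 * u 3 + k4 * u 4 + k5 * u 5 = (\<Sum>i\<in>UNIV. v6 k0 k1 k2 k3 k4 k5 i * u i)"
      by (simp add: sum6)
    also have "\<dots> = (\<Sum>i\<in>UNIV. if i = i0 then u i else 0)"
      using k by (intro sum.cong refl) simp
    finally show ?thesis by simp
  qed
  have "transversal_at (v6 x0 x1 x2 x3 x4 x5) i0 (v5 c0 c1 c2 c3 c4) (v5 d0 d1 d2 d3 d4)"
    unfolding transversal_at_def
  proof (intro conjI)
    show "v6 x0 x1 x2 x3 x4 x5 i0 \<noteq> 0" using x pick[of "v6 x0 x1 x2 x3 x4 x5"] by simp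
    show "\<exists>l m. v5 c0 c1 c2 c3 c4 l * v5 d0 d1 d2 d3 d4 m \<noteq> v5 c0 c1 c2 c3 c4 m * v5 d0 d1 d2 d3 d4 l"
      using indep by blast
    show "\<forall>y z. y i0 = 0 \<longrightarrow> z i0 = 0 \<longrightarrow>
      (\<forall>l. first_value (v6 x0 x1 x2 x3 x4 x5) l * second_value y l = second_value (v6 x0 x1 x2 x3 x4 x5) l * first_value y l) \<longrightarrow>
      (\<forall>l. first_value (v6 x0 x1 x2 x3 x4 x5) l * second_value z l = second_value (v6 x0 x1 x2 x3 x4 x5) l * first_value z l) \<longrightarrow>
      (\<forall>i. (\<Sum>l\<in>UNIV. (v5 c0 c1 c2 c3 c4 l * second_value y l + v5 d0 d1 d2 d3 d4 l * second_value z l) * first_factor l i) = 0) \<longrightarrow>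
      (\<forall>i. (\<Sum>l\<in>UNIV. (v5 c0 c1 c2 c3 c4 l * first_value y l + v5 d0 d1 d2 d3 d4 l * first_value z l) * second_factor l i) = 0) \<longrightarrow>
      (\<forall>i. y i = 0 \<and> z i = 0)"
    proof (intro allI impI)
      fix y z i
      assume h: "y i0 = 0" "z i0 = 0"
        "\<forall>l. first_value (v6 x0 x1 x2 x3 x4 x5) l * second_value y l = second_value (v6 x0 x1 x2 x3 x4 x5) l * first_value y l"
        "\<forall>l. first_value (v6 x0 x1 x2 x3 x4 x5) l * second_value z l = second_value (v6 x0 x1 x2 x3 x4 x5) l * first_value z l"
        "\<forall>i. (\<Sum>l\<in>UNIV. (v5 c0 c1 c2 c3 c4 l * second_value y l + v5 d0 d1 d2 d3 d4 l * second_value z l) * first_factor l i) = 0"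
        "\<forall>i. (\<Sum>l\<in>UNIV. (v5 c0 c1 c2 c3 c4 l * first_value y l + v5 d0 d1 d2 d3 d4 l * first_value z l) * second_factor l i) = 0"
      have "y 0 = 0 \<and> y 1 = 0 \<and> y 2 = 0 \<and> y 3 = 0 \<and> y 4 = 0 \<and> y 5 = 0 \<and>
          z 0 = 0 \<and> z 1 = 0 \<and> z 2 = 0 \<and> z 3 = 0 \<and> z 4 = 0 \<and> z 5 = 0"
        by (rule inj[of "y 0" "y 1" "y 2" "y 3" "y 4" "y 5" "z 0" "z 1" "z 2" "z 3" "z 4" "z 5"])
          (use h(1,2) pick[of y] pick[of z] h(3,4)[unfolded all5] h(5,6)[unfolded all6] in
            \<open>simp_all add: sum5 first_factor_def first_value_def second_factor_def second_value_def\<close>)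
      then have "\<forall>i. y i = 0 \<and> z i = 0" unfolding all6 by simp
      then show "y i = 0 \<and> z i = 0" ..
    qed
  qed (use kernel in \<open>auto simp: all6 sum5 first_value_def second_value_def first_factor_def second_factor_def algebra_simps\<close>)
  then show ?thesis unfolding smooth_point_def by blast
qed

text \<open>A point \<open>(p, q)\<close> on each of fifteen lines. On the first ten, two of the five forms vanish:
  \<open>\<alpha>\<^sub>l(p) = \<alpha>\<^sub>m(p) = 0\<close> and \<open>\<beta>\<^sub>l(q) = \<beta>\<^sub>m(q) = 0\<close>. On each of the last five, one form vanishes and
  so does a combination of the other four: these have one linear relation \<open>\<lambda>\<close> among their second
  factors and one relation \<open>\<mu>\<close> among their first factors, and the coefficients \<open>e\<^sub>k\<close> of the
  combination satisfy \<open>e\<^sub>k \<alpha>\<^sub>k(p) = \<lambda>\<^sub>k\<close>, \<open>e\<^sub>k \<beta>\<^sub>k(q) = \<mu>\<^sub>k\<close>.\<close>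

lemma smooth_point_1: "smooth_point (v6 0 0 1 0 0 1)"
  by (rule smooth_pointI[where ?i0.0 = 2 and l = 0 and m = 1
      and ?k0.0 = 0 and ?k1.0 = 0 and ?k2.0 = 1 and ?k3.0 = 0 and ?k4.0 = 0 and ?k5.0 = 0
      and ?c0.0 = "1" and ?c1.0 = "0" and ?c2.0 = "0" and ?c3.0 = "0" and ?c4.0 = "0"
      and ?d0.0 = "0" and ?d1.0 = "1" and ?d2.0 = "0" and ?d3.0 = "0" and ?d4.0 = "0"])
    (simp add: all6, simp, simp, simp, (intro conjI; algebra))

lemma smooth_point_2: "smooth_point (v6 0 1 0 0 1 0)"
  by (rule smooth_pointI[where ?i0.0 = 1 and l = 0 and m = 2
      and ?k0.0 = 0 and ?k1.0 = 1 and ?k2.0 = 0 and ?k3.0 = 0 and ?k4.0 = 0 and ?k5.0 = 0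
      and ?c0.0 = "1" and ?c1.0 = "0" and ?c2.0 = "0" and ?c3.0 = "0" and ?c4.0 = "0"
      and ?d0.0 = "0" and ?d1.0 = "0" and ?d2.0 = "1" and ?d3.0 = "0" and ?d4.0 = "0"])
    (simp add: all6, simp, simp, simp, (intro conjI; algebra))

lemma smooth_point_3: "smooth_point (v6 0 1 (-1) 0 1 (-1))"
  by (rule smooth_pointI[where ?i0.0 = 1 and l = 0 and m = 3
      and ?k0.0 = 0 and ?k1.0 = 1 and ?k2.0 = 0 and ?k3.0 = 0 and ?k4.0 = 0 and ?k5.0 = 0
      and ?c0.0 = "1" and ?c1.0 = "0" and ?c2.0 = "0" and ?c3.0 = "0" and ?c4.0 = "0"
      and ?d0.0 = "0" and ?d1.0 = "0" and ?d2.0 = "0" and ?d3.0 = "1" and ?d4.0 = "0"])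
    (simp add: all6, simp, simp, simp, (intro conjI; algebra))

lemma smooth_point_4: "smooth_point (v6 0 2 1 0 1 2)"
  by (rule smooth_pointI[where ?i0.0 = 1 and l = 0 and m = 4
      and ?k0.0 = 0 and ?k1.0 = 1 and ?k2.0 = 0 and ?k3.0 = 0 and ?k4.0 = 0 and ?k5.0 = 0
      and ?c0.0 = "1" and ?c1.0 = "0" and ?c2.0 = "0" and ?c3.0 = "0" and ?c4.0 = "0"
      and ?d0.0 = "0" and ?d1.0 = "0" and ?d2.0 = "0" and ?d3.0 = "0" and ?d4.0 = "1"])
    (simp add: all6, simp, simp, simp, (intro conjI; algebra))

lemma smooth_point_5: "smooth_point (v6 1 0 0 1 0 0)"
  by (rule smooth_pointI[where ?i0.0 = 0 and l = 1 and m = 2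
      and ?k0.0 = 1 and ?k1.0 = 0 and ?k2.0 = 0 and ?k3.0 = 0 and ?k4.0 = 0 and ?k5.0 = 0
      and ?c0.0 = "0" and ?c1.0 = "1" and ?c2.0 = "0" and ?c3.0 = "0" and ?c4.0 = "0"
      and ?d0.0 = "0" and ?d1.0 = "0" and ?d2.0 = "1" and ?d3.0 = "0" and ?d4.0 = "0"])
    (simp add: all6, simp, simp, simp, (intro conjI; algebra))

lemma smooth_point_6: "smooth_point (v6 1 0 (-1) 1 0 (-1))"
  by (rule smooth_pointI[where ?i0.0 = 0 and l = 1 and m = 3
      and ?k0.0 = 1 and ?k1.0 = 0 and ?k2.0 = 0 and ?k3.0 = 0 and ?k4.0 = 0 and ?k5.0 = 0
      and ?c0.0 = "0" and ?c1.0 = "1" and ?c2.0 = "0" and ?c3.0 = "0" and ?c4.0 = "0"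
      and ?d0.0 = "0" and ?d1.0 = "0" and ?d2.0 = "0" and ?d3.0 = "1" and ?d4.0 = "0"])
    (simp add: all6, simp, simp, simp, (intro conjI; algebra))

lemma smooth_point_7: "smooth_point (v6 2 0 (-1) 1 0 1)"
  by (rule smooth_pointI[where ?i0.0 = 0 and l = 1 and m = 4
      and ?k0.0 = 1 and ?k1.0 = 0 and ?k2.0 = 0 and ?k3.0 = 0 and ?k4.0 = 0 and ?k5.0 = 0
      and ?c0.0 = "0" and ?c1.0 = "1" and ?c2.0 = "0" and ?c3.0 = "0" and ?c4.0 = "0"
      and ?d0.0 = "0" and ?d1.0 = "0" and ?d2.0 = "0" and ?d3.0 = "0" and ?d4.0 = "1"])
    (simp add: all6, simp, simp, simp, (intro conjI; algebra))

lemma smooth_point_8: "smooth_point (v6 1 (-1) 0 1 (-1) 0)"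
  by (rule smooth_pointI[where ?i0.0 = 0 and l = 2 and m = 3
      and ?k0.0 = 1 and ?k1.0 = 0 and ?k2.0 = 0 and ?k3.0 = 0 and ?k4.0 = 0 and ?k5.0 = 0
      and ?c0.0 = "0" and ?c1.0 = "0" and ?c2.0 = "1" and ?c3.0 = "0" and ?c4.0 = "0"
      and ?d0.0 = "0" and ?d1.0 = "0" and ?d2.0 = "0" and ?d3.0 = "1" and ?d4.0 = "0"])
    (simp add: all6, simp, simp, simp, (intro conjI; algebra))

lemma smooth_point_9: "smooth_point (v6 1 1 0 2 (-1) 0)"
  by (rule smooth_pointI[where ?i0.0 = 0 and l = 2 and m = 4
      and ?k0.0 = 1 and ?k1.0 = 0 and ?k2.0 = 0 and ?k3.0 = 0 and ?k4.0 = 0 and ?k5.0 = 0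
      and ?c0.0 = "0" and ?c1.0 = "0" and ?c2.0 = "1" and ?c3.0 = "0" and ?c4.0 = "0"
      and ?d0.0 = "0" and ?d1.0 = "0" and ?d2.0 = "0" and ?d3.0 = "0" and ?d4.0 = "1"])
    (simp add: all6, simp, simp, simp, (intro conjI; algebra))

lemma smooth_point_10: "smooth_point (v6 3 (-1) (-2) 3 (-2) (-1))"
  by (rule smooth_pointI[where ?i0.0 = 0 and l = 3 and m = 4
      and ?k0.0 = 1 and ?k1.0 = 0 and ?k2.0 = 0 and ?k3.0 = 0 and ?k4.0 = 0 and ?k5.0 = 0
      and ?c0.0 = "0" and ?c1.0 = "0" and ?c2.0 = "0" and ?c3.0 = "1" and ?c4.0 = "0"
      and ?d0.0 = "0" and ?d1.0 = "0" and ?d2.0 = "0" and ?d3.0 = "0" and ?d4.0 = "1"])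
    (simp add: all6, simp, simp, simp, (intro conjI; algebra))

lemma smooth_point_11: "smooth_point (v6 0 1 (-2) 0 2 (-1))"
  by (rule smooth_pointI[where ?i0.0 = 1 and l = 0 and m = 1
      and ?k0.0 = 0 and ?k1.0 = 1 and ?k2.0 = 0 and ?k3.0 = 0 and ?k4.0 = 0 and ?k5.0 = 0
      and ?c0.0 = "1" and ?c1.0 = "0" and ?c2.0 = "0" and ?c3.0 = "0" and ?c4.0 = "0"
      and ?d0.0 = "0" and ?d1.0 = "5" and ?d2.0 = "5" and ?d3.0 = "(-5)" and ?d4.0 = "1"])
    (simp add: all6, simp, simp, simp, (intro conjI; algebra))

lemma smooth_point_12: "smooth_point (v6 1 0 (-3) 2 0 (-3))"
  by (rule smooth_pointI[where ?i0.0 = 0 and l = 0 and m = 1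
      and ?k0.0 = 1 and ?k1.0 = 0 and ?k2.0 = 0 and ?k3.0 = 0 and ?k4.0 = 0 and ?k5.0 = 0
      and ?c0.0 = "0" and ?c1.0 = "1" and ?c2.0 = "0" and ?c3.0 = "0" and ?c4.0 = "0"
      and ?d0.0 = "(-5)" and ?d1.0 = "0" and ?d2.0 = "5" and ?d3.0 = "(-5)" and ?d4.0 = "1"])
    (simp add: all6, simp, simp, simp, (intro conjI; algebra))

lemma smooth_point_13: "smooth_point (v6 2 (-3) 0 1 (-3) 0)"
  by (rule smooth_pointI[where ?i0.0 = 0 and l = 0 and m = 2
      and ?k0.0 = 1 and ?k1.0 = 0 and ?k2.0 = 0 and ?k3.0 = 0 and ?k4.0 = 0 and ?k5.0 = 0
      and ?c0.0 = "0" and ?c1.0 = "0" and ?c2.0 = "1" and ?c3.0 = "0" and ?c4.0 = "0"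
      and ?d0.0 = "(-5)" and ?d1.0 = "5" and ?d2.0 = "0" and ?d3.0 = "(-5)" and ?d4.0 = "1"])
    (simp add: all6, simp, simp, simp, (intro conjI; algebra))

lemma smooth_point_14: "smooth_point (v6 1 (-2) 1 1 1 (-2))"
  by (rule smooth_pointI[where ?i0.0 = 0 and l = 0 and m = 3
      and ?k0.0 = 1 and ?k1.0 = 0 and ?k2.0 = 0 and ?k3.0 = 0 and ?k4.0 = 0 and ?k5.0 = 0
      and ?c0.0 = "0" and ?c1.0 = "0" and ?c2.0 = "0" and ?c3.0 = "1" and ?c4.0 = "0"
      and ?d0.0 = "(-5)" and ?d1.0 = "5" and ?d2.0 = "5" and ?d3.0 = "0" and ?d4.0 = "1"])
    (simp add: all6, simp, simp, simp, (intro conjI; algebra))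

lemma smooth_point_15: "smooth_point (v6 1 (-1) (-1) 1 (-1) (-1))"
  by (rule smooth_pointI[where ?i0.0 = 0 and l = 0 and m = 4
      and ?k0.0 = 1 and ?k1.0 = 0 and ?k2.0 = 0 and ?k3.0 = 0 and ?k4.0 = 0 and ?k5.0 = 0
      and ?c0.0 = "1" and ?c1.0 = "(-1)" and ?c2.0 = "(-1)" and ?c3.0 = "1" and ?c4.0 = "0"
      and ?d0.0 = "0" and ?d1.0 = "0" and ?d2.0 = "0" and ?d3.0 = "0" and ?d4.0 = "1"])
    (simp add: all6, simp, simp, simp, (intro conjI; algebra))

lemmas smooth_points =
  smooth_point_1 smooth_point_2 smooth_point_3 smooth_point_4 smooth_point_5
  smooth_point_6 smooth_point_7 smooth_point_8 smooth_point_9 smooth_point_10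
  smooth_point_11 smooth_point_12 smooth_point_13 smooth_point_14 smooth_point_15

section \<open>Cubics vanishing on the fifteen lines\<close>

text \<open>An enumeration of the indices, so that every cubic monomial has one sorted triple.\<close>

definition index6 :: "6 \<Rightarrow> nat" where
  "index6 = v6 0 1 2 3 4 5"

definition sorted_triples :: "(6 \<times> 6 \<times> 6) set" where
  "sorted_triples = {(i, j, k). index6 i \<le> index6 j \<and> index6 j \<le> index6 k}"

text \<open>The cubics vanishing on the fifteen lines form a space of dimension six on which the coefficients
  of these six monomials are coordinates. Three of the monomials have degree one and three have
  degree two in the last three coordinates; in each of these bidegrees the fifteen lines impose
  independent conditions on the eighteen coefficients.\<close>

definition free_triples :: "(6 \<times> 6 \<times> 6) set" where
  "free_triples = {(0, 0, 4), (0, 0, 5), (1, 1, 5), (1, 3, 3), (2, 3, 3), (2, 4, 4)}"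

definition cubic :: "(6 \<times> 6 \<times> 6 \<Rightarrow> complex) \<Rightarrow> (6 \<Rightarrow> complex) \<Rightarrow> complex" where
  "cubic a x = (\<Sum>(i, j, k)\<in>sorted_triples - free_triples. a (i, j, k) * x i * x j * x k)"

lemma cubic_expand:
  "cubic a x = (\<Sum>i\<in>UNIV. \<Sum>j\<in>UNIV. \<Sum>k\<in>UNIV.
     if (i, j, k) \<in> sorted_triples - free_triples then a (i, j, k) * x i * x j * x k else 0)"
proof -
  have "cubic a x = (\<Sum>t\<in>UNIV. if t \<in> sorted_triples - free_triples then
      (case t of (i, j, k) \<Rightarrow> a (i, j, k) * x i * x j * x k) else 0)"
    unfolding cubic_def by (rule sum.mono_neutral_cong_left) auto
  also have "\<dots> = (\<Sum>i\<in>UNIV. \<Sum>jk\<in>UNIV. if (i, jk) \<in> sorted_triples - free_triples then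
      (case jk of (j, k) \<Rightarrow> a (i, j, k) * x i * x j * x k) else 0)"
    unfolding sum.cartesian_product UNIV_Times_UNIV by (rule sum.cong[OF refl]) auto
  also have "\<dots> = (\<Sum>i\<in>UNIV. \<Sum>j\<in>UNIV. \<Sum>k\<in>UNIV.
     if (i, j, k) \<in> sorted_triples - free_triples then a (i, j, k) * x i * x j * x k else 0)"
    by (rule sum.cong[OF refl], unfold sum.cartesian_product UNIV_Times_UNIV, rule sum.cong[OF refl]) auto
  finally show ?thesis .
qed

text \<open>The bihomogeneous parts of \<open>cubic a\<close>, numbered by their degree in the last three coordinates.\<close>

definition part0 :: "(6 \<times> 6 \<times> 6 \<Rightarrow> complex) \<Rightarrow> (6 \<Rightarrow> complex) \<Rightarrow> complex" where
  "part0 a x = a (0, 0, 0) * x 0 * x 0 * x 0 +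
     a (0, 0, 1) * x 0 * x 0 * x 1 +
     a (0, 0, 2) * x 0 * x 0 * x 2 +
     a (0, 1, 1) * x 0 * x 1 * x 1 +
     a (0, 1, 2) * x 0 * x 1 * x 2 +
     a (0, 2, 2) * x 0 * x 2 * x 2 +
     a (1, 1, 1) * x 1 * x 1 * x 1 +
     a (1, 1, 2) * x 1 * x 1 * x 2 +
     a (1, 2, 2) * x 1 * x 2 * x 2 +
     a (2, 2, 2) * x 2 * x 2 * x 2"

definition part1 :: "(6 \<times> 6 \<times> 6 \<Rightarrow> complex) \<Rightarrow> (6 \<Rightarrow> complex) \<Rightarrow> complex" where
  "part1 a x = a (0, 0, 3) * x 0 * x 0 * x 3 +
     a (0, 1, 3) * x 0 * x 1 * x 3 +
     a (0, 1, 4) * x 0 * x 1 * x 4 +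
     a (0, 1, 5) * x 0 * x 1 * x 5 +
     a (0, 2, 3) * x 0 * x 2 * x 3 +
     a (0, 2, 4) * x 0 * x 2 * x 4 +
     a (0, 2, 5) * x 0 * x 2 * x 5 +
     a (1, 1, 3) * x 1 * x 1 * x 3 +
     a (1, 1, 4) * x 1 * x 1 * x 4 +
     a (1, 2, 3) * x 1 * x 2 * x 3 +
     a (1, 2, 4) * x 1 * x 2 * x 4 +
     a (1, 2, 5) * x 1 * x 2 * x 5 +
     a (2, 2, 3) * x 2 * x 2 * x 3 +
     a (2, 2, 4) * x 2 * x 2 * x 4 +
     a (2, 2, 5) * x 2 * x 2 * x 5"

definition part2 :: "(6 \<times> 6 \<times> 6 \<Rightarrow> complex) \<Rightarrow> (6 \<Rightarrow> complex) \<Rightarrow> complex" where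
  "part2 a x = a (0, 3, 3) * x 0 * x 3 * x 3 +
     a (0, 3, 4) * x 0 * x 3 * x 4 +
     a (0, 3, 5) * x 0 * x 3 * x 5 +
     a (0, 4, 4) * x 0 * x 4 * x 4 +
     a (0, 4, 5) * x 0 * x 4 * x 5 +
     a (0, 5, 5) * x 0 * x 5 * x 5 +
     a (1, 3, 4) * x 1 * x 3 * x 4 +
     a (1, 3, 5) * x 1 * x 3 * x 5 +
     a (1, 4, 4) * x 1 * x 4 * x 4 +
     a (1, 4, 5) * x 1 * x 4 * x 5 +
     a (1, 5, 5) * x 1 * x 5 * x 5 +
     a (2, 3, 4) * x 2 * x 3 * x 4 +
     a (2, 3, 5) * x 2 * x 3 * x 5 +
     a (2, 4, 5) * x 2 * x 4 * x 5 +
     a (2, 5, 5) * x 2 * x 5 * x 5"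

definition part3 :: "(6 \<times> 6 \<times> 6 \<Rightarrow> complex) \<Rightarrow> (6 \<Rightarrow> complex) \<Rightarrow> complex" where
  "part3 a x = a (3, 3, 3) * x 3 * x 3 * x 3 +
     a (3, 3, 4) * x 3 * x 3 * x 4 +
     a (3, 3, 5) * x 3 * x 3 * x 5 +
     a (3, 4, 4) * x 3 * x 4 * x 4 +
     a (3, 4, 5) * x 3 * x 4 * x 5 +
     a (3, 5, 5) * x 3 * x 5 * x 5 +
     a (4, 4, 4) * x 4 * x 4 * x 4 +
     a (4, 4, 5) * x 4 * x 4 * x 5 +
     a (4, 5, 5) * x 4 * x 5 * x 5 +
     a (5, 5, 5) * x 5 * x 5 * x 5"

lemma cubic_parts: "cubic a x = part0 a x + part1 a x + part2 a x + part3 a x"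
  unfolding cubic_expand sorted_triples_def free_triples_def part0_def part1_def part2_def part3_def sum6
  by (simp add: index6_def)

lemma parts_scale_second:
  "part0 a (scale_second s x) = part0 a x" "part1 a (scale_second s x) = s * part1 a x"
  "part2 a (scale_second s x) = s\<^sup>2 * part2 a x" "part3 a (scale_second s x) = s ^ 3 * part3 a x"
  by (simp_all add: part0_def part1_def part2_def part3_def scale_second_def distrib_left
      power2_eq_square power3_eq_cube mult_ac)

text \<open>The cubic vanishes at \<open>scale_second s x\<close> for all \<open>s \<noteq> 0\<close>, and four values of \<open>s\<close> separate the four
  powers of \<open>s\<close>.\<close>

lemma parts_vanish:
  assumes "\<And>x. smooth_point x \<Longrightarrow> cubic a x = 0" "smooth_point x"
  shows "part0 a x = 0" "part1 a x = 0" "part2 a x = 0" "part3 a x = 0"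
proof -
  have e: "part0 a x + s * part1 a x + s\<^sup>2 * part2 a x + s ^ 3 * part3 a x = 0" if "s \<noteq> 0" for s
    using assms(1)[OF smooth_point_scale_second[OF assms(2) that]]
    by (simp only: cubic_parts parts_scale_second)
  have 1: "f0 + f1 + f2 + f3 = 0 \<Longrightarrow> f0 - f1 + f2 - f3 = 0 \<Longrightarrow> f0 + 2 * f1 + 4 * f2 + 8 * f3 = 0 \<Longrightarrow>
      f0 - 2 * f1 + 4 * f2 - 8 * f3 = 0 \<Longrightarrow> f0 = 0 \<and> f1 = 0 \<and> f2 = 0 \<and> f3 = 0" for f0 f1 f2 f3 :: complex
    by (intro conjI; algebra)
  have "part0 a x = 0 \<and> part1 a x = 0 \<and> part2 a x = 0 \<and> part3 a x = 0"
    by (rule 1) (use e[of 1] e[of "-1"] e[of 2] e[of "-2"] in simp_all)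
  then show "part0 a x = 0" "part1 a x = 0" "part2 a x = 0" "part3 a x = 0" by auto
qed

text \<open>For each of the four parts, the fifteen lines give fifteen linear equations for the remaining
  coefficients: ten coefficients in \<open>part0\<close> and \<open>part3\<close>, fifteen in \<open>part1\<close> and \<open>part2\<close>. The
  premises of \<open>scalar\<close> are these equations, in the order of the points.\<close>

lemma part0_coefficients:
  assumes "\<And>x. smooth_point x \<Longrightarrow> cubic a x = 0"
  shows "a (0, 0, 0) = 0 \<and> a (0, 0, 1) = 0 \<and> a (0, 0, 2) = 0 \<and> a (0, 1, 1) = 0 \<and> a (0, 1, 2) = 0 \<and> a (0, 2, 2) = 0 \<and> a (1, 1, 1) = 0 \<and> a (1, 1, 2) = 0 \<and> a (1, 2, 2) = 0 \<and> a (2, 2, 2) = 0"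
proof -
  note e = smooth_points[THEN parts_vanish(1)[OF assms, rotated]]
  have scalar: "a000 = 0 \<and> a001 = 0 \<and> a002 = 0 \<and> a011 = 0 \<and> a012 = 0 \<and> a022 = 0 \<and> a111 = 0 \<and> a112 = 0 \<and> a122 = 0 \<and> a222 = 0" if
    "a222 = 0"
    "a111 = 0"
    "a111 + (-1) * a112 + a122 + (-1) * a222 = 0"
    "8 * a111 + 4 * a112 + 2 * a122 + a222 = 0"
    "a000 = 0"
    "a000 + (-1) * a002 + a022 + (-1) * a222 = 0"
    "8 * a000 + (-4) * a002 + 2 * a022 + (-1) * a222 = 0"
    "a000 + (-1) * a001 + a011 + (-1) * a111 = 0"
    "a000 + a001 + a011 + a111 = 0"
    "27 * a000 + (-9) * a001 + (-18) * a002 + 3 * a011 + 6 * a012 + 12 * a022 + (-1) * a111 + (-2) * a112 + (-4) * a122 + (-8) * a222 = 0"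
    "a111 + (-2) * a112 + 4 * a122 + (-8) * a222 = 0"
    "a000 + (-3) * a002 + 9 * a022 + (-27) * a222 = 0"
    "8 * a000 + (-12) * a001 + 18 * a011 + (-27) * a111 = 0"
    "a000 + (-2) * a001 + a002 + 4 * a011 + (-2) * a012 + a022 + (-8) * a111 + 4 * a112 + (-2) * a122 + a222 = 0"
    "a000 + (-1) * a001 + (-1) * a002 + a011 + a012 + a022 + (-1) * a111 + (-1) * a112 + (-1) * a122 + (-1) * a222 = 0" for a000 a001 a002 a011 a012 a022 a111 a112 a122 a222 :: complex
    using that by (intro conjI; algebra)
  show ?thesis
    by (rule scalar) (use e in \<open>simp_all add: part0_def algebra_simps\<close>)
qed

lemma part1_coefficients:
  assumes "\<And>x. smooth_point x \<Longrightarrow> cubic a x = 0"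
  shows "a (0, 0, 3) = 0 \<and> a (0, 1, 3) = 0 \<and> a (0, 1, 4) = 0 \<and> a (0, 1, 5) = 0 \<and> a (0, 2, 3) = 0 \<and> a (0, 2, 4) = 0 \<and> a (0, 2, 5) = 0 \<and> a (1, 1, 3) = 0 \<and> a (1, 1, 4) = 0 \<and> a (1, 2, 3) = 0 \<and> a (1, 2, 4) = 0 \<and> a (1, 2, 5) = 0 \<and> a (2, 2, 3) = 0 \<and> a (2, 2, 4) = 0 \<and> a (2, 2, 5) = 0"
proof -
  note e = smooth_points[THEN parts_vanish(2)[OF assms, rotated]]
  have scalar: "a003 = 0 \<and> a013 = 0 \<and> a014 = 0 \<and> a015 = 0 \<and> a023 = 0 \<and> a024 = 0 \<and> a025 = 0 \<and> a113 = 0 \<and> a114 = 0 \<and> a123 = 0 \<and> a124 = 0 \<and> a125 = 0 \<and> a223 = 0 \<and> a224 = 0 \<and> a225 = 0" if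
    "a225 = 0"
    "a114 = 0"
    "a114 + (-1) * a124 + a125 + a224 + (-1) * a225 = 0"
    "4 * a114 + 2 * a124 + 4 * a125 + a224 + 2 * a225 = 0"
    "a003 = 0"
    "a003 + (-1) * a023 + a025 + a223 + (-1) * a225 = 0"
    "4 * a003 + (-2) * a023 + (-2) * a025 + a223 + a225 = 0"
    "a003 + (-1) * a013 + a014 + a113 + (-1) * a114 = 0"
    "2 * a003 + 2 * a013 + (-1) * a014 + 2 * a113 + (-1) * a114 = 0"
    "27 * a003 + (-9) * a013 + 6 * a014 + 3 * a015 + (-18) * a023 + 12 * a024 + 6 * a025 + 3 * a113 + (-2) * a114 + 6 * a123 + (-4) * a124 + (-2) * a125 + 12 * a223 + (-8) * a224 + (-4) * a225 = 0"
    "2 * a114 + (-4) * a124 + 2 * a125 + 8 * a224 + (-4) * a225 = 0"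
    "2 * a003 + (-6) * a023 + 9 * a025 + 18 * a223 + (-27) * a225 = 0"
    "4 * a003 + (-6) * a013 + 18 * a014 + 9 * a113 + (-27) * a114 = 0"
    "a003 + (-2) * a013 + (-2) * a014 + 4 * a015 + a023 + a024 + (-2) * a025 + 4 * a113 + 4 * a114 + (-2) * a123 + (-2) * a124 + 4 * a125 + a223 + a224 + (-2) * a225 = 0"
    "a003 + (-1) * a013 + a014 + a015 + (-1) * a023 + a024 + a025 + a113 + (-1) * a114 + a123 + (-1) * a124 + (-1) * a125 + a223 + (-1) * a224 + (-1) * a225 = 0" for a003 a013 a014 a015 a023 a024 a025 a113 a114 a123 a124 a125 a223 a224 a225 :: complex
    using that by (intro conjI; algebra)
  show ?thesis
    by (rule scalar) (use e in \<open>simp_all add: part1_def algebra_simps\<close>)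
qed

lemma part2_coefficients:
  assumes "\<And>x. smooth_point x \<Longrightarrow> cubic a x = 0"
  shows "a (0, 3, 3) = 0 \<and> a (0, 3, 4) = 0 \<and> a (0, 3, 5) = 0 \<and> a (0, 4, 4) = 0 \<and> a (0, 4, 5) = 0 \<and> a (0, 5, 5) = 0 \<and> a (1, 3, 4) = 0 \<and> a (1, 3, 5) = 0 \<and> a (1, 4, 4) = 0 \<and> a (1, 4, 5) = 0 \<and> a (1, 5, 5) = 0 \<and> a (2, 3, 4) = 0 \<and> a (2, 3, 5) = 0 \<and> a (2, 4, 5) = 0 \<and> a (2, 5, 5) = 0"
proof -
  note e = smooth_points[THEN parts_vanish(3)[OF assms, rotated]]
  have scalar: "a033 = 0 \<and> a034 = 0 \<and> a035 = 0 \<and> a044 = 0 \<and> a045 = 0 \<and> a055 = 0 \<and> a134 = 0 \<and> a135 = 0 \<and> a144 = 0 \<and> a145 = 0 \<and> a155 = 0 \<and> a234 = 0 \<and> a235 = 0 \<and> a245 = 0 \<and> a255 = 0" if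
    "a255 = 0"
    "a144 = 0"
    "a144 + (-1) * a145 + a155 + a245 + (-1) * a255 = 0"
    "2 * a144 + 4 * a145 + 8 * a155 + 2 * a245 + 4 * a255 = 0"
    "a033 = 0"
    "a033 + (-1) * a035 + a055 + a235 + (-1) * a255 = 0"
    "2 * a033 + 2 * a035 + 2 * a055 + (-1) * a235 + (-1) * a255 = 0"
    "a033 + (-1) * a034 + a044 + a134 + (-1) * a144 = 0"
    "4 * a033 + (-2) * a034 + a044 + (-2) * a134 + a144 = 0"
    "27 * a033 + (-18) * a034 + (-9) * a035 + 12 * a044 + 6 * a045 + 3 * a055 + 6 * a134 + 3 * a135 + (-4) * a144 + (-2) * a145 + (-1) * a155 + 12 * a234 + 6 * a235 + (-4) * a245 + (-2) * a255 = 0"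
    "4 * a144 + (-2) * a145 + a155 + 4 * a245 + (-2) * a255 = 0"
    "4 * a033 + (-6) * a035 + 9 * a055 + 18 * a235 + (-27) * a255 = 0"
    "2 * a033 + (-6) * a034 + 18 * a044 + 9 * a134 + (-27) * a144 = 0"
    "a033 + a034 + (-2) * a035 + a044 + (-2) * a045 + 4 * a055 + (-2) * a134 + 4 * a135 + (-2) * a144 + 4 * a145 + (-8) * a155 + a234 + (-2) * a235 + (-2) * a245 + 4 * a255 = 0"
    "a033 + (-1) * a034 + (-1) * a035 + a044 + a045 + a055 + a134 + a135 + (-1) * a144 + (-1) * a145 + (-1) * a155 + a234 + a235 + (-1) * a245 + (-1) * a255 = 0" for a033 a034 a035 a044 a045 a055 a134 a135 a144 a145 a155 a234 a235 a245 a255 :: complex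
    using that by (intro conjI; algebra)
  show ?thesis
    by (rule scalar) (use e in \<open>simp_all add: part2_def algebra_simps\<close>)
qed

lemma part3_coefficients:
  assumes "\<And>x. smooth_point x \<Longrightarrow> cubic a x = 0"
  shows "a (3, 3, 3) = 0 \<and> a (3, 3, 4) = 0 \<and> a (3, 3, 5) = 0 \<and> a (3, 4, 4) = 0 \<and> a (3, 4, 5) = 0 \<and> a (3, 5, 5) = 0 \<and> a (4, 4, 4) = 0 \<and> a (4, 4, 5) = 0 \<and> a (4, 5, 5) = 0 \<and> a (5, 5, 5) = 0"
proof -
  note e = smooth_points[THEN parts_vanish(4)[OF assms, rotated]]
  have scalar: "a333 = 0 \<and> a334 = 0 \<and> a335 = 0 \<and> a344 = 0 \<and> a345 = 0 \<and> a355 = 0 \<and> a444 = 0 \<and> a445 = 0 \<and> a455 = 0 \<and> a555 = 0" if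
    "a555 = 0"
    "a444 = 0"
    "a444 + (-1) * a445 + a455 + (-1) * a555 = 0"
    "a444 + 2 * a445 + 4 * a455 + 8 * a555 = 0"
    "a333 = 0"
    "a333 + (-1) * a335 + a355 + (-1) * a555 = 0"
    "a333 + a335 + a355 + a555 = 0"
    "a333 + (-1) * a334 + a344 + (-1) * a444 = 0"
    "8 * a333 + (-4) * a334 + 2 * a344 + (-1) * a444 = 0"
    "27 * a333 + (-18) * a334 + (-9) * a335 + 12 * a344 + 6 * a345 + 3 * a355 + (-8) * a444 + (-4) * a445 + (-2) * a455 + (-1) * a555 = 0"
    "8 * a444 + (-4) * a445 + 2 * a455 + (-1) * a555 = 0"
    "8 * a333 + (-12) * a335 + 18 * a355 + (-27) * a555 = 0"
    "a333 + (-3) * a334 + 9 * a344 + (-27) * a444 = 0"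
    "a333 + a334 + (-2) * a335 + a344 + (-2) * a345 + 4 * a355 + a444 + (-2) * a445 + 4 * a455 + (-8) * a555 = 0"
    "a333 + (-1) * a334 + (-1) * a335 + a344 + a345 + a355 + (-1) * a444 + (-1) * a445 + (-1) * a455 + (-1) * a555 = 0" for a333 a334 a335 a344 a345 a355 a444 a445 a455 a555 :: complex
    using that by (intro conjI; algebra)
  show ?thesis
    by (rule scalar) (use e in \<open>simp_all add: part3_def algebra_simps\<close>)
qed

theorem cubic_vanishing_on_smooth_points:
  assumes "\<And>x. smooth_point x \<Longrightarrow> cubic a x = 0" "t \<in> sorted_triples - free_triples"
  shows "a t = 0"
proof -
  have "\<forall>i j k. (i, j, k) \<in> sorted_triples - free_triples \<longrightarrow> a (i, j, k) = 0"
    unfolding all6 sorted_triples_def free_triples_def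
    using part0_coefficients[OF assms(1)] part1_coefficients[OF assms(1)]
      part2_coefficients[OF assms(1)] part3_coefficients[OF assms(1)]
    by (simp add: index6_def)
  then show ?thesis using assms(2) by (cases t) blast
qed

section \<open>The quartic of the decomposable forms\<close>

definition base_columns :: "5 \<Rightarrow> 6" where
  "base_columns = v5 1 2 3 4 5"

definition base_quartic :: "(6 \<Rightarrow> complex) \<Rightarrow> complex" where
  "base_quartic x =
    ((x 3 + x 4 + x 5) * x 1 - (x 0 + x 1 + x 2) * x 4) *
      (2 * (x 3 + 2 * x 4 - x 5) * x 2 + (x 0 - x 1 + 2 * x 2) * x 5) +
    ((x 3 + x 4 + x 5) * x 2 - (x 0 + x 1 + x 2) * x 5) *
      ((x 3 + 2 * x 4 - x 5) * x 1 + 2 * (x 0 - x 1 + 2 * x 2) * x 4)"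

lemma partial_det_2: "a \<noteq> b \<Longrightarrow> partial_det {a, b} B = B a a * B b b - B a b * B b a"
  using partial_det_insert[of "{b}" a B] partial_det_insert[of "{}" b B]
    partial_det_insert[of "{}" b "\<lambda>i j. B i (Transposition.transpose a b j)"] by simp

lemma partial_det_3:
  assumes "a \<noteq> b" "a \<noteq> c" "b \<noteq> c"
  shows "partial_det {a, b, c} B = B a a * (B b b * B c c - B b c * B c b)
    - (B a b * (B b a * B c c - B b c * B c a) + B a c * (B b b * B c a - B b a * B c b))"
  using partial_det_insert[of "{b, c}" a B] assms
  by (simp add: partial_det_2 Transposition.transpose_def)

text \<open>The matrix of \<open>base_form\<close> at a point, without the first column. The rows of the coordinate forms
  have at most two non-zero entries, so the expansion starts with them.\<close>

lemma partial_det_sparse: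
  fixes B :: "5 \<Rightarrow> 5 \<Rightarrow> complex"
  assumes B: "B 0 0 = 0" "B 0 1 = 0" "B 0 2 = x0" "B 0 3 = 0" "B 0 4 = 0" "B 1 0 = - x4" "B 1 1 = 0" "B 1 2 = 0" "B 1 3 = x1" "B 1 4 = 0" "B 2 0 = 0" "B 2 1 = - x5" "B 2 2 = 0" "B 2 3 = 0" "B 2 4 = x2" "B 3 0 = - t" "B 3 1 = - t" "B 3 2 = s" "B 3 3 = s" "B 3 4 = s" "B 4 0 = b" "B 4 1 = - (2 * b)" "B 4 2 = a" "B 4 3 = 2 * a" "B 4 4 = - a"
  shows "partial_det {0, 1, 2, 3, 4} B = x0 *
    ((t * x1 - s * x4) * (2 * b * x2 + a * x5) + (t * x2 - s * x5) * (b * x1 + 2 * a * x4))"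
proof -
  have "partial_det {0, 1, 2, 3, 4} B = - (x0 * partial_det {1, 2, 3, 4} (\<lambda>i j. B i (Transposition.transpose 0 2 j)))"
    by (subst partial_det_insert) (simp_all add: B)
  also have "partial_det {1, 2, 3, 4} (\<lambda>i j. B i (Transposition.transpose 0 2 j)) =
      x4 * partial_det {2, 3, 4} (\<lambda>i j. B i (Transposition.transpose 0 2 (Transposition.transpose 1 2 j)))
      - x1 * partial_det {2, 3, 4} (\<lambda>i j. B i (Transposition.transpose 0 2 (Transposition.transpose 1 3 j)))"
    by (subst partial_det_insert) (simp_all add: B Transposition.transpose_def)
  also have "x4 * partial_det {2, 3, 4} (\<lambda>i j. B i (Transposition.transpose 0 2 (Transposition.transpose 1 2 j))) =
      x4 * (x5 * 3 * s * a + x2 * (2 * b * s - 2 * a * t))"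
    by (simp add: partial_det_3 B Transposition.transpose_def) (simp add: algebra_simps)
  also have "x1 * partial_det {2, 3, 4} (\<lambda>i j. B i (Transposition.transpose 0 2 (Transposition.transpose 1 3 j))) =
      x1 * (x2 * 3 * b * t + x5 * (a * t - b * s))"
    by (simp add: partial_det_3 B Transposition.transpose_def)
  finally show ?thesis by algebra
qed

lemma base_minor:
  "det (\<chi> l c. \<Sum>i\<in>UNIV. base_form l (base_columns c) i * x i) = x 0 * base_quartic x"
proof -
  have "det (\<chi> l c. \<Sum>i\<in>UNIV. base_form l (base_columns c) i * x i) =
    partial_det {0, 1, 2, 3, 4} (\<lambda>l c. first_value x l * second_factor l (base_columns c) - second_value x l * first_factor l (base_columns c))"
    by (simp add: det_eq_partial_det base_form_apply UNIV_5)
  also have "\<dots> = x 0 * base_quartic x"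
    unfolding base_quartic_def
    by (rule partial_det_sparse) (simp_all add: base_columns_def first_value_def second_value_def
        first_factor_def second_factor_def)
  finally show ?thesis .
qed

text \<open>For \<open>x 0 = 1\<close> and small \<open>r\<close> the linear factors can be cancelled, so \<open>r \<mapsto> G(x + r b)\<close> is constant
  near zero, where \<open>G\<close> is the quartic. Its derivative at zero is a linear form in \<open>b\<close>, and six
  choices of \<open>x\<close> give six independent linear forms. Derivatives are replaced by the five-point
  formula \<open>12 e g'(0) = 8 (g(e) - g(-e)) - (g(2 e) - g(-2 e))\<close>, which is exact for polynomials \<open>g\<close>
  of degree four.\<close>

theorem base_quartic_not_cone:
  assumes "\<And>x r. x 0 * (x 0 + r * b 0) * base_quartic (\<lambda>i. x i + r * b i) = (x 0 + r * b 0) * (x 0 * base_quartic x)"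
  shows "b i = 0"
proof -
  \<comment> \<open>A step so small that \<open>1 + r b\<^sub>0\<close> does not vanish for \<open>r = \<plusminus> e\<close> and \<open>r = \<plusminus> 2 e\<close>.\<close>
  define e :: complex where "e = of_real (1 / (4 * (1 + norm (b 0))))"
  have pos: "4 * (1 + norm (b 0)) > 0" by (smt (verit) norm_ge_zero)
  have e: "e \<noteq> 0" using pos unfolding e_def by (simp del: of_real_divide)
  have ne: "norm e = 1 / (4 * (1 + norm (b 0)))" unfolding e_def norm_of_real using pos by simp
  have small: "1 + r * b 0 \<noteq> 0" if "norm r \<le> 2 * norm e" for r
  proof
    assume "1 + r * b 0 = 0"
    then have "norm (r * b 0) = 1" by (metis add_eq_0_iff norm_minus_cancel norm_one)
    moreover have "norm (r * b 0) \<le> 2 * norm e * norm (b 0)"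
      unfolding norm_mult using that by (intro mult_right_mono) auto
    moreover have "2 * norm e * norm (b 0) < 1"
    proof -
      have "2 * norm (b 0) < 4 * (1 + norm (b 0))" by (smt (verit) norm_ge_zero)
      then have "2 * norm (b 0) / (4 * (1 + norm (b 0))) < 1" using pos by (simp only: divide_less_eq_1_pos)
      then show ?thesis unfolding ne by simp
    qed
    ultimately show False by simp
  qed
  have inv: "base_quartic (\<lambda>i. x i + r * b i) = base_quartic x" if "x 0 = 1" "norm r \<le> 2 * norm e" for x r
    using assms[of x r] small[OF that(2)] that(1) by simp
  have first_order: "y = 0"
    if x0: "x 0 = 1"
      and y: "8 * (base_quartic (\<lambda>i. x i + e * b i) - base_quartic (\<lambda>i. x i + - e * b i)) -
        (base_quartic (\<lambda>i. x i + 2 * e * b i) - base_quartic (\<lambda>i. x i + - 2 * e * b i)) = 12 * e * y" for x y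
  proof -
    have "base_quartic (\<lambda>i. x i + e * b i) = base_quartic x" "base_quartic (\<lambda>i. x i + - e * b i) = base_quartic x"
      "base_quartic (\<lambda>i. x i + 2 * e * b i) = base_quartic x" "base_quartic (\<lambda>i. x i + - 2 * e * b i) = base_quartic x"
      by (rule inv[where x = x, OF x0]; simp add: norm_mult)+
    then have "12 * e * y = 0" using y by (simp only: diff_self mult_zero_right)
    then show ?thesis using e by simp
  qed
  have 1: "2 * b 1 + (-3) * b 4 = 0"
    by (rule first_order[of "v6 1 0 0 0 0 1"], simp) (unfold base_quartic_def v6_simps, algebra)
  have 2: "2 * b 1 + 3 * b 4 = 0"
    by (rule first_order[of "v6 1 0 0 0 0 (-1)"], simp) (unfold base_quartic_def v6_simps, algebra)
  have 3: "(-2) * b 2 + (-3) * b 5 = 0"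
    by (rule first_order[of "v6 1 0 0 0 1 0"], simp) (unfold base_quartic_def v6_simps, algebra)
  have 4: "(-2) * b 2 + 3 * b 5 = 0"
    by (rule first_order[of "v6 1 0 0 0 (-1) 0"], simp) (unfold base_quartic_def v6_simps, algebra)
  have 5: "(-6) * b 0 + b 1 + (-7) * b 2 + (-3) * b 4 + (-3) * b 5 = 0"
    by (rule first_order[of "v6 1 0 0 0 1 1"], simp) (unfold base_quartic_def v6_simps, algebra)
  have 6: "(-2) * b 0 + (-2) * b 2 + 2 * b 3 + (-4) * b 4 + (-8) * b 5 = 0"
    by (rule first_order[of "v6 1 0 1 0 1 0"], simp) (unfold base_quartic_def v6_simps, algebra)
  have "b 0 = 0 \<and> b 1 = 0 \<and> b 2 = 0 \<and> b 3 = 0 \<and> b 4 = 0 \<and> b 5 = 0"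
    using 1 2 3 4 5 6 by (intro conjI; algebra)
  then have "\<forall>i. b i = 0" unfolding all6 by simp
  then show ?thesis ..
qed

section \<open>Two properties of a frame\<close>

text \<open>A frame is given by an arbitrary array \<open>s\<close>, which is antisymmetrized to get five alternating
  forms. In this way the frames form an affine space, as elimination of quantifiers requires.\<close>

definition entry :: "(5 \<times> 6 \<times> 6 \<Rightarrow> complex) \<Rightarrow> 5 \<Rightarrow> 6 \<Rightarrow> 6 \<Rightarrow> complex" where
  "entry s l j i = s (l, i, j) - s (l, j, i)"

definition in_pencil_kernel :: "(5 \<times> 6 \<times> 6 \<Rightarrow> complex) \<Rightarrow> (6 \<Rightarrow> complex) \<Rightarrow> (5 \<Rightarrow> complex) \<Rightarrow> (5 \<Rightarrow> complex) \<Rightarrow> bool" where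
  "in_pencil_kernel s x c d \<longleftrightarrow> (\<exists>l m. c l * d m - c m * d l \<noteq> 0) \<and>
     (\<forall>j. (\<Sum>l\<in>UNIV. \<Sum>i\<in>UNIV. c l * entry s l j i * x i) = 0) \<and>
     (\<forall>j. (\<Sum>l\<in>UNIV. \<Sum>i\<in>UNIV. d l * entry s l j i * x i) = 0)"

definition cubic_vanishes :: "(5 \<times> 6 \<times> 6 \<Rightarrow> complex) \<Rightarrow> (6 \<times> 6 \<times> 6 \<Rightarrow> complex) \<Rightarrow> bool" where
  "cubic_vanishes s a \<longleftrightarrow> (\<forall>x c d. in_pencil_kernel s x c d \<longrightarrow> cubic a x = 0)"

text \<open>The six-dimensional upper bound as a statement about points: a cubic that vanishes where a pencil
  of forms vanishes is determined by its coefficients at \<open>free_triples\<close>. All quantifiers range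
  over complex numbers.\<close>

definition determines_cubics :: "(5 \<times> 6 \<times> 6 \<Rightarrow> complex) \<Rightarrow> bool" where
  "determines_cubics s \<longleftrightarrow>
     (\<forall>a. (\<forall>t. t \<notin> sorted_triples - free_triples \<longrightarrow> a t = 0) \<longrightarrow> cubic_vanishes s a \<longrightarrow> (\<forall>t. a t = 0))"

definition point_minor :: "(5 \<times> 6 \<times> 6 \<Rightarrow> complex) \<Rightarrow> (6 \<Rightarrow> complex) \<Rightarrow> complex" where
  "point_minor s x = det (\<chi> l c. \<Sum>i\<in>UNIV. entry s l (base_columns c) i * x i)"

text \<open>The minor \<open>point_minor s\<close> is \<open>x\<^sub>0 F\<close> with the quartic \<open>F\<close>, so the condition says that \<open>F\<close> is
  invariant under translation by multiples of \<open>b\<close>, i.e. that \<open>F\<close> defines a cone with vertex \<open>b\<close>.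
  It is stated for the minor because that is visibly polynomial in \<open>s\<close>.\<close>

definition vertex :: "(5 \<times> 6 \<times> 6 \<Rightarrow> complex) \<Rightarrow> (6 \<Rightarrow> complex) \<Rightarrow> bool" where
  "vertex s b \<longleftrightarrow> (\<forall>x r. x 0 * point_minor s (\<lambda>i. x i + r * b i) = (x 0 + r * b 0) * point_minor s x)"

definition not_cone :: "(5 \<times> 6 \<times> 6 \<Rightarrow> complex) \<Rightarrow> bool" where
  "not_cone s \<longleftrightarrow> (\<forall>b. vertex s b \<longrightarrow> (\<forall>i. b i = 0))"

section \<open>Constructibility of the two properties\<close>

lemma polyfun_if: "p \<in> polyfun \<Longrightarrow> q \<in> polyfun \<Longrightarrow> (\<lambda>s. if C then p s else q s) \<in> polyfun"
  by (cases C) simp_all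

lemma polyfun_cubic:
  assumes "\<And>t. (\<lambda>s. f s t) \<in> polyfun" "\<And>i. (\<lambda>s. g s i) \<in> polyfun"
  shows "(\<lambda>s. cubic (f s) (g s)) \<in> polyfun"
  unfolding cubic_expand
  by (intro polyfun_sum polyfun_if polyfun_mult assms polyfun_const)

lemma polyfun_det:
  fixes f :: "('v \<Rightarrow> complex) \<Rightarrow> 'n::finite \<Rightarrow> 'n \<Rightarrow> complex"
  assumes "\<And>i j. (\<lambda>s. f s i j) \<in> polyfun"
  shows "(\<lambda>s. det (\<chi> i j. f s i j)) \<in> polyfun"
  unfolding det_def vec_lambda_beta
  by (intro polyfun_sum polyfun_mult polyfun_const polyfun_prod assms)

lemma constructible_all:
  "(\<And>i. {s. P s i} \<in> constructible) \<Longrightarrow> {s. \<forall>i::'k::finite. P s i} \<in> constructible"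
  using constructible_INT[of UNIV "\<lambda>i. {s. P s i}"] by (simp add: Collect_all_eq)

lemma constructible_ex:
  "(\<And>i. {s. P s i} \<in> constructible) \<Longrightarrow> {s. \<exists>i::'k::finite. P s i} \<in> constructible"
  using constructible_UN[of UNIV "\<lambda>i. {s. P s i}"] by (simp add: Collect_ex_eq)

lemma constructible_conj:
  "{s. P s} \<in> constructible \<Longrightarrow> {s. Q s} \<in> constructible \<Longrightarrow> {s. P s \<and> Q s} \<in> constructible"
  using constructible_Int by (simp add: Collect_conj_eq)

lemma constructible_not: "{s. P s} \<in> constructible \<Longrightarrow> {s. \<not> P s} \<in> constructible"
  using constructible_Compl by (simp add: Collect_neg_eq)

lemma constructible_imp:
  "{s. P s} \<in> constructible \<Longrightarrow> {s. Q s} \<in> constructible \<Longrightarrow> {s. P s \<longrightarrow> Q s} \<in> constructible"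
  using constructible_not[OF constructible_conj[OF _ constructible_not]] by simp

lemma constructible_const: "{s. C} \<in> constructible"
  using constructible_UNIV constructible_empty by (cases C) simp_all

lemma constructible_all_fun:
  fixes P :: "('v \<Rightarrow> complex) \<Rightarrow> ('k::finite \<Rightarrow> complex) \<Rightarrow> bool"
  assumes "{\<sigma>. P (\<lambda>v. \<sigma> (Inl v)) (\<lambda>k. \<sigma> (Inr k))} \<in> constructible"
  shows "{s. \<forall>z. P s z} \<in> constructible"
proof -
  have "{s. \<exists>z. case_sum s z \<in> {\<sigma>. \<not> P (\<lambda>v. \<sigma> (Inl v)) (\<lambda>k. \<sigma> (Inr k))}} \<in> constructible"
    by (intro constructible_project constructible_not assms)
  then have "{s. \<exists>z. \<not> P s z} \<in> constructible" by simp
  from constructible_not[OF this] show ?thesis by simp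
qed

lemma constructible_cubic_vanishes:
  "{\<tau> :: (5 \<times> 6 \<times> 6) + (6 \<times> 6 \<times> 6) \<Rightarrow> complex. cubic_vanishes (\<lambda>v. \<tau> (Inl v)) (\<lambda>t. \<tau> (Inr t))} \<in> constructible"
  unfolding cubic_vanishes_def in_pencil_kernel_def entry_def
  by (intro constructible_all_fun constructible_imp constructible_conj constructible_ex constructible_all
      constructible_not constructible_zeros polyfun_sum polyfun_mult polyfun_diff polyfun_coord polyfun_cubic)

lemma constructible_determines_cubics: "{s. determines_cubics s} \<in> constructible"
  unfolding determines_cubics_def
  by (intro constructible_all_fun constructible_imp constructible_all constructible_const
      constructible_zeros polyfun_coord constructible_cubic_vanishes)

lemma polyfun_point_minor:
  assumes "\<And>v. (\<lambda>s. f s v) \<in> polyfun" "\<And>i. (\<lambda>s. g s i) \<in> polyfun"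
  shows "(\<lambda>s. point_minor (f s) (g s)) \<in> polyfun"
  unfolding point_minor_def entry_def
  by (intro polyfun_det polyfun_sum polyfun_mult polyfun_diff assms)

text \<open>Presents a single number as a tuple, the kind of variable over which \<open>constructible_all_fun\<close>
  quantifies.\<close>

lemma all_scalar: "(\<forall>r. P r) \<longleftrightarrow> (\<forall>z :: unit \<Rightarrow> complex. P (z ()))"
proof (intro iffI allI)
  fix r assume "\<forall>z :: unit \<Rightarrow> complex. P (z ())"
  from this[rule_format, of "\<lambda>_. r"] show "P r" .
qed simp

lemma constructible_not_cone: "{s. not_cone s} \<in> constructible"
proof -
  have "vertex s b \<longleftrightarrow> (\<forall>x. \<forall>z :: unit \<Rightarrow> complex.
      x 0 * point_minor s (\<lambda>i. x i + z () * b i) - (x 0 + z () * b 0) * point_minor s x = 0)" for s b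
    unfolding vertex_def all_scalar[of "\<lambda>r. _ r"] by simp
  then show ?thesis
    unfolding not_cone_def
    by (simp only:) (intro constructible_all_fun constructible_imp constructible_all
      constructible_zeros polyfun_coord polyfun_diff polyfun_mult polyfun_add polyfun_point_minor)
qed

section \<open>The two properties near the decomposable frame\<close>

definition base_frame :: "5 \<times> 6 \<times> 6 \<Rightarrow> complex" where
  "base_frame = (\<lambda>(l, i, j). first_factor l i * second_factor l j)"

lemma entry_base_frame: "entry base_frame l j i = base_form l j i"
  by (simp add: entry_def base_frame_def base_form_def mult.commute)

lemma entry_perturbed:
  "entry (\<lambda>v. base_frame v + of_real t * b v) l j i = base_form l j i + of_real t * entry b l j i"
  unfolding entry_base_frame[symmetric] by (simp add: entry_def algebra_simps)

lemma dist_Pair_le: "dist (a, b) (c, d) \<le> dist a c + dist b d"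
  by (simp add: dist_Pair_Pair sqrt_sum_squares_le_sum)

lemma cubic_scale: "cubic (\<lambda>t. k * a t) x = k * cubic a x"
  by (simp add: cubic_def sum_distrib_left case_prod_unfold mult.assoc)

lemma failing_sequence:
  assumes "\<not> (\<exists>\<epsilon>>0. \<forall>t::real. 0 < t \<and> t < \<epsilon> \<longrightarrow> P t)"
  obtains t :: "nat \<Rightarrow> real" where "\<And>n. 0 < t n" "t \<longlonglongrightarrow> 0" "\<And>n. \<not> P (t n)"
proof -
  have "\<exists>t. 0 < t \<and> t < inverse (real (Suc n)) \<and> \<not> P t" for n
    using assms by (auto dest: spec[of _ "inverse (real (Suc n))"])
  then obtain t where t: "\<And>n. 0 < t n" "\<And>n. t n < inverse (real (Suc n))" "\<And>n. \<not> P (t n)" by metis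
  have "t \<longlonglongrightarrow> 0"
    by (rule tendsto_sandwich[OF _ _ tendsto_const LIMSEQ_inverse_real_of_nat])
      (use t in \<open>auto intro!: always_eventually less_imp_le\<close>)
  with t show thesis using that by blast
qed

text \<open>Rescaling non-zero vectors to the compact unit sphere produces a non-zero limit.\<close>

lemma limit_of_unit_vectors:
  fixes a :: "nat \<Rightarrow> 'k::finite \<Rightarrow> complex"
  assumes "\<And>n. \<exists>k. a n k \<noteq> 0"
  obtains r :: "nat \<Rightarrow> nat" and c :: "nat \<Rightarrow> complex" and l :: "'k \<Rightarrow> complex"
  where "strict_mono r" "\<And>k. (\<lambda>n. c (r n) * a (r n) k) \<longlonglongrightarrow> l k" "\<exists>k. l k \<noteq> 0"
proof -
  define v where "v n = (\<chi> k. a n k)" for n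
  define u where "u n = (1 / norm (v n)) *\<^sub>R v n" for n
  have v: "v n \<noteq> 0" for n using assms[of n] by (auto simp: v_def vec_eq_iff)
  then have "u n \<in> sphere 0 1" for n by (simp add: u_def)
  then obtain L r where Lr: "L \<in> sphere (0 :: complex^'k) 1" "strict_mono r" "(u \<circ> r) \<longlonglongrightarrow> L"
    using compact_sphere[of "0 :: complex^'k" 1] unfolding compact_def by metis
  show thesis
  proof (rule that[of r "\<lambda>n. of_real (1 / norm (v n))" "\<lambda>k. L $ k"])
    show "strict_mono r" by (rule Lr(2))
    show "(\<lambda>n. of_real (1 / norm (v (r n))) * a (r n) k) \<longlonglongrightarrow> L $ k" for k
    proof -
      have "(\<lambda>n. (u \<circ> r) n $ k) \<longlonglongrightarrow> L $ k" by (intro tendsto_vec_nth Lr(3))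
      moreover have "(u \<circ> r) n $ k = of_real (1 / norm (v (r n))) * a (r n) k" for n
        by (simp only: u_def v_def o_def vector_scaleR_component vec_lambda_beta scaleR_conv_of_real[where 'a = complex])
      ultimately show ?thesis by (simp only:)
    qed
    have "L \<noteq> 0" using Lr(1) by auto
    then show "\<exists>k. L $ k \<noteq> 0" by (auto simp: vec_eq_iff)
  qed
qed

lemma vec_nth_vec_lambda: "($) (vec_lambda g) = g"
  by (simp add: fun_eq_iff)

text \<open>Near \<open>x\<close> there is a point at which a pencil of forms of the perturbed frame vanishes, by
  \<open>pencil_deforms\<close>. That the pencil is spanned by independent vectors and that the cubic does not
  vanish are open conditions on the point, the pencil and the coefficients.\<close>

lemma smooth_point_persists:
  fixes b :: "5 \<times> 6 \<times> 6 \<Rightarrow> complex"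
  assumes x: "smooth_point x" and ne: "cubic a x \<noteq> 0"
    and t: "\<And>n. 0 < t n" "t \<longlonglongrightarrow> 0" and a: "\<And>k. (\<lambda>n. \<alpha> n k) \<longlonglongrightarrow> a k"
  shows "\<exists>n. \<exists>y c d. in_pencil_kernel (\<lambda>v. base_frame v + of_real (t n) * b v) y c d \<and> cubic (\<alpha> n) y \<noteq> 0"
proof -
  obtain i0 c d where *: "x i0 \<noteq> 0" "\<exists>l m. c $ l * d $ m \<noteq> c $ m * d $ l"
    "\<And>j. (\<Sum>l\<in>UNIV. \<Sum>i\<in>UNIV. c $ l * base_form l j i * (\<chi> i. x i) $ i) = 0"
    "\<And>j. (\<Sum>l\<in>UNIV. \<Sum>i\<in>UNIV. d $ l * base_form l j i * (\<chi> i. x i) $ i) = 0"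
    "transversal_pencil base_form (\<chi> i. x i) i0 c d"
    by (rule smooth_point_pencil[OF x]) (rule that)
  obtain l m where lm: "c $ l * d $ m \<noteq> c $ m * d $ l" using *(2) by blast
  define f where "f = (\<lambda>(A :: complex^(6 \<times> 6 \<times> 6), X :: complex^6, C :: complex^5, D :: complex^5).
    cubic (\<lambda>k. A $ k) (\<lambda>i. X $ i) * (C $ l * D $ m - C $ m * D $ l))"
  define p where "p = (\<chi> k. a k, \<chi> i. x i, c, d)"
  have cont: "continuous_on UNIV f"
    unfolding f_def case_prod_unfold cubic_def
    by (intro continuous_intros)
  have "f p \<noteq> 0" using ne lm by (simp add: f_def p_def vec_nth_vec_lambda)
  moreover have "open (f -` (- {0}))"
    using cont by (intro open_vimage) auto
  ultimately obtain \<eta> where \<eta>: "\<eta> > 0" "ball p \<eta> \<subseteq> f -` (- {0})"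
    by (metis ComplI open_contains_ball singletonD vimage_eq)
  have "\<exists>\<delta>>0. \<forall>t. 0 < t \<and> t < \<delta> \<longrightarrow> (\<exists>X C D. dist X (\<chi> i. x i) < \<eta> / 4 \<and> dist C c < \<eta> / 4 \<and> dist D d < \<eta> / 4 \<and>
    (\<forall>j. (\<Sum>l\<in>UNIV. \<Sum>i\<in>UNIV. C $ l * (base_form l j i + of_real t * entry b l j i) * X $ i) = 0) \<and>
    (\<forall>j. (\<Sum>l\<in>UNIV. \<Sum>i\<in>UNIV. D $ l * (base_form l j i + of_real t * entry b l j i) * X $ i) = 0))"
  proof (rule pencil_deforms[where ?i0.0 = i0])
    show "base_form l j i = - base_form l i j" for l i j by (rule base_form_skew)
    show "entry b l j i = - entry b l i j" for l i j by (simp add: entry_def)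
    show "(\<chi> i. x i) $ i0 \<noteq> 0" using *(1) by simp
    show "0 < \<eta> / 4" using \<eta>(1) by simp
  qed (rule *(3-5))+
  then obtain \<delta> where \<delta>: "\<delta> > 0" "\<And>t. 0 < t \<Longrightarrow> t < \<delta> \<Longrightarrow> (\<exists>X C D. dist X (\<chi> i. x i) < \<eta> / 4 \<and> dist C c < \<eta> / 4 \<and> dist D d < \<eta> / 4 \<and>
    (\<forall>j. (\<Sum>l\<in>UNIV. \<Sum>i\<in>UNIV. C $ l * (base_form l j i + of_real t * entry b l j i) * X $ i) = 0) \<and>
    (\<forall>j. (\<Sum>l\<in>UNIV. \<Sum>i\<in>UNIV. D $ l * (base_form l j i + of_real t * entry b l j i) * X $ i) = 0))"
    by blast
  have "(\<lambda>n. \<chi> k. \<alpha> n k) \<longlonglongrightarrow> (\<chi> k. a k)"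
    by (rule vec_tendstoI) (simp add: a)
  then have "\<forall>\<^sub>F n in sequentially. dist (\<chi> k. \<alpha> n k) (\<chi> k. a k) < \<eta> / 4"
    using \<eta>(1) by (intro tendstoD) auto
  moreover have "\<forall>\<^sub>F n in sequentially. t n < \<delta>"
    using t(2) \<delta>(1) by (rule order_tendstoD)
  ultimately have "\<forall>\<^sub>F n in sequentially. dist (\<chi> k. \<alpha> n k) (\<chi> k. a k) < \<eta> / 4 \<and> t n < \<delta>"
    by (rule eventually_conj)
  then obtain n where n: "dist (\<chi> k. \<alpha> n k) (\<chi> k. a k) < \<eta> / 4" "t n < \<delta>"
    by (metis (mono_tags, lifting) eventually_sequentially le_refl)
  obtain X C D where X: "dist X (\<chi> i. x i) < \<eta> / 4" "dist C c < \<eta> / 4" "dist D d < \<eta> / 4"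
    "\<And>j. (\<Sum>l\<in>UNIV. \<Sum>i\<in>UNIV. C $ l * (base_form l j i + of_real (t n) * entry b l j i) * X $ i) = 0"
    "\<And>j. (\<Sum>l\<in>UNIV. \<Sum>i\<in>UNIV. D $ l * (base_form l j i + of_real (t n) * entry b l j i) * X $ i) = 0"
    using \<delta>(2)[OF t(1) n(2)] by blast
  have "dist (\<chi> k. \<alpha> n k, X, C, D) p \<le> dist (\<chi> k. \<alpha> n k) (\<chi> k. a k) + (dist X (\<chi> i. x i) + (dist C c + dist D d))"
    unfolding p_def by (intro order_trans[OF dist_Pair_le] add_left_mono dist_Pair_le)
  also have "\<dots> < \<eta>" using n(1) X(1-3) by linarith
  finally have "f (\<chi> k. \<alpha> n k, X, C, D) \<noteq> 0" using \<eta>(2) by (auto simp: dist_commute)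
  then have "cubic (\<alpha> n) (\<lambda>i. X $ i) \<noteq> 0" "C $ l * D $ m - C $ m * D $ l \<noteq> 0"
    by (auto simp: f_def vec_nth_vec_lambda)
  moreover have "in_pencil_kernel (\<lambda>v. base_frame v + of_real (t n) * b v) (\<lambda>i. X $ i) (\<lambda>l. C $ l) (\<lambda>l. D $ l)"
    unfolding in_pencil_kernel_def entry_perturbed using X(4,5) calculation(2) by blast
  ultimately show ?thesis by blast
qed

text \<open>Otherwise there are non-zero cubics violating the property for a sequence of parameters that tends
  to zero. After rescaling they converge to a non-zero cubic, which vanishes at every smooth point
  by \<open>smooth_point_persists\<close>, contrary to \<open>cubic_vanishing_on_smooth_points\<close>. Only smooth points
  may be used here: the base frame also has pencils vanishing at all points of two planes, and
  such points need not survive a perturbation.\<close>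

lemma determines_cubics_near_base:
  "\<exists>\<epsilon>>0. \<forall>t::real. 0 < t \<and> t < \<epsilon> \<longrightarrow> determines_cubics (\<lambda>v. base_frame v + of_real t * b v)"
proof (rule ccontr)
  assume "\<not> ?thesis"
  then obtain t :: "nat \<Rightarrow> real" where t: "\<And>n. 0 < t n" "t \<longlonglongrightarrow> 0"
    "\<And>n. \<not> determines_cubics (\<lambda>v. base_frame v + of_real (t n) * b v)"
    by (rule failing_sequence) blast
  then have "\<exists>a. (\<forall>k. k \<notin> sorted_triples - free_triples \<longrightarrow> a k = 0) \<and>
      cubic_vanishes (\<lambda>v. base_frame v + of_real (t n) * b v) a \<and> (\<exists>k. a k \<noteq> 0)" for n
    unfolding determines_cubics_def by blast
  then obtain a where a: "\<And>n k. k \<notin> sorted_triples - free_triples \<Longrightarrow> a n k = 0"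
      "\<And>n. cubic_vanishes (\<lambda>v. base_frame v + of_real (t n) * b v) (a n)" "\<And>n. \<exists>k. a n k \<noteq> 0"
    by metis
  obtain r c l where r: "strict_mono r" "\<And>k. (\<lambda>n. c (r n) * a (r n) k) \<longlonglongrightarrow> l k" "\<exists>k. l k \<noteq> 0"
    by (rule limit_of_unit_vectors[of a, OF a(3)]) (rule that)
  have tr: "(\<lambda>n. t (r n)) \<longlonglongrightarrow> 0" using LIMSEQ_subseq_LIMSEQ[OF t(2) r(1)] by (simp add: o_def)
  have "cubic l x = 0" if "smooth_point x" for x
  proof (rule ccontr)
    assume "cubic l x \<noteq> 0"
    from smooth_point_persists[OF that this t(1) tr r(2)]
    obtain n y c' d' where n: "in_pencil_kernel (\<lambda>v. base_frame v + of_real (t (r n)) * b v) y c' d'"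
      "cubic (\<lambda>k. c (r n) * a (r n) k) y \<noteq> 0" by blast
    then show False using a(2)[of "r n"] unfolding cubic_vanishes_def cubic_scale by auto
  qed
  then have "l k = 0" if "k \<in> sorted_triples - free_triples" for k
    using cubic_vanishing_on_smooth_points that by blast
  moreover have "l k = 0" if "k \<notin> sorted_triples - free_triples" for k
    using r(2)[of k] a(1)[OF that] by (simp add: LIMSEQ_const_iff)
  ultimately show False using r(3) by blast
qed

lemma vertex_scale: "vertex s b \<Longrightarrow> vertex s (\<lambda>i. k * b i)"
  unfolding vertex_def
proof (intro allI)
  fix x :: "6 \<Rightarrow> complex" and r
  assume "\<forall>x r. x 0 * point_minor s (\<lambda>i. x i + r * b i) = (x 0 + r * b 0) * point_minor s x"
  from this[rule_format, of x "r * k"]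
  show "x 0 * point_minor s (\<lambda>i. x i + r * (k * b i)) = (x 0 + r * (k * b 0)) * point_minor s x"
    by (simp only: mult.assoc)
qed

lemma tendsto_point_minor:
  assumes "\<And>v. (\<lambda>n. s n v) \<longlonglongrightarrow> s' v" "\<And>i. (\<lambda>n. x n i) \<longlonglongrightarrow> x' i"
  shows "(\<lambda>n. point_minor (s n) (x n)) \<longlonglongrightarrow> point_minor s' x'"
  unfolding point_minor_def det_def vec_lambda_beta entry_def
  by (intro tendsto_sum tendsto_mult tendsto_const tendsto_prod tendsto_diff assms)

text \<open>Being a vertex is a closed condition, so a limit of rescaled vertices is a vertex for the base
  frame.\<close>

lemma not_cone_near_base:
  "\<exists>\<epsilon>>0. \<forall>t::real. 0 < t \<and> t < \<epsilon> \<longrightarrow> not_cone (\<lambda>v. base_frame v + of_real t * b v)"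
proof (rule ccontr)
  assume "\<not> ?thesis"
  then obtain t :: "nat \<Rightarrow> real" where t: "\<And>n. 0 < t n" "t \<longlonglongrightarrow> 0"
    "\<And>n. \<not> not_cone (\<lambda>v. base_frame v + of_real (t n) * b v)"
    by (rule failing_sequence) blast
  then have "\<exists>u. vertex (\<lambda>v. base_frame v + of_real (t n) * b v) u \<and> (\<exists>i. u i \<noteq> 0)" for n
    unfolding not_cone_def by blast
  then obtain u where u: "\<And>n. vertex (\<lambda>v. base_frame v + of_real (t n) * b v) (u n)" "\<And>n. \<exists>i. u n i \<noteq> 0"
    by metis
  obtain r c l where r: "strict_mono r" "\<And>k. (\<lambda>n. c (r n) * u (r n) k) \<longlonglongrightarrow> l k" "\<exists>k. l k \<noteq> 0"
    by (rule limit_of_unit_vectors[of u, OF u(2)]) (rule that)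
  have tr: "(\<lambda>n. t (r n)) \<longlonglongrightarrow> 0" using LIMSEQ_subseq_LIMSEQ[OF t(2) r(1)] by (simp add: o_def)
  have s: "(\<lambda>n. base_frame v + of_real (t (r n)) * b v) \<longlonglongrightarrow> base_frame v" for v
    using tendsto_add[OF tendsto_const tendsto_mult_right[OF tendsto_of_real[OF tr]], of "base_frame v" "b v"] by simp
  have base: "point_minor base_frame x = x 0 * base_quartic x" for x
    unfolding point_minor_def entry_base_frame by (rule base_minor)
  have "vertex base_frame l"
    unfolding vertex_def
  proof (intro allI)
    fix x :: "6 \<Rightarrow> complex" and q
    have e: "x 0 * point_minor (\<lambda>v. base_frame v + of_real (t (r n)) * b v) (\<lambda>i. x i + q * (c (r n) * u (r n) i)) =
        (x 0 + q * (c (r n) * u (r n) 0)) * point_minor (\<lambda>v. base_frame v + of_real (t (r n)) * b v) x" for n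
      using vertex_scale[OF u(1)] unfolding vertex_def by blast
    have "(\<lambda>n. x 0 * point_minor (\<lambda>v. base_frame v + of_real (t (r n)) * b v) (\<lambda>i. x i + q * (c (r n) * u (r n) i)))
        \<longlonglongrightarrow> x 0 * point_minor base_frame (\<lambda>i. x i + q * l i)"
      by (intro tendsto_mult tendsto_const tendsto_point_minor s tendsto_add r(2))
    moreover have "(\<lambda>n. (x 0 + q * (c (r n) * u (r n) 0)) * point_minor (\<lambda>v. base_frame v + of_real (t (r n)) * b v) x)
        \<longlonglongrightarrow> (x 0 + q * l 0) * point_minor base_frame x"
      by (intro tendsto_mult tendsto_const tendsto_point_minor s tendsto_add r(2))
    ultimately show "x 0 * point_minor base_frame (\<lambda>i. x i + q * l i) = (x 0 + q * l 0) * point_minor base_frame x"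
      unfolding e by (rule LIMSEQ_unique)
  qed
  then have "x 0 * (x 0 + q * l 0) * base_quartic (\<lambda>i. x i + q * l i) = (x 0 + q * l 0) * (x 0 * base_quartic x)" for x q
    unfolding vertex_def base by (simp only: mult.assoc)
  then have "l i = 0" for i by (rule base_quartic_not_cone)
  then show False using r(3) by blast
qed

theorem generic_frame:
  "\<exists>h\<in>polyfun. (\<exists>s. h s \<noteq> 0) \<and> (\<forall>s. h s \<noteq> 0 \<longrightarrow> determines_cubics s \<and> not_cone s)"
proof -
  obtain h where h: "h \<in> polyfun" "\<exists>s. h s \<noteq> 0" "\<forall>s. h s \<noteq> 0 \<longrightarrow> determines_cubics s"
    using constructible_generic[OF constructible_determines_cubics, of base_frame] determines_cubics_near_base by auto
  obtain g where g: "g \<in> polyfun" "\<exists>s. g s \<noteq> 0" "\<forall>s. g s \<noteq> 0 \<longrightarrow> not_cone s"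
    using constructible_generic[OF constructible_not_cone, of base_frame] not_cone_near_base by auto
  have "(\<lambda>s. h s * g s) \<in> polyfun" using h(1) g(1) by (rule polyfun_mult)
  moreover have "\<exists>s. h s * g s \<noteq> 0" using h(1,2) g(1,2) polyfun_mult_nonzero by blast
  ultimately show ?thesis using h(3) g(3) by (intro bexI[of _ "\<lambda>s. h s * g s"]) auto
qed

section \<open>Partial derivatives in the ideal of the singular curve\<close>

lemma pderivative_prod:
  "finite I \<Longrightarrow> pderivative i (\<Prod>r\<in>I. f r) = (\<Sum>a\<in>I. \<Prod>r\<in>I. if r = a then pderivative i (f r) else f r)"
proof (induction I rule: finite_induct)
  case (insert b I)
  have 1: "(\<Prod>r\<in>I. if r = b then pderivative i (f r) else f r) = (\<Prod>r\<in>I. f r)"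
    using insert.hyps by (intro prod.cong) auto
  have 2: "(\<Sum>a\<in>I. (if b = a then pderivative i (f b) else f b) * (\<Prod>r\<in>I. if r = a then pderivative i (f r) else f r)) =
      f b * (\<Sum>a\<in>I. \<Prod>r\<in>I. if r = a then pderivative i (f r) else f r)"
    unfolding sum_distrib_left using insert.hyps by (intro sum.cong) auto
  show ?case using insert by (simp add: pderivative_mult 1 2)
qed simp

lemma pderivative_det:
  fixes M :: "'n::finite \<Rightarrow> 'n \<Rightarrow> 'i cpoly"
  shows "pderivative i (det (\<chi> r c. M r c)) = (\<Sum>a\<in>UNIV. det (\<chi> r c. if r = a then pderivative i (M r c) else M r c))"
proof -
  have s: "pderivative i (of_int (sign p) * q) = of_int (sign p) * pderivative i q" for p :: "'n \<Rightarrow> 'n" and q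
    by (cases p rule: sign_cases) (simp_all add: pderivative_uminus)
  have "pderivative i (det (\<chi> r c. M r c)) =
      (\<Sum>p | p permutes (UNIV :: 'n set). \<Sum>a\<in>UNIV. of_int (sign p) * (\<Prod>r\<in>UNIV. if r = a then pderivative i (M r (p r)) else M r (p r)))"
    unfolding det_def vec_lambda_beta pderivative_sum s by (simp only: pderivative_prod[OF finite] sum_distrib_left)
  also have "\<dots> = (\<Sum>a\<in>UNIV. det (\<chi> r c. if r = a then pderivative i (M r c) else M r c))"
    unfolding det_def vec_lambda_beta by (rule sum.swap)
  finally show ?thesis .
qed

lemma injection_missing: "\<exists>f :: 4 \<Rightarrow> 5. inj f \<and> range f = UNIV - {a}"
proof -
  have "card (UNIV :: 4 set) = card (UNIV - {a} :: 5 set)" by simp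
  then obtain f where "bij_betw f (UNIV :: 4 set) (UNIV - {a} :: 5 set)"
    using finite_same_card_bij[of "UNIV :: 4 set" "UNIV - {a}"] by auto
  then show ?thesis by (auto simp: bij_betw_def)
qed

lemma columns_missing: "\<exists>j :: 5 \<Rightarrow> 6. inj j \<and> i \<notin> range j"
proof -
  have "card (UNIV :: 5 set) = card (UNIV - {i} :: 6 set)" by simp
  then obtain f where "bij_betw f (UNIV :: 5 set) (UNIV - {i} :: 6 set)"
    using finite_same_card_bij[of "UNIV :: 5 set" "UNIV - {i}"] by auto
  then show ?thesis by (auto simp: bij_betw_def)
qed

lemma minor_in_chart_minors:
  fixes u :: "'m::finite \<Rightarrow> complex ^ (6 \<times> 6)"
  assumes "range u \<subseteq> U" "i \<notin> range j"
  shows "minor u j \<in> chart_minors TYPE('m) U i"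
  unfolding chart_minors_eq
  by (rule CollectI, rule exI[of _ u], rule exI[of _ j], intro conjI refl assms)

text \<open>Row \<open>a\<close> is arbitrary, which covers a minor of size five as well as the result of differentiating
  one of its rows.\<close>

lemma det_in_ideal_of_minors:
  fixes A :: "6 cpoly^5^5"
  assumes rows: "\<And>r c. r \<noteq> a \<Longrightarrow> A $ r $ c = form_coeff (w r) (j c)"
    and w: "range w \<subseteq> U" and j: "i \<notin> range j"
  shows "det A \<in> ideal.span (chart_minors TYPE(4) U i)"
proof -
  obtain f :: "4 \<Rightarrow> 5" where f: "inj f" "range f = UNIV - {a}" using injection_missing by blast
  show ?thesis
  proof (rule det_in_ideal_of_cofactors[OF f])
    fix b
    have fa: "f r \<noteq> a" for r using f(2) by auto
    have "det (\<chi> r c. A $ f r $ Transposition.transpose a b (f c)) =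
        minor (w \<circ> f) (\<lambda>c. j (Transposition.transpose a b (f c)))"
      by (simp add: minor_def rows[OF fa])
    also have "\<dots> \<in> chart_minors TYPE(4) U i"
    proof (rule minor_in_chart_minors)
      show "range (w \<circ> f) \<subseteq> U" using w by auto
      show "i \<notin> range (\<lambda>c. j (Transposition.transpose a b (f c)))" using j by auto
    qed
    finally show "det (\<chi> r c. A $ f r $ Transposition.transpose a b (f c)) \<in> ideal.span (chart_minors TYPE(4) U i)"
      by (rule ideal.span_base)
  qed
qed

lemma minor_in_ideal:
  fixes w :: "5 \<Rightarrow> complex ^ (6 \<times> 6)"
  assumes "range w \<subseteq> U" "i \<notin> range j"
  shows "minor w j \<in> ideal.span (chart_minors TYPE(4) U i)"
  unfolding minor_def by (rule det_in_ideal_of_minors[of 0 _ w j]) (use assms in auto)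

lemma pderivative_minor_in_ideal:
  fixes w :: "5 \<Rightarrow> complex ^ (6 \<times> 6)"
  assumes "range w \<subseteq> U" "i \<notin> range j"
  shows "pderivative l (minor w j) \<in> ideal.span (chart_minors TYPE(4) U i)"
  unfolding minor_def pderivative_det
proof (rule ideal.span_sum)
  fix a :: 5
  show "det (\<chi> r c. if r = a then pderivative l (form_coeff (w r) (j c)) else form_coeff (w r) (j c))
      \<in> ideal.span (chart_minors TYPE(4) U i)"
    by (rule det_in_ideal_of_minors[of a _ w j]) (use assms in auto)
qed

text \<open>On chart \<open>i\<close> both \<open>x\<^sub>i F\<close> and its partial derivatives lie in the ideal of the minors of size four,
  by Laplace expansion along the differentiated row; and \<open>x\<^sub>i \<partial>F\<close> differs from \<open>\<partial>(x\<^sub>i F)\<close> by at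
  most \<open>F\<close>.\<close>

lemma pderivative_in_singular_curve:
  fixes w :: "5 \<Rightarrow> complex ^ (6 \<times> 6)"
  assumes w: "range w \<subseteq> U" and hom: "homogeneous 4 F"
    and F: "\<And>i j. i \<notin> range j \<Longrightarrow> inj j \<Longrightarrow> minor w j = Var i * F \<or> minor w j = - (Var i * F)"
  shows "pderivative l F \<in> H0 (singular_curve U) 3"
  unfolding H0_def singular_curve_def degeneracy_locus_def chart_ideal_def
proof (intro CollectI conjI allI)
  show "homogeneous 3 (pderivative l F)" using homogeneous_pderivative[OF hom, of l] by simp
  fix i
  let ?I = "ideal.span (chart_minors TYPE(4) U i)"
  obtain j :: "5 \<Rightarrow> 6" where j: "inj j" "i \<notin> range j" using columns_missing by blast
  have neg: "- p \<in> ?I \<Longrightarrow> p \<in> ?I" for p using ideal.span_neg[of "- p"] by simp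
  have 1: "Var i * F \<in> ?I"
    using F[OF j(2,1)] minor_in_ideal[OF w j(2)] neg by metis
  have 2: "pderivative l (Var i * F) \<in> ?I"
    using F[OF j(2,1)] pderivative_minor_in_ideal[OF w j(2), of l] neg
    by (metis pderivative_uminus)
  have "Var i ^ 2 * pderivative l F = Var i * pderivative l (Var i * F) - (if l = i then 1 else 0) * (Var i * F)"
    by (simp add: pderivative_mult power2_eq_square algebra_simps)
  also have "\<dots> \<in> ?I" by (intro ideal.span_diff ideal.span_scale 1 2)
  finally show "\<exists>N. Var i ^ N * pderivative l F \<in> ?I" by blast
qed

section \<open>The equation of the Palatini quartic\<close>

lemma span_range_combination:
  fixes w :: "'m::finite \<Rightarrow> complex ^ 'k"
  assumes "u \<in> vec.span (range w)"
  shows "\<exists>g. u = (\<Sum>k\<in>UNIV. g k *s w k)"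
proof -
  have "vec.subspace {u. \<exists>g. u = (\<Sum>k\<in>UNIV. g k *s w k)}"
  proof (rule vec.subspaceI)
    show "0 \<in> {u. \<exists>g. u = (\<Sum>k\<in>UNIV. g k *s w k)}"
      by (intro CollectI exI[of _ "\<lambda>_. 0"]) simp
  next
    fix x y assume "x \<in> {u. \<exists>g. u = (\<Sum>k\<in>UNIV. g k *s w k)}" "y \<in> {u. \<exists>g. u = (\<Sum>k\<in>UNIV. g k *s w k)}"
    then obtain g h where "x = (\<Sum>k\<in>UNIV. g k *s w k)" "y = (\<Sum>k\<in>UNIV. h k *s w k)" by auto
    then show "x + y \<in> {u. \<exists>g. u = (\<Sum>k\<in>UNIV. g k *s w k)}"
      by (intro CollectI exI[of _ "\<lambda>k. g k + h k"]) (simp add: vec.scale_left_distrib sum.distrib)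
  next
    fix c x assume "x \<in> {u. \<exists>g. u = (\<Sum>k\<in>UNIV. g k *s w k)}"
    then obtain g where "x = (\<Sum>k\<in>UNIV. g k *s w k)" by auto
    then show "c *s x \<in> {u. \<exists>g. u = (\<Sum>k\<in>UNIV. g k *s w k)}"
      by (intro CollectI exI[of _ "\<lambda>k. c * g k"]) (simp add: vec.scale_sum_right)
  qed
  moreover have "range w \<subseteq> {u. \<exists>g. u = (\<Sum>k\<in>UNIV. g k *s w k)}"
  proof (intro subsetI, elim rangeE, intro CollectI)
    fix x k assume x: "x = w k"
    have "(\<Sum>l\<in>UNIV. (if l = k then 1 else 0) *s w l) = (\<Sum>l\<in>UNIV. if l = k then w l else 0)"
      by (intro sum.cong) auto
    then show "\<exists>g. x = (\<Sum>k\<in>UNIV. g k *s w k)"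
      using x by (intro exI[of _ "\<lambda>l. if l = k then 1 else 0"]) simp
  qed
  ultimately show ?thesis using vec.span_minimal assms by blast
qed

text \<open>Every minor of size five on chart \<open>i\<close> is a constant, the determinant of a base change, times
  \<open>x\<^sub>i F\<close>, and \<open>x\<^sub>i F\<close> is such a minor up to sign.\<close>

lemma Palatini_hypersurface:
  fixes w :: "5 \<Rightarrow> complex ^ (6 \<times> 6)"
  assumes F: "\<And>i j. i \<notin> range j \<Longrightarrow> inj j \<Longrightarrow> minor w j = Var i * F \<or> minor w j = - (Var i * F)"
  shows "Palatini (vec.span (range w)) = hypersurface F"
proof
  fix i
  let ?B = "chart_minors TYPE(5) (vec.span (range w)) i"
  have B: "?B \<subseteq> ideal.span {F}"
  proof
    fix b assume "b \<in> ?B"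
    then obtain u :: "5 \<Rightarrow> complex ^ (6 \<times> 6)" and j where b: "b = minor u j" "range u \<subseteq> vec.span (range w)" "i \<notin> range j"
      unfolding chart_minors_eq by auto
    have "\<forall>a. \<exists>g. u a = (\<Sum>k\<in>UNIV. g k *s w k)" using b(2) span_range_combination by blast
    then obtain g where "\<And>a. u a = (\<Sum>k\<in>UNIV. g a k *s w k)" by metis
    then have b': "b = Const (det (\<chi> a k. g a k)) * minor w j" using minor_combination b(1) by blast
    have F': "Var i * F \<in> ideal.span {F}" by (intro ideal.span_scale ideal.span_base) simp
    have "minor w j \<in> ideal.span {F}"
    proof (cases "inj j")
      case True
      then show ?thesis using F[OF b(3) True] F' ideal.span_neg[OF F'] by auto
    next
      case False
      then show ?thesis by (simp add: minor_not_inj ideal.span_zero)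
    qed
    then show "b \<in> ideal.span {F}" unfolding b' by (rule ideal.span_scale)
  qed
  obtain j :: "5 \<Rightarrow> 6" where j: "inj j" "i \<notin> range j" using columns_missing by blast
  have m: "minor w j \<in> ideal.span ?B"
    by (rule ideal.span_base[OF minor_in_chart_minors[OF _ j(2)]]) (rule vec.span_superset)
  have F': "Var i * F \<in> ideal.span ?B"
    using F[OF j(2,1)] m ideal.span_neg[OF m] by auto
  show "Palatini (vec.span (range w)) i = hypersurface F i"
    unfolding Palatini_def degeneracy_locus_def hypersurface_def
  proof
    show "chart_ideal i ?B \<subseteq> chart_ideal i {F}"
      using ideal.span_minimal[OF B ideal.subspace_span] by (auto simp: chart_ideal_def)
    show "chart_ideal i {F} \<subseteq> chart_ideal i ?B"
    proof
      fix g assume "g \<in> chart_ideal i {F}"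
      then obtain N k where "Var i ^ N * g = k * F"
        unfolding chart_ideal_def ideal.span_singleton by auto
      then have "Var i ^ Suc N * g = k * (Var i * F)"
        by (simp only: power_Suc mult.assoc mult.left_commute[of k])
      then have "Var i ^ Suc N * g \<in> ideal.span ?B" using ideal.span_scale[OF F', of k] by (simp only:)
      then show "g \<in> chart_ideal i ?B" unfolding chart_ideal_def by blast
    qed
  qed
qed

lemma lookup_Var_power_mult:
  "Poly_Mapping.lookup (Var i ^ N * p) (Poly_Mapping.single i N + m) = Poly_Mapping.lookup p m"
proof (induction p rule: single_add_induct)
  case (single n c)
  show ?case by (simp add: Var_power mult_single lookup_single)
next
  case (add p q)
  then show ?case by (simp add: distrib_left lookup_add)
qed

lemma lookup_Var_power_mult_0:
  assumes "Poly_Mapping.lookup m i < N"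
  shows "Poly_Mapping.lookup (Var i ^ N * p) m = 0"
proof (induction p rule: single_add_induct)
  case (single n c)
  have "Poly_Mapping.single i N + n \<noteq> m" using assms by (auto simp: lookup_add)
  then show ?case by (simp add: Var_power mult_single lookup_single)
next
  case (add p q)
  then show ?case by (simp add: distrib_left lookup_add)
qed

text \<open>Powers of two different variables are coprime; the exponents show this directly.\<close>

lemma Var_power_divides:
  assumes ne: "i \<noteq> k" and eq: "Var k ^ M * p = Var i ^ N * q"
  shows "\<exists>r. p = Var i ^ N * r"
proof -
  have zero: "Poly_Mapping.lookup p m = 0" if "Poly_Mapping.lookup m i < N" for m
  proof -
    have "Poly_Mapping.lookup p m = Poly_Mapping.lookup (Var i ^ N * q) (Poly_Mapping.single k M + m)"
      by (simp only: lookup_Var_power_mult flip: eq)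
    also have "\<dots> = 0"
      using that ne by (intro lookup_Var_power_mult_0) (simp add: lookup_add lookup_single)
    finally show ?thesis .
  qed
  define r where "r = (\<Sum>m\<in>Poly_Mapping.keys p. Poly_Mapping.single (m - Poly_Mapping.single i N) (Poly_Mapping.lookup p m))"
  have "Var i ^ N * r = (\<Sum>m\<in>Poly_Mapping.keys p. Poly_Mapping.single m (Poly_Mapping.lookup p m))"
    unfolding r_def sum_distrib_left
  proof (rule sum.cong[OF refl])
    fix m assume "m \<in> Poly_Mapping.keys p"
    then have "\<not> Poly_Mapping.lookup m i < N" using zero[of m] unfolding in_keys_iff by blast
    then have "N \<le> Poly_Mapping.lookup m i" by simp
    then have "Poly_Mapping.single i N + (m - Poly_Mapping.single i N) = m"
      by (intro poly_mapping_eqI) (auto simp: lookup_add lookup_minus lookup_single when_def)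
    then show "Var i ^ N * Poly_Mapping.single (m - Poly_Mapping.single i N) (Poly_Mapping.lookup p m) =
        Poly_Mapping.single m (Poly_Mapping.lookup p m)"
      by (simp add: Var_power mult_single)
  qed
  then show ?thesis using poly_mapping_sum_single[of p] by metis
qed

text \<open>Only the constant term of \<open>p\<close> contributes to the part of \<open>p * F\<close> that has degree \<open>d\<close>.\<close>

lemma homogeneous_multiple_same_degree:
  fixes F :: "'i::finite cpoly"
  assumes "homogeneous d F" "homogeneous d (p * F)"
  shows "\<exists>c. p * F = Const c * F"
proof -
  let ?deg = "\<lambda>m :: 'i \<Rightarrow>\<^sub>0 nat. \<Sum>i\<in>UNIV. Poly_Mapping.lookup m i"
  define c where "c = Poly_Mapping.lookup p 0"
  define p' where "p' = p - Const c"
  have p'0: "Poly_Mapping.lookup p' 0 = 0" by (simp add: p'_def c_def lookup_minus Const_def)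
  have "Poly_Mapping.lookup (p' * F) m = 0" for m
  proof (cases "?deg m = d")
    case True
    have "m \<notin> Poly_Mapping.keys (p' * F)"
    proof
      assume "m \<in> Poly_Mapping.keys (p' * F)"
      then obtain a b where ab: "m = a + b" "a \<in> Poly_Mapping.keys p'" "b \<in> Poly_Mapping.keys F"
        using keys_mult[of p' F] by blast
      then have "?deg a + ?deg b = d" "?deg b = d"
        using True assms(1) by (simp_all add: homogeneous_def lookup_add sum.distrib)
      then have "a = 0" by (intro poly_mapping_eqI) simp
      then show False using ab(2) p'0 by (simp add: in_keys_iff)
    qed
    then show ?thesis by (simp add: in_keys_iff)
  next
    case False
    have "p' * F = p * F + - (Const c * F)" by (simp add: p'_def left_diff_distrib)
    moreover have "homogeneous d (p * F + - (Const c * F))"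
      by (intro homogeneous_add assms homogeneous_uminus homogeneous_Const_mult)
    ultimately show ?thesis using False by (auto simp: homogeneous_def in_keys_iff)
  qed
  then have "p' * F = 0" by (intro poly_mapping_eqI) simp
  then show ?thesis by (auto simp: p'_def left_diff_distrib)
qed

text \<open>On the charts \<open>0\<close> and \<open>1\<close>, \<open>F'\<close> becomes a multiple of \<open>F\<close> after multiplication by a power of
  \<open>x\<^sub>0\<close>, respectively of \<open>x\<^sub>1\<close>. As these powers are coprime, \<open>F\<close> divides \<open>F'\<close>.\<close>

lemma hypersurface_equation_unique:
  assumes F: "F \<noteq> 0" "homogeneous d F" and F': "F' \<noteq> 0" "homogeneous d F'"
    and eq: "hypersurface F = hypersurface F'"
  shows "\<exists>c. c \<noteq> 0 \<and> F' = Const c * F"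
proof -
  have "\<exists>N k. Var i ^ N * F' = k * F" for i
  proof -
    have "F' \<in> hypersurface F' i"
      unfolding hypersurface_def chart_ideal_def by (intro CollectI exI[of _ 0]) (simp add: ideal.span_base)
    then have "F' \<in> hypersurface F i" by (simp only: eq)
    then show ?thesis unfolding hypersurface_def chart_ideal_def ideal.span_singleton by auto
  qed
  then obtain N k M l where 0: "Var 0 ^ N * F' = k * F" and 1: "Var 1 ^ M * F' = l * F" by metis
  have "F * (Var 1 ^ M * k) = F * (Var 0 ^ N * l)"
  proof -
    have "F * (Var 1 ^ M * k) = Var 1 ^ M * (k * F)" by (simp only: mult_ac)
    also have "\<dots> = Var 0 ^ N * (Var 1 ^ M * F')" unfolding 0[symmetric] by (simp only: mult_ac)
    also have "\<dots> = F * (Var 0 ^ N * l)" unfolding 1 by (simp only: mult_ac)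
    finally show ?thesis .
  qed
  then have e: "Var 1 ^ M * k = Var 0 ^ N * l" using F(1) by (metis mult_left_cancel)
  obtain r where "k = Var 0 ^ N * r" using Var_power_divides[OF zero_neq_one e] ..
  with 0 have "Var 0 ^ N * F' = Var 0 ^ N * (r * F)" by (simp only: mult.assoc)
  moreover have "(Var 0 :: 6 cpoly) ^ N \<noteq> 0"
  proof
    assume "(Var 0 :: 6 cpoly) ^ N = 0"
    from arg_cong[OF this, of "eval (\<lambda>_. 1)"] show False by (simp add: eval_power)
  qed
  ultimately have "F' = r * F" by (metis mult_left_cancel)
  then obtain c where "F' = Const c * F" using homogeneous_multiple_same_degree[OF F(2), of r] F'(2) by auto
  then show ?thesis using F'(1) by (intro exI[of _ c]) auto
qed

section \<open>Points of the singular curve\<close>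

lemma det_zero_of_left_kernel:
  fixes R :: "complex^'n^'n"
  assumes "\<alpha> \<noteq> 0" "\<And>b. (\<Sum>a\<in>UNIV. \<alpha> $ a * R $ a $ b) = 0"
  shows "det R = 0"
proof (rule ccontr)
  assume "det R \<noteq> 0"
  then have "invertible (Finite_Cartesian_Product.transpose R)"
    by (simp add: invertible_det_nz)
  then obtain B where B: "B ** Finite_Cartesian_Product.transpose R = mat 1" unfolding invertible_def by blast
  have "Finite_Cartesian_Product.transpose R *v \<alpha> = 0"
    using assms(2) by (simp add: vec_eq_iff matrix_vector_mult_def Finite_Cartesian_Product.transpose_def mult.commute)
  then have "\<alpha> = 0" using B matrix_left_invertible_ker[of "Finite_Cartesian_Product.transpose R"] by blast
  then show False using assms(1) by simp
qed

text \<open>Two independent relations put all five rows into the span of three of them, so any four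
  combinations of the rows are dependent.\<close>

lemma combinations_of_rank_deficient_rows:
  fixes y :: "5 \<Rightarrow> complex^6" and g :: "4 \<Rightarrow> 5 \<Rightarrow> complex"
  assumes ne: "c l * d m - c m * d l \<noteq> 0"
    and c: "(\<Sum>k\<in>UNIV. c k *s y k) = 0" and d: "(\<Sum>k\<in>UNIV. d k *s y k) = 0"
  shows "det (\<chi> a b. (\<Sum>k\<in>UNIV. g a k *s y k) $ j b) = 0"
proof -
  define t where "t a = (\<Sum>k\<in>UNIV. g a k *s y k)" for a
  let ?S = "y ` (UNIV - {l, m})"
  have lm: "l \<noteq> m" using ne by auto
  have solve: "p *s y l \<in> vec.span ?S"
    if h: "(\<Sum>k\<in>UNIV. h k *s y k) = 0" "h m = 0" "h l = p" for h p
  proof -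
    have "(\<Sum>k\<in>UNIV. h k *s y k) = h l *s y l + (\<Sum>k\<in>UNIV - {l}. h k *s y k)"
      by (rule sum.remove) auto
    moreover have "(\<Sum>k\<in>UNIV - {l}. h k *s y k) = h m *s y m + (\<Sum>k\<in>UNIV - {l} - {m}. h k *s y k)"
      using lm by (intro sum.remove) auto
    ultimately have "p *s y l = - (\<Sum>k\<in>UNIV - {l, m}. h k *s y k)"
      using h by (simp add: eq_neg_iff_add_eq_0 Diff_insert2[symmetric] insert_commute)
    also have "\<dots> \<in> vec.span ?S"
      by (intro vec.span_neg vec.span_sum vec.span_scale vec.span_base) auto
    finally show ?thesis .
  qed
  have solve': "p *s y m \<in> vec.span ?S"
    if h: "(\<Sum>k\<in>UNIV. h k *s y k) = 0" "h l = 0" "h m = p" for h p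
  proof -
    have "(\<Sum>k\<in>UNIV. h k *s y k) = h m *s y m + (\<Sum>k\<in>UNIV - {m}. h k *s y k)"
      by (rule sum.remove) auto
    moreover have "(\<Sum>k\<in>UNIV - {m}. h k *s y k) = h l *s y l + (\<Sum>k\<in>UNIV - {m} - {l}. h k *s y k)"
      using lm by (intro sum.remove) auto
    ultimately have "p *s y m = - (\<Sum>k\<in>UNIV - {l, m}. h k *s y k)"
      using h by (simp add: eq_neg_iff_add_eq_0 Diff_insert2[symmetric] insert_commute)
    also have "\<dots> \<in> vec.span ?S"
      by (intro vec.span_neg vec.span_sum vec.span_scale vec.span_base) auto
    finally show ?thesis .
  qed
  let ?\<Delta> = "c l * d m - c m * d l"
  have comb: "(\<Sum>k\<in>UNIV. (p * c k - q * d k) *s y k) = 0" for p q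
  proof -
    have "(\<Sum>k\<in>UNIV. (p * c k - q * d k) *s y k) = p *s (\<Sum>k\<in>UNIV. c k *s y k) - q *s (\<Sum>k\<in>UNIV. d k *s y k)"
      by (simp add: vec.scale_left_diff_distrib sum_subtractf vec.scale_sum_right)
    then show ?thesis by (simp add: c d)
  qed
  have cancel: "v \<in> vec.span ?S" if "p *s v \<in> vec.span ?S" "p \<noteq> 0" for p v
    using vec.span_scale[OF that(1), of "1 / p"] that(2) by simp
  have yl: "y l \<in> vec.span ?S"
    by (rule cancel[OF solve[OF comb[of "d m" "c m"] _ refl]]) (use ne in \<open>simp_all add: mult.commute\<close>)
  have ym: "y m \<in> vec.span ?S"
    by (rule cancel[OF solve'[OF comb[of "d l" "c l"] _ refl]]) (use ne in \<open>simp_all add: mult.commute\<close>)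
  have yk: "y k \<in> vec.span ?S" for k
    using yl ym vec.span_base[of "y k" ?S] by (cases "k = l \<or> k = m") auto
  have tS: "t a \<in> vec.span ?S" for a
    unfolding t_def by (intro vec.span_sum vec.span_scale yk)
  have cardS: "card ?S \<le> 3"
  proof -
    have "card ?S \<le> card (UNIV - {l, m})" by (rule card_image_le) simp
    also have "\<dots> = 3" using lm by (simp add: card_Diff_subset)
    finally show ?thesis .
  qed
  show ?thesis
  proof (cases "inj t")
    case False
    then obtain a a' where "a \<noteq> a'" "t a = t a'" unfolding inj_def by blast
    then show ?thesis
      unfolding t_def[symmetric] by (intro det_identical_rows[of a a']) (simp_all add: row_def)
  next
    case True
    have "vec.dependent (range t)"
    proof (rule ccontr)
      assume "vec.independent (range t)"
      then have "card (range t) \<le> card ?S"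
        using tS by (intro vec.independent_span_bound[THEN conjunct2]) auto
      moreover have "card (range t) = 4" using True by (simp add: card_image)
      ultimately show False using cardS by simp
    qed
    then obtain u v where u: "v \<in> range t" "u v \<noteq> 0" "(\<Sum>v\<in>range t. u v *s v) = 0"
      by (auto simp: vec.dependent_finite)
    then obtain a0 where a0: "u (t a0) \<noteq> 0" by auto
    have s: "(\<Sum>a\<in>UNIV. u (t a) *s t a) = 0" using u(3) by (simp add: sum.reindex[OF True])
    show ?thesis unfolding t_def[symmetric]
    proof (rule det_zero_of_left_kernel)
      show "(\<chi> a. u (t a)) \<noteq> 0" using a0 by (auto simp: vec_eq_iff)
      fix b
      have "(\<Sum>a\<in>UNIV. u (t a) *s t a) $ j b = 0" using s by simp
      then show "(\<Sum>a\<in>UNIV. (\<chi> a. u (t a)) $ a * (\<chi> a b. t a $ j b) $ a $ b) = 0"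
        by (simp add: sum_component)
    qed
  qed
qed

definition frame :: "(5 \<times> 6 \<times> 6 \<Rightarrow> complex) \<Rightarrow> 5 \<Rightarrow> complex ^ (6 \<times> 6)" where
  "frame s l = (\<chi> ij. entry s l (snd ij) (fst ij))"

lemma frame_nth [simp]: "frame s l $ (i, j) = entry s l j i"
  by (simp add: frame_def)

lemma frame_alternating: "frame s l \<in> alternating_forms"
  by (simp add: alternating_forms_def entry_def)

lemma eval_form_coeff: "eval x (form_coeff u j) = (\<Sum>i\<in>UNIV. u $ (i, j) * x i)"
  by (simp add: form_coeff_def eval_sum)

lemma eval_minor: "eval x (minor u j) = det (\<chi> a b. \<Sum>i\<in>UNIV. u a $ (i, j b) * x i)"
  by (simp add: minor_def eval_det eval_form_coeff)

lemma singular_curve_section_vanishes: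
  assumes f: "f \<in> H0 (singular_curve (vec.span (range (frame s)))) d"
    and x: "in_pencil_kernel s x c d'" "x i \<noteq> 0"
  shows "eval x f = 0"
proof -
  let ?U = "vec.span (range (frame s))"
  obtain N where N: "Var i ^ N * f \<in> ideal.span (chart_minors TYPE(4) ?U i)"
    using f unfolding H0_def singular_curve_def degeneracy_locus_def chart_ideal_def by blast
  have gen: "eval x b = 0" if b_in: "b \<in> chart_minors TYPE(4) ?U i" for b
  proof -
    obtain u :: "4 \<Rightarrow> complex ^ (6 \<times> 6)" and j where b: "b = minor u j" "range u \<subseteq> ?U"
      using b_in unfolding chart_minors_eq by auto
    have "\<forall>a. \<exists>g. u a = (\<Sum>k\<in>UNIV. g k *s frame s k)" using b(2) span_range_combination by blast
    then obtain g where g: "\<And>a. u a = (\<Sum>k\<in>UNIV. g a k *s frame s k)" by metis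
    define y where "y k = (\<chi> j. \<Sum>i\<in>UNIV. entry s k j i * x i)" for k
    have uy: "(\<Sum>i\<in>UNIV. u a $ (i, jj) * x i) = (\<Sum>k\<in>UNIV. g a k *s y k) $ jj" for a jj
    proof -
      have "(\<Sum>i\<in>UNIV. u a $ (i, jj) * x i) = (\<Sum>i\<in>UNIV. \<Sum>k\<in>UNIV. g a k * (entry s k jj i * x i))"
        unfolding g by (simp add: sum_component sum_distrib_right mult.assoc)
      also have "\<dots> = (\<Sum>k\<in>UNIV. \<Sum>i\<in>UNIV. g a k * (entry s k jj i * x i))" by (rule sum.swap)
      also have "\<dots> = (\<Sum>k\<in>UNIV. g a k *s y k) $ jj"
        by (simp add: sum_component y_def sum_distrib_left)
      finally show ?thesis .
    qed
    have ker: "(\<Sum>k\<in>UNIV. e k *s y k) = 0" if "\<forall>j. (\<Sum>l\<in>UNIV. \<Sum>i\<in>UNIV. e l * entry s l j i * x i) = 0" for e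
      unfolding vec_eq_iff
    proof
      fix jj
      have "(\<Sum>k\<in>UNIV. e k *s y k) $ jj = (\<Sum>l\<in>UNIV. \<Sum>i\<in>UNIV. e l * entry s l jj i * x i)"
        by (simp add: sum_component y_def sum_distrib_left mult.assoc)
      then show "(\<Sum>k\<in>UNIV. e k *s y k) $ jj = 0 $ jj" using that by simp
    qed
    obtain l m where lm: "c l * d' m - c m * d' l \<noteq> 0" using x(1) unfolding in_pencil_kernel_def by blast
    have "det (\<chi> a b. (\<Sum>k\<in>UNIV. g a k *s y k) $ j b) = 0"
      by (rule combinations_of_rank_deficient_rows[OF lm]) (use x(1) ker in \<open>auto simp: in_pencil_kernel_def\<close>)
    then show ?thesis unfolding b(1) eval_minor uy .
  qed
  have "eval x p = 0" if "p \<in> ideal.span (chart_minors TYPE(4) ?U i)" for p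
    using that
  proof (induction rule: ideal.span_induct_alt)
    case (step c b p)
    then show ?case using gen[OF step(1)] by simp
  qed simp
  from this[OF N] have "x i ^ N * eval x f = 0" by (simp add: eval_power)
  then show ?thesis using x(2) by simp
qed

section \<open>Cubic forms by coefficients\<close>

definition triple_exponent :: "6 \<times> 6 \<times> 6 \<Rightarrow> (6 \<Rightarrow>\<^sub>0 nat)" where
  "triple_exponent = (\<lambda>(i, j, k). Poly_Mapping.single i 1 + Poly_Mapping.single j 1 + Poly_Mapping.single k 1)"

lemma index6_inj: "index6 i = index6 j \<Longrightarrow> i = j"
proof -
  have "\<forall>i j. index6 i = index6 j \<longrightarrow> i = j" unfolding all6 by (simp add: index6_def)
  then show "index6 i = index6 j \<Longrightarrow> i = j" by blast
qed

lemma exponent_as_list: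
  fixes m :: "'i::finite \<Rightarrow>\<^sub>0 nat"
  shows "(\<Sum>i\<in>UNIV. Poly_Mapping.lookup m i) = n \<Longrightarrow>
    \<exists>xs. length xs = n \<and> m = sum_list (map (\<lambda>i. Poly_Mapping.single i 1) xs)"
proof (induction n arbitrary: m)
  case 0
  then have "m = 0" by (intro poly_mapping_eqI) simp
  then show ?case by simp
next
  case (Suc n)
  then obtain i where i: "Poly_Mapping.lookup m i \<noteq> 0" by (metis sum.neutral nat.distinct(1))
  define m' where "m' = m - Poly_Mapping.single i 1"
  have m: "m = Poly_Mapping.single i 1 + m'"
    unfolding m'_def using i by (intro poly_mapping_eqI) (auto simp: lookup_add lookup_minus lookup_single when_def)
  have "(\<Sum>j\<in>UNIV. Poly_Mapping.lookup m' j) = n"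
    using Suc.prems unfolding m by (simp add: lookup_add sum.distrib lookup_single when_def)
  then obtain xs where "length xs = n" "m' = sum_list (map (\<lambda>i. Poly_Mapping.single i 1) xs)"
    using Suc.IH by blast
  then show ?case using m by (intro exI[of _ "i # xs"]) simp
qed

lemma triple_exponent_bij:
  "bij_betw triple_exponent sorted_triples {m. (\<Sum>i\<in>UNIV. Poly_Mapping.lookup m i) = 3}"
  unfolding bij_betw_def
proof
  show "inj_on triple_exponent sorted_triples"
  proof (rule inj_onI)
    fix p q assume pq: "p \<in> sorted_triples" "q \<in> sorted_triples" "triple_exponent p = triple_exponent q"
    obtain i j k i' j' k' where p: "p = (i, j, k)" and q: "q = (i', j', k')" by (metis prod_cases3)
    note s = pq(1,2)[unfolded p q] and eq = pq(3)[unfolded p q]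
    have count: "Poly_Mapping.lookup (triple_exponent (i, j, k)) x = count (mset [i, j, k]) x" for i j k x
      by (simp add: triple_exponent_def lookup_add lookup_single when_def)
    have "mset [i, j, k] = mset [i', j', k']"
      by (rule multiset_eqI) (simp only: count[symmetric] eq)
    then have "mset (map index6 [i, j, k]) = mset (map index6 [i', j', k'])" by (simp only: mset_map)
    moreover have "sorted (map index6 [i, j, k])" "sorted (map index6 [i', j', k'])"
      using s by (auto simp: sorted_triples_def)
    ultimately have "map index6 [i, j, k] = map index6 [i', j', k']"
      by (metis properties_for_sort sort_key_id_if_sorted sorted_sort_id)
    then show "p = q" unfolding p q by (auto dest: index6_inj)
  qed
  show "triple_exponent ` sorted_triples = {m. (\<Sum>i\<in>UNIV. Poly_Mapping.lookup m i) = 3}"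
  proof (intro equalityI subsetI)
    fix m assume "m \<in> triple_exponent ` sorted_triples"
    then show "m \<in> {m. (\<Sum>i\<in>UNIV. Poly_Mapping.lookup m i) = 3}"
      by (auto simp: triple_exponent_def lookup_add sum.distrib lookup_single when_def)
  next
    fix m :: "6 \<Rightarrow>\<^sub>0 nat" assume "m \<in> {m. (\<Sum>i\<in>UNIV. Poly_Mapping.lookup m i) = 3}"
    then obtain xs where xs: "length xs = 3" "m = sum_list (map (\<lambda>i. Poly_Mapping.single i 1) xs)"
      using exponent_as_list[of m 3] by auto
    define ys where "ys = sort_key index6 xs"
    have "sum_list (map (\<lambda>i. Poly_Mapping.single i (1::nat)) ys) = sum_list (map (\<lambda>i. Poly_Mapping.single i 1) xs)"
      unfolding sum_mset_sum_list[symmetric] mset_map by (simp add: ys_def)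
    moreover have "length ys = 3" using xs by (simp add: ys_def)
    then obtain i j k where ijk: "ys = [i, j, k]"
      by (auto simp: numeral_3_eq_3 length_Suc_conv)
    moreover have "sorted (map index6 ys)" by (simp add: ys_def)
    ultimately have "m = triple_exponent (i, j, k)" "(i, j, k) \<in> sorted_triples"
      using xs(2) by (simp_all add: triple_exponent_def sorted_triples_def add.assoc)
    then show "m \<in> triple_exponent ` sorted_triples" by blast
  qed
qed

lemma cubic_form_expansion:
  assumes "homogeneous 3 f"
  shows "f = (\<Sum>t\<in>sorted_triples. Poly_Mapping.single (triple_exponent t) (Poly_Mapping.lookup f (triple_exponent t)))"
proof -
  have fin: "finite {m :: 6 \<Rightarrow>\<^sub>0 nat. (\<Sum>i\<in>UNIV. Poly_Mapping.lookup m i) = 3}"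
    using bij_betw_finite[OF triple_exponent_bij] finite by blast
  have "f = (\<Sum>m\<in>Poly_Mapping.keys f. Poly_Mapping.single m (Poly_Mapping.lookup f m))"
    by (rule poly_mapping_sum_single[symmetric])
  also have "\<dots> = (\<Sum>m | (\<Sum>i\<in>UNIV. Poly_Mapping.lookup m i) = 3. Poly_Mapping.single m (Poly_Mapping.lookup f m))"
    using assms fin by (intro sum.mono_neutral_left) (auto simp: homogeneous_def in_keys_iff)
  also have "\<dots> = (\<Sum>t\<in>sorted_triples. Poly_Mapping.single (triple_exponent t) (Poly_Mapping.lookup f (triple_exponent t)))"
    by (rule sum.reindex_bij_betw[OF triple_exponent_bij, symmetric])
  finally show ?thesis .
qed

lemma eval_triple: "eval x (Poly_Mapping.single (triple_exponent (i, j, k)) c) = c * x i * x j * x k"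
proof -
  have "Poly_Mapping.single (triple_exponent (i, j, k)) c = Const c * Var i * Var j * Var k"
    by (simp add: triple_exponent_def Const_def Var_def mult_single)
  then show ?thesis by simp
qed

lemma cubic_form_zero:
  assumes s: "determines_cubics s" and f: "f \<in> H0 (singular_curve (vec.span (range (frame s)))) 3"
    and free: "\<And>t. t \<in> free_triples \<Longrightarrow> Poly_Mapping.lookup f (triple_exponent t) = 0"
  shows "f = 0"
proof -
  have hom: "homogeneous 3 f" using f by (simp add: H0_def)
  define a where "a t = (if t \<in> sorted_triples - free_triples then Poly_Mapping.lookup f (triple_exponent t) else 0)" for t
  have eval: "eval x f = cubic a x" for x
  proof -
    have "eval x f = (\<Sum>t\<in>sorted_triples. eval x (Poly_Mapping.single (triple_exponent t) (Poly_Mapping.lookup f (triple_exponent t))))"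
      by (subst cubic_form_expansion[OF hom]) (rule eval_sum)
    also have "\<dots> = (\<Sum>t\<in>sorted_triples - free_triples. eval x (Poly_Mapping.single (triple_exponent t) (Poly_Mapping.lookup f (triple_exponent t))))"
      using free by (intro sum.mono_neutral_right) auto
    also have "\<dots> = cubic a x"
      unfolding cubic_def by (intro sum.cong refl) (auto simp: a_def eval_triple)
    finally show ?thesis .
  qed
  have "cubic_vanishes s a"
    unfolding cubic_vanishes_def
  proof (intro allI impI)
    fix x c d assume x: "in_pencil_kernel s x c d"
    show "cubic a x = 0"
    proof (cases "\<exists>i. x i \<noteq> 0")
      case True
      then show ?thesis using singular_curve_section_vanishes[OF f x] eval by auto
    next
      case False
      then show ?thesis by (simp add: cubic_def case_prod_unfold)
    qed
  qed
  moreover have "\<forall>t. t \<notin> sorted_triples - free_triples \<longrightarrow> a t = 0" by (simp add: a_def)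
  ultimately have "a t = 0" for t
    using s unfolding determines_cubics_def by blast
  then have "Poly_Mapping.lookup f (triple_exponent t) = 0" if "t \<in> sorted_triples" for t
    using free[of t] that unfolding a_def by (metis DiffI)
  then show ?thesis by (subst cubic_form_expansion[OF hom]) simp
qed

section \<open>The space of cubic sections\<close>

lemma base_columns_inj: "inj base_columns" and base_columns_missing: "0 \<notin> range base_columns"
proof -
  have "\<forall>i j. base_columns i = base_columns j \<longrightarrow> i = j"
    unfolding all5 by (simp add: base_columns_def)
  then show "inj base_columns" unfolding inj_def by blast
  have "\<forall>i. base_columns i \<noteq> 0" unfolding all5 by (simp add: base_columns_def)
  then show "0 \<notin> range base_columns" by (metis rangeE)
qed

lemma point_minor_eval: "point_minor s x = eval x (minor (frame s) base_columns)"
  by (simp add: point_minor_def eval_minor)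

text \<open>A relation among the partial derivatives is a direction in which \<open>F\<close> does not change.\<close>

lemma partials_independent:
  assumes s: "not_cone s" and F: "minor (frame s) base_columns = Var 0 * F"
    and b: "(\<Sum>i\<in>UNIV. Const (b i) * pderivative i F) = 0"
  shows "b i = 0"
proof -
  have "vertex s b"
    unfolding vertex_def point_minor_eval F
    by (simp add: eval_translate_invariant[OF b] mult.left_commute mult.commute)
  then show ?thesis using s unfolding not_cone_def by blast
qed

lemma H0_subspace:
  assumes I: "\<And>i. I i = chart_ideal i (B i)"
  shows "cp.subspace (H0 I d)"
proof (rule cp.subspaceI)
  show "0 \<in> H0 I d" by (simp add: H0_def I chart_ideal_def ideal.span_zero)
next
  fix f g assume fg: "f \<in> H0 I d" "g \<in> H0 I d"
  have "f + g \<in> chart_ideal i (B i)" for i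
  proof -
    obtain N M where N: "Var i ^ N * f \<in> ideal.span (B i)" and M: "Var i ^ M * g \<in> ideal.span (B i)"
      using fg unfolding H0_def I chart_ideal_def by blast
    have "Var i ^ (N + M) * (f + g) = Var i ^ M * (Var i ^ N * f) + Var i ^ N * (Var i ^ M * g)"
      by (simp only: power_add distrib_left distrib_right mult_ac)
    also have "\<dots> \<in> ideal.span (B i)" by (intro ideal.span_add ideal.span_scale N M)
    finally show ?thesis unfolding chart_ideal_def by blast
  qed
  then show "f + g \<in> H0 I d" using fg by (simp add: H0_def I homogeneous_add)
next
  fix c f assume f: "f \<in> H0 I d"
  have "Const c * f \<in> chart_ideal i (B i)" for i
  proof -
    obtain N where N: "Var i ^ N * f \<in> ideal.span (B i)"
      using f unfolding H0_def I chart_ideal_def by blast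
    have "Var i ^ N * (Const c * f) = Const c * (Var i ^ N * f)" by (rule mult.left_commute)
    also have "\<dots> \<in> ideal.span (B i)" by (intro ideal.span_scale N)
    finally show ?thesis unfolding chart_ideal_def by blast
  qed
  then show "Const c * f \<in> H0 I d" using f by (simp add: H0_def I homogeneous_Const_mult)
qed

text \<open>Let \<open>K\<close> be the square matrix of the coefficients of the six partial derivatives at the six
  \<open>free_triples\<close>. It is injective: a combination of partial derivatives without free coefficients
  is zero by \<open>determines_cubics\<close>, and the partial derivatives are independent as \<open>F\<close> is not a
  cone. So \<open>K\<close> is surjective, i.e. every section has the same free coefficients as some
  combination of partial derivatives, and therefore equals it.\<close>

lemma cubic_sections_spanned:
  fixes s :: "5 \<times> 6 \<times> 6 \<Rightarrow> complex"
  defines "V \<equiv> H0 (singular_curve (vec.span (range (frame s)))) 3"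
  assumes s: "determines_cubics s" "not_cone s" and hom: "homogeneous 4 F"
    and F: "minor (frame s) base_columns = Var 0 * F"
    and minors: "\<And>i j. i \<notin> range j \<Longrightarrow> inj j \<Longrightarrow> minor (frame s) j = Var i * F \<or> minor (frame s) j = - (Var i * F)"
  shows "V = cp.span (range (\<lambda>i. pderivative i F))" "cp.dim V = 6"
proof -
  have V: "cp.subspace V"
    unfolding V_def by (rule H0_subspace) (simp add: singular_curve_def degeneracy_locus_def)
  have D: "pderivative i F \<in> V" for i
    unfolding V_def by (rule pderivative_in_singular_curve[OF vec.span_superset hom minors])
  define \<tau> :: "6 \<Rightarrow> 6 \<times> 6 \<times> 6" where
    "\<tau> = v6 (0, 0, 4) (0, 0, 5) (1, 1, 5) (1, 3, 3) (2, 3, 3) (2, 4, 4)"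
  have free: "free_triples \<subseteq> range \<tau>"
  proof
    fix t assume "t \<in> free_triples"
    then have "t \<in> {\<tau> 0, \<tau> 1, \<tau> 2, \<tau> 3, \<tau> 4, \<tau> 5}" by (simp add: free_triples_def \<tau>_def)
    then show "t \<in> range \<tau>" by blast
  qed
  have zero: "f = 0" if "f \<in> V" "\<And>r. Poly_Mapping.lookup f (triple_exponent (\<tau> r)) = 0" for f
    using cubic_form_zero[OF s(1)] that free unfolding V_def by blast
  define K where "K = (\<chi> r i. Poly_Mapping.lookup (pderivative i F) (triple_exponent (\<tau> r)))"
  define D' where "D' b = (\<Sum>i\<in>UNIV. Const (b $ i) * pderivative i F)" for b :: "complex^6"
  have D'V: "D' b \<in> V" for b
    unfolding D'_def by (intro cp.subspace_sum[OF V] cp.subspace_scale[OF V] D)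
  have lookup_Const: "Poly_Mapping.lookup (Const c * p) m = c * Poly_Mapping.lookup p m" for c and p :: "6 cpoly" and m
  proof (induction p rule: single_add_induct)
    case (single n d)
    then show ?case by (simp add: Const_def mult_single lookup_single when_def)
  next
    case (add p q)
    then show ?case by (simp add: distrib_left lookup_add)
  qed
  have KD: "(K *v b) $ r = Poly_Mapping.lookup (D' b) (triple_exponent (\<tau> r))" for b r
    by (simp add: K_def D'_def matrix_vector_mult_def lookup_sum lookup_Const) (simp only: mult.commute)
  have "b = 0" if "K *v b = 0" for b
  proof -
    have "D' b = 0" by (rule zero[OF D'V]) (use that in \<open>simp flip: KD\<close>)
    then have "b $ i = 0" for i
      using partials_independent[OF s(2) F, of "\<lambda>i. b $ i"] unfolding D'_def by blast
    then show ?thesis by (simp add: vec_eq_iff)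
  qed
  then have "\<exists>B. B ** K = mat 1" by (simp add: matrix_left_invertible_ker)
  then have "\<exists>B. K ** B = mat 1" by (simp add: matrix_left_right_inverse)
  then have surj: "surj ((*v) K)" by (simp add: matrix_right_invertible_surjective)
  show span: "V = cp.span (range (\<lambda>i. pderivative i F))"
  proof
    show "cp.span (range (\<lambda>i. pderivative i F)) \<subseteq> V"
      by (rule cp.span_minimal[OF _ V]) (use D in blast)
    show "V \<subseteq> cp.span (range (\<lambda>i. pderivative i F))"
    proof
      fix f assume f: "f \<in> V"
      obtain b where b: "(\<chi> r. Poly_Mapping.lookup f (triple_exponent (\<tau> r))) = K *v b"
        using surj unfolding surj_def by blast
      have "f - D' b = 0"
      proof (rule zero)
        show "f - D' b \<in> V" by (rule cp.subspace_diff[OF V f D'V])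
        fix r
        have "Poly_Mapping.lookup f (triple_exponent (\<tau> r)) = (K *v b) $ r"
          unfolding b[symmetric] by simp
        then show "Poly_Mapping.lookup (f - D' b) (triple_exponent (\<tau> r)) = 0"
          by (simp add: lookup_minus KD)
      qed
      then have "f = D' b" by simp
      also have "\<dots> \<in> cp.span (range (\<lambda>i. pderivative i F))"
        unfolding D'_def by (intro cp.span_sum cp.span_scale cp.span_base) auto
      finally show "f \<in> cp.span (range (\<lambda>i. pderivative i F))" .
    qed
  qed
  have inj: "inj (\<lambda>i. pderivative i F)"
  proof (rule injI, rule ccontr)
    fix i k assume eq: "pderivative i F = pderivative k F" and ne: "i \<noteq> k"
    define b :: "6 \<Rightarrow> complex" where "b l = (if l = i then 1 else 0) - (if l = k then 1 else 0)" for l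
    have "(\<Sum>l\<in>UNIV. Const (b l) * pderivative l F) =
        (\<Sum>l\<in>UNIV. (if l = i then pderivative i F else 0) - (if l = k then pderivative k F else 0))"
      by (intro sum.cong refl) (auto simp: b_def Const_uminus)
    also have "\<dots> = 0" by (simp add: sum_subtractf eq)
    finally have "b i = 0" by (rule partials_independent[OF s(2) F])
    then show False using ne by (simp add: b_def)
  qed
  have "cp.independent (range (\<lambda>i. pderivative i F))"
  proof
    assume "cp.dependent (range (\<lambda>i. pderivative i F))"
    then obtain u v where u: "v \<in> range (\<lambda>i. pderivative i F)" "u v \<noteq> 0"
      "(\<Sum>v\<in>range (\<lambda>i. pderivative i F). Const (u v) * v) = 0"
      by (auto simp: cp.dependent_finite)
    have "(\<Sum>i\<in>UNIV. Const (u (pderivative i F)) * pderivative i F) = 0"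
      using u(3) by (simp add: sum.reindex[OF inj])
    then have "u (pderivative i F) = 0" for i
      using partials_independent[OF s(2) F, of "\<lambda>i. u (pderivative i F)"] by blast
    then show False using u(1,2) by auto
  qed
  then have "cp.dim (cp.span (range (\<lambda>i. pderivative i F))) = card (range (\<lambda>i. pderivative i F))"
    by (rule cp.dim_span_eq_card_independent)
  then show "cp.dim V = 6" unfolding span by (simp add: card_image[OF inj])
qed

section \<open>Change of coordinates\<close>

lemma matrix_inv_left: "invertible A \<Longrightarrow> matrix_inv A ** A = mat 1"
  unfolding invertible_def matrix_inv_def by (rule someI_ex[THEN conjunct2])

lemma subst_linear_coords_inverse:
  assumes A: "invertible A"
  shows "subst (linear_coords A) (subst (linear_coords (matrix_inv A)) p) = p"
proof (induction p rule: cpoly_induct)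
  case (Var k)
  have inv: "(\<Sum>l\<in>UNIV. matrix_inv A $ k $ l * A $ l $ j) = (if k = j then 1 else 0)" for j
  proof -
    have "(matrix_inv A ** A) $ k $ j = mat 1 $ k $ j" using matrix_inv_left[OF A] by simp
    then show ?thesis by (simp add: matrix_matrix_mult_def mat_def)
  qed
  have "subst (linear_coords A) (subst (linear_coords (matrix_inv A)) (Var k)) =
      (\<Sum>l\<in>UNIV. \<Sum>j\<in>UNIV. Const (matrix_inv A $ k $ l * A $ l $ j) * Var j)"
    by (simp only: subst_simps linear_coords_def subst_sum sum_distrib_left Const_mult mult.assoc)
  also have "\<dots> = (\<Sum>j\<in>UNIV. Const (\<Sum>l\<in>UNIV. matrix_inv A $ k $ l * A $ l $ j) * Var j)"
    by (subst sum.swap) (simp only: Const_sum sum_distrib_right)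
  also have "\<dots> = (\<Sum>j\<in>UNIV. if k = j then Var j else 0)"
    unfolding inv by (intro sum.cong) auto
  finally show ?case by simp
qed simp_all

text \<open>The chain rule.\<close>

lemma partial_wrt_eq:
  assumes A: "invertible A"
  shows "partial_wrt A i F = (\<Sum>k\<in>UNIV. Const (matrix_inv A $ k $ i) * pderivative k F)"
proof -
  have d: "pderivative i (linear_coords B k) = Const (B $ k $ i)" for B :: "complex^6^6" and k
  proof -
    have "pderivative i (linear_coords B k) = (\<Sum>j\<in>UNIV. if i = j then Const (B $ k $ j) else 0)"
      unfolding linear_coords_def pderivative_sum by (intro sum.cong) (auto simp: pderivative_mult)
    then show ?thesis by simp
  qed
  show ?thesis
    unfolding partial_wrt_def pderivative_subst d subst_sum
    by (simp add: subst_linear_coords_inverse[OF A] mult.commute)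
qed

lemma jacobian_space_eq:
  assumes A: "invertible A"
  shows "jacobian_space A F = cp.span (range (\<lambda>i. pderivative i F))"
proof -
  have "pderivative k F = (\<Sum>i\<in>UNIV. Const (A $ i $ k) * partial_wrt A i F)" for k
  proof -
    have inv: "(\<Sum>i\<in>UNIV. matrix_inv A $ l $ i * A $ i $ k) = (if l = k then 1 else 0)" for l
    proof -
      have "(matrix_inv A ** A) $ l $ k = mat 1 $ l $ k" using matrix_inv_left[OF A] by simp
      then show ?thesis by (simp add: matrix_matrix_mult_def mat_def)
    qed
    have "(\<Sum>i\<in>UNIV. Const (A $ i $ k) * partial_wrt A i F) =
        (\<Sum>i\<in>UNIV. \<Sum>l\<in>UNIV. Const (matrix_inv A $ l $ i * A $ i $ k) * pderivative l F)"
      unfolding partial_wrt_eq[OF A] sum_distrib_left Const_mult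
      by (rule sum.cong[OF refl], rule sum.cong[OF refl]) (simp only: mult_ac)
    also have "\<dots> = (\<Sum>l\<in>UNIV. Const (\<Sum>i\<in>UNIV. matrix_inv A $ l $ i * A $ i $ k) * pderivative l F)"
      by (subst sum.swap) (simp only: Const_sum sum_distrib_right)
    also have "\<dots> = (\<Sum>l\<in>UNIV. if l = k then pderivative l F else 0)"
      unfolding inv by (intro sum.cong) auto
    finally show ?thesis by simp
  qed
  moreover have "(\<Sum>i\<in>UNIV. Const (A $ i $ k) * partial_wrt A i F) \<in> jacobian_space A F" for k
    unfolding jacobian_space_def by (intro cp.span_sum cp.span_scale cp.span_base) auto
  ultimately have "range (\<lambda>i. pderivative i F) \<subseteq> jacobian_space A F" by auto
  then have 1: "cp.span (range (\<lambda>i. pderivative i F)) \<subseteq> jacobian_space A F"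
    unfolding jacobian_space_def by (intro cp.span_minimal cp.subspace_span)
  have "partial_wrt A i F \<in> cp.span (range (\<lambda>i. pderivative i F))" for i
    unfolding partial_wrt_eq[OF A] by (intro cp.span_sum cp.span_scale cp.span_base) auto
  then have "jacobian_space A F \<subseteq> cp.span (range (\<lambda>i. pderivative i F))"
    unfolding jacobian_space_def by (intro cp.span_minimal cp.subspace_span) auto
  with 1 show ?thesis by blast
qed

lemma span_partials_Const_mult:
  fixes F :: "6 cpoly"
  assumes "c \<noteq> 0"
  shows "cp.span (range (\<lambda>i. pderivative i (Const c * F))) = cp.span (range (\<lambda>i. pderivative i F))"
proof -
  have sub: "cp.span (range (\<lambda>i. pderivative i (Const c * F))) \<subseteq> cp.span (range (\<lambda>i. pderivative i F))"
    for c and F :: "6 cpoly"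
  proof (intro cp.span_minimal cp.subspace_span subsetI, elim rangeE)
    fix p i assume "p = pderivative i (Const c * F)"
    then have "p = Const c * pderivative i F" by (simp add: pderivative_mult)
    then show "p \<in> cp.span (range (\<lambda>i. pderivative i F))"
      by (simp only:) (intro cp.span_scale cp.span_base rangeI)
  qed
  have "Const (1 / c) * (Const c * F) = Const (1 / c * c) * F" by (simp only: Const_mult mult.assoc)
  then have "Const (1 / c) * (Const c * F) = F" using assms by simp
  with sub[of "1 / c" "Const c * F"] sub[of c F] show ?thesis by auto
qed

theorem jacobian_space_of_good_frame:
  assumes s: "determines_cubics s" "not_cone s" and U: "U = vec.span (range (frame s))"
  shows "(\<exists>F. quartic_equation F (Palatini U)) \<and> cp.dim (H0 (singular_curve U) 3) = 6 \<and>
    (\<forall>F A. quartic_equation F (Palatini U) \<and> invertible A \<longrightarrow> H0 (singular_curve U) 3 = jacobian_space A F)"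
proof -
  obtain F where F: "homogeneous 4 F" "minor (frame s) base_columns = Var 0 * F"
    "\<forall>i j. i \<notin> range j \<longrightarrow> inj j \<longrightarrow> minor (frame s) j = Var i * F \<or> minor (frame s) j = - (Var i * F)"
    using minors_divisible[of "frame s" base_columns, OF frame_alternating base_columns_inj base_columns_missing]
    by (elim exE conjE) (rule that)
  have F3: "\<And>i j. i \<notin> range j \<Longrightarrow> inj j \<Longrightarrow> minor (frame s) j = Var i * F \<or> minor (frame s) j = - (Var i * F)"
    using F(3) by blast
  have V: "H0 (singular_curve U) 3 = cp.span (range (\<lambda>i. pderivative i F))"
    unfolding U by (rule cubic_sections_spanned(1)[OF s F(1,2)]) (rule F3)
  have dim: "cp.dim (H0 (singular_curve U) 3) = 6"
    unfolding U by (rule cubic_sections_spanned(2)[OF s F(1,2)]) (rule F3)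
  have P: "Palatini U = hypersurface F" unfolding U by (rule Palatini_hypersurface[OF F3])
  have "F \<noteq> 0"
  proof
    assume "F = 0"
    then have "(\<Sum>i\<in>UNIV. Const ((\<lambda>_. 1) i) * pderivative i F) = 0" by simp
    from partials_independent[OF s(2) F(2) this] show False by simp
  qed
  then have q: "quartic_equation F (Palatini U)"
    using F(1) P by (simp add: quartic_equation_def)
  have "H0 (singular_curve U) 3 = jacobian_space A F'"
    if F': "quartic_equation F' (Palatini U)" and A: "invertible A" for F' A
  proof -
    obtain c where c: "c \<noteq> 0" "F' = Const c * F"
      using hypersurface_equation_unique[of F 4 F'] F' q unfolding quartic_equation_def by auto
    have "jacobian_space A F' = cp.span (range (\<lambda>i. pderivative i F))"
      unfolding jacobian_space_eq[OF A] c(2) by (rule span_partials_Const_mult[OF c(1)])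
    then show ?thesis using V by simp
  qed
  then show ?thesis using q dim by blast
qed

section \<open>Open sets in the grassmannian\<close>

text \<open>If the five forms were dependent, \<open>point_minor\<close> would vanish identically and every vector would be
  a vertex.\<close>

lemma frame_independent:
  assumes s: "not_cone s"
  shows "inj (frame s)" "vec.independent (range (frame s))"
proof -
  have rel: "g = (\<lambda>_. 0)" if g: "(\<Sum>l\<in>UNIV. g l *s frame s l) = 0" for g
  proof (rule ccontr)
    assume ne: "g \<noteq> (\<lambda>_. 0)"
    have e: "(\<Sum>l\<in>UNIV. g l * entry s l j i) = 0" for i j
    proof -
      have "(\<Sum>l\<in>UNIV. g l *s frame s l) $ (i, j) = 0" using g by simp
      then show ?thesis by (simp add: sum_component)
    qed
    have "point_minor s x = 0" for x
      unfolding point_minor_def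
    proof (rule det_zero_of_left_kernel)
      show "(\<chi> l. g l) \<noteq> 0" using ne by (auto simp: vec_eq_iff)
      fix b
      have "(\<Sum>l\<in>UNIV. g l * (\<Sum>i\<in>UNIV. entry s l (base_columns b) i * x i)) =
          (\<Sum>i\<in>UNIV. (\<Sum>l\<in>UNIV. g l * entry s l (base_columns b) i) * x i)"
        unfolding sum_distrib_left sum_distrib_right mult.assoc by (rule sum.swap)
      then show "(\<Sum>a\<in>UNIV. (\<chi> l. g l) $ a * (\<chi> l c. \<Sum>i\<in>UNIV. entry s l (base_columns c) i * x i) $ a $ b) = 0"
        by (simp add: e)
    qed
    then have "vertex s (\<lambda>_. 1)" by (simp add: vertex_def)
    then show False using s unfolding not_cone_def by (metis zero_neq_one)
  qed
  show inj: "inj (frame s)"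
  proof (rule injI, rule ccontr)
    fix i k assume eq: "frame s i = frame s k" and ne: "i \<noteq> k"
    define b :: "5 \<Rightarrow> complex" where "b l = (if l = i then 1 else 0) - (if l = k then 1 else 0)" for l
    have "(\<Sum>l\<in>UNIV. b l *s frame s l) =
        (\<Sum>l\<in>UNIV. (if l = i then frame s i else 0) - (if l = k then frame s k else 0))"
      by (intro sum.cong refl) (auto simp: b_def)
    also have "\<dots> = 0" by (simp add: sum_subtractf eq)
    finally have "b = (\<lambda>_. 0)" by (rule rel)
    then have "b i = 0" by simp
    then show False using ne by (simp add: b_def)
  qed
  show "vec.independent (range (frame s))"
  proof
    assume "vec.dependent (range (frame s))"
    then obtain u v where u: "v \<in> range (frame s)" "u v \<noteq> 0" "(\<Sum>v\<in>range (frame s). u v *s v) = 0"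
      by (auto simp: vec.dependent_finite)
    have "(\<Sum>l\<in>UNIV. u (frame s l) *s frame s l) = 0" using u(3) by (simp add: sum.reindex[OF inj])
    then have "(\<lambda>l. u (frame s l)) = (\<lambda>_. 0)" by (rule rel)
    then have "u (frame s l) = 0" for l by (simp add: fun_eq_iff)
    then show False using u(1,2) by auto
  qed
qed

lemma frame_span:
  assumes s: "not_cone s" and U: "U \<in> Gr5" "range (frame s) \<subseteq> U"
  shows "U = vec.span (range (frame s))"
proof
  have "vec.subspace U" "vec.dim U = 5" using U(1) by (auto simp: Gr5_def)
  then show "vec.span (range (frame s)) \<subseteq> U" using U(2) vec.span_minimal by blast
  have "card (range (frame s)) = 5" using frame_independent(1)[OF s] by (simp add: card_image)
  then show "U \<subseteq> vec.span (range (frame s))"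
    using U(2) frame_independent(2)[OF s] \<open>vec.dim U = 5\<close>
    by (intro vec.card_ge_dim_independent) auto
qed

lemma frame_span_in_Gr5:
  assumes s: "not_cone s"
  shows "vec.span (range (frame s)) \<in> Gr5"
proof -
  have "vec.subspace alternating_forms"
  proof (rule vec.subspaceI)
    show "0 \<in> alternating_forms" by (simp add: alternating_forms_def)
  next
    fix u v assume "u \<in> alternating_forms" "v \<in> alternating_forms"
    then have u: "u $ (j, i) = - u $ (i, j)" and v: "v $ (j, i) = - v $ (i, j)" for i j
      unfolding alternating_forms_def by blast+
    have "(u + v) $ (j, i) = - (u + v) $ (i, j)" for i j
      unfolding vector_add_component u[where i = i and j = j] v[where i = i and j = j] by (rule minus_add_distrib[symmetric])
    then show "u + v \<in> alternating_forms" unfolding alternating_forms_def by blast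
  next
    fix c u assume "u \<in> alternating_forms"
    then have u: "u $ (j, i) = - u $ (i, j)" for i j unfolding alternating_forms_def by blast
    have "(c *s u) $ (j, i) = - (c *s u) $ (i, j)" for i j
      unfolding vector_smult_component u[where i = i and j = j] by (rule mult_minus_right)
    then show "c *s u \<in> alternating_forms" unfolding alternating_forms_def by blast
  qed
  then have "vec.span (range (frame s)) \<subseteq> alternating_forms"
    by (intro vec.span_minimal) (auto intro: frame_alternating)
  moreover have "vec.dim (vec.span (range (frame s))) = 5"
    using vec.dim_span_eq_card_independent[OF frame_independent(2)[OF s]] frame_independent(1)[OF s]
    by (simp add: card_image)
  ultimately show ?thesis by (simp add: Gr5_def vec.subspace_span)
qed

lemma good_depends_on_entries:
  assumes "entry s = entry s'"
  shows "determines_cubics s = determines_cubics s'" "not_cone s = not_cone s'"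
  using assms unfolding determines_cubics_def cubic_vanishes_def in_pencil_kernel_def not_cone_def vertex_def point_minor_def
  by simp_all

text \<open>The polynomial \<open>h\<close> found on the space of arrays may depend on the symmetric parts, which the forms
  do not see. To get one that depends only on the forms, the symmetric part of \<open>s\<close> is replaced by
  that of an array \<open>s1\<close> at which \<open>h\<close> does not vanish.\<close>

lemma generic_entries:
  obtains H where "H \<in> polyfun" "\<exists>s. H s \<noteq> 0" "\<And>s. H s \<noteq> 0 \<Longrightarrow> determines_cubics s \<and> not_cone s"
    "\<And>s s'. entry s = entry s' \<Longrightarrow> H s = H s'"
proof -
  obtain h s1 where h: "h \<in> polyfun" "h s1 \<noteq> 0" "\<And>s. h s \<noteq> 0 \<Longrightarrow> determines_cubics s \<and> not_cone s"
    using generic_frame by blast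
  define shift where "shift s = (\<lambda>(l, i, j). (entry s l j i + (s1 (l, i, j) + s1 (l, j, i))) / 2)" for s
  have shift_entry: "entry (shift s) = entry s" for s
    by (auto simp: fun_eq_iff entry_def shift_def field_simps)
  have "shift s1 = s1" by (auto simp: fun_eq_iff shift_def entry_def)
  then have "h (shift s1) \<noteq> 0" using h(2) by simp
  moreover have "(\<lambda>s. h (shift s)) \<in> polyfun"
  proof (rule polyfun_comp[OF h(1)])
    fix v :: "5 \<times> 6 \<times> 6"
    obtain l i j where "v = (l, i, j)" by (metis prod_cases3)
    then have "(\<lambda>s. shift s v) = (\<lambda>s. (s (l, i, j) - s (l, j, i) + (s1 (l, i, j) + s1 (l, j, i))) * (1 / 2))"
      by (simp add: shift_def entry_def)
    also have "\<dots> \<in> polyfun" by (intro polyfun_mult polyfun_add polyfun_diff polyfun_coord polyfun_const)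
    finally show "(\<lambda>s. shift s v) \<in> polyfun" .
  qed
  moreover have "determines_cubics s \<and> not_cone s" if "h (shift s) \<noteq> 0" for s
    using h(3)[OF that] good_depends_on_entries[OF shift_entry] by blast
  moreover have "h (shift s) = h (shift s')" if "entry s = entry s'" for s s'
    by (simp add: shift_def that)
  ultimately show thesis using that[of "\<lambda>s. h (shift s)"] by blast
qed

theorem corollary1p3:
  shows "for_general (\<lambda>U.
           (\<exists>F. quartic_equation F (Palatini U)) \<and>
           cp.dim (H0 (singular_curve U) 3) = 6 \<and>
           (\<forall>F A. quartic_equation F (Palatini U) \<and> invertible A \<longrightarrow>
              H0 (singular_curve U) 3 = jacobian_space A F))"
proof -
  obtain H where H: "H \<in> polyfun" "\<exists>s. H s \<noteq> 0" "\<And>s. H s \<noteq> 0 \<Longrightarrow> determines_cubics s \<and> not_cone s"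
    "\<And>s s'. entry s = entry s' \<Longrightarrow> H s = H s'"
    by (rule generic_entries) (rule that)
  \<comment> \<open>The members of \<open>S\<close> are spanned by some good frame. With respect to a spanning family \<open>w\<close>, this
    frame is given by a matrix \<open>g\<close>, so the polynomials that detect membership are indexed by \<open>g\<close>.
    The division by \<open>2\<close> in \<open>mix\<close> is there because antisymmetrizing an alternating matrix doubles
    it.\<close>
  define S where "S = {U \<in> Gr5. \<exists>s. H s \<noteq> 0 \<and> range (frame s) \<subseteq> U}"
  define mix :: "(5 \<Rightarrow> 5 \<Rightarrow> complex) \<Rightarrow> (5 \<times> 6 \<times> 6 \<Rightarrow> complex) \<Rightarrow> 5 \<times> 6 \<times> 6 \<Rightarrow> complex" where
    "mix g v = (\<lambda>(l, i, j). \<Sum>k\<in>UNIV. g l k / 2 * v (k, i, j))" for g v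
  have "(\<lambda>v. H (mix g v)) \<in> polyfun" for g
  proof (rule polyfun_comp[OF H(1)])
    fix v :: "5 \<times> 6 \<times> 6"
    obtain l i j where "v = (l, i, j)" by (metis prod_cases3)
    then have "(\<lambda>s. mix g s v) = (\<lambda>s. \<Sum>k\<in>UNIV. g l k / 2 * s (k, i, j))" by (simp add: mix_def)
    also have "\<dots> \<in> polyfun" by (intro polyfun_sum polyfun_mult polyfun_coord polyfun_const)
    finally show "(\<lambda>s. mix g s v) \<in> polyfun" .
  qed
  then have "\<forall>g. \<exists>P :: (5 \<times> 6 \<times> 6) cpoly. \<forall>v. eval v P = H (mix g v)" using polyfun_eval by blast
  then obtain P :: "(5 \<Rightarrow> 5 \<Rightarrow> complex) \<Rightarrow> (5 \<times> 6 \<times> 6) cpoly" where P: "\<And>g v. eval v (P g) = H (mix g v)" by metis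
  have frame_mix: "frame (mix g (\<lambda>(k, ij). w k $ ij)) l = (\<Sum>k\<in>UNIV. g l k *s w k)"
    if w: "\<And>k. w k \<in> alternating_forms" for w g l
    unfolding vec_eq_iff
  proof
    fix ij :: "6 \<times> 6"
    obtain i j where ij: "ij = (i, j)" by fastforce
    have alt: "w k $ (j, i) = - w k $ (i, j)" for k using w[of k] unfolding alternating_forms_def by blast
    have "frame (mix g (\<lambda>(k, ij). w k $ ij)) l $ (i, j) = (\<Sum>k\<in>UNIV. g l k / 2 * w k $ (i, j) - g l k / 2 * w k $ (j, i))"
      by (simp add: entry_def mix_def sum_subtractf)
    also have "\<dots> = (\<Sum>k\<in>UNIV. g l k * w k $ (i, j))"
    proof (rule sum.cong[OF refl])
      fix k
      show "g l k / 2 * w k $ (i, j) - g l k / 2 * w k $ (j, i) = g l k * w k $ (i, j)"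
        unfolding alt[of k] by simp
    qed
    finally show "frame (mix g (\<lambda>(k, ij). w k $ ij)) l $ ij = (\<Sum>k\<in>UNIV. g l k *s w k) $ ij"
      by (simp add: ij sum_component)
  qed
  have open_S: "zariski_open_Gr5 S"
    unfolding zariski_open_Gr5_def
  proof (intro conjI exI[of _ "range P"] allI impI)
    show "S \<subseteq> Gr5" by (auto simp: S_def)
    fix w :: "5 \<Rightarrow> complex ^ (6 \<times> 6)"
    assume w: "vec.span (range w) \<in> Gr5"
    have alt: "w k \<in> alternating_forms" for k
      using w vec.span_superset[of "range w"] by (auto simp: Gr5_def)
    show "vec.span (range w) \<in> S \<longleftrightarrow> (\<exists>p\<in>range P. eval (\<lambda>(k, ij). w k $ ij) p \<noteq> 0)"
    proof
      assume "vec.span (range w) \<in> S"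
      then obtain s where s: "H s \<noteq> 0" "range (frame s) \<subseteq> vec.span (range w)" by (auto simp: S_def)
      then have "\<forall>l. \<exists>g. frame s l = (\<Sum>k\<in>UNIV. g k *s w k)" using span_range_combination by blast
      then obtain g where g: "\<And>l. frame s l = (\<Sum>k\<in>UNIV. g l k *s w k)" by metis
      have "entry (mix g (\<lambda>(k, ij). w k $ ij)) = entry s"
      proof (intro ext)
        fix l j i
        have "frame (mix g (\<lambda>(k, ij). w k $ ij)) l $ (i, j) = frame s l $ (i, j)"
          by (simp only: frame_mix[OF alt] g)
        then show "entry (mix g (\<lambda>(k, ij). w k $ ij)) l j i = entry s l j i" by simp
      qed
      then have "H (mix g (\<lambda>(k, ij). w k $ ij)) \<noteq> 0" using H(4) s(1) by metis
      then show "\<exists>p\<in>range P. eval (\<lambda>(k, ij). w k $ ij) p \<noteq> 0" using P by (intro bexI[of _ "P g"]) auto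
    next
      assume "\<exists>p\<in>range P. eval (\<lambda>(k, ij). w k $ ij) p \<noteq> 0"
      then obtain g where "H (mix g (\<lambda>(k, ij). w k $ ij)) \<noteq> 0" using P by auto
      moreover have "frame (mix g (\<lambda>(k, ij). w k $ ij)) l \<in> vec.span (range w)" for l
        unfolding frame_mix[OF alt] by (intro vec.span_sum vec.span_scale vec.span_base) auto
      ultimately show "vec.span (range w) \<in> S" using w unfolding S_def by blast
    qed
  qed
  moreover have "S \<noteq> {}"
  proof -
    obtain s where "H s \<noteq> 0" using H(2) ..
    then have "vec.span (range (frame s)) \<in> S"
      unfolding S_def using frame_span_in_Gr5 H(3) vec.span_superset by blast
    then show ?thesis by blast
  qed
  moreover have "(\<exists>F. quartic_equation F (Palatini U)) \<and> cp.dim (H0 (singular_curve U) 3) = 6 \<and>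
    (\<forall>F A. quartic_equation F (Palatini U) \<and> invertible A \<longrightarrow> H0 (singular_curve U) 3 = jacobian_space A F)"
    if U: "U \<in> S" for U
  proof -
    obtain s where s: "H s \<noteq> 0" "U \<in> Gr5" "range (frame s) \<subseteq> U" using U unfolding S_def by blast
    have good: "determines_cubics s" "not_cone s" using H(3)[OF s(1)] by blast+
    show ?thesis by (rule jacobian_space_of_good_frame[OF good frame_span[OF good(2) s(2,3)]])
  qed
  ultimately show ?thesis unfolding for_general_def by blast
qed

end
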